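(* Let $C$ be a reduced curve in the complex projective plane $\mathbb{P}^2$ of degree $d\geq 3$, no irreducible component of which is a line, and suppose $C$ has exactly $s$ singular points. Then $$i(C)\leq 3d(d-2)-6s.$$ More precisely, if $n_k$ denotes the number of singular points of $C$ of multiplicity $k$, then $$i(C)\leq 3d(d-2)-\sum_k 3k(k-1)n_k,$$ and equality in this last inequality occurs if and only if all the singularities of $C$ are ordinary simple $k$-multiple points, for various $k$.
   Context: For a smooth point $p\in C$ with projective tangent line $T_pC$, the inflection order is $\iota_p(C)=(C,T_pC)_p-2$, where $(C,T_pC)_p$ is the intersection multiplicity at $p$; $p$ is an inflection point if $\iota_p(C)>0$. Let $I_C$ be the set of inflection points of $C$ (all of which are smooth points of $C$). Then $i(C)=\sum_{p\in I_C}\iota_p(C)$. A singular point $p$ of $C$ is an ordinary $k$-multiple point if the germ $(C,p)$ consists of $k$ smooth branches $C_1,\ldots,C_k$ with pairwise distinct tangent lines $L_1,\ldots,L_k$ at $p$. It is an ordinary simple $k$-multiple point if moreover $(C_j,L_j)_p=2$ for all $j\in\{1,\ldots,k\}$. *)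

theory Defs
  imports
    "HOL-Analysis.Analysis"
    "HOL-Computational_Algebra.Computational_Algebra"
    "HOL-Library.Extended_Nat"
begin

unbundle no fps_syntax

section \<open>Ternary forms\<close>

text \<open>
  Polynomials in $X, Y, Z$ are elements of $\mathbb{C}[X][Y][Z]$: the outermost variable is $Z$,
  the innermost one is $X$.
\<close>

type_synonym poly3 = "complex poly poly poly"

definition coeff3 :: "poly3 \<Rightarrow> nat \<Rightarrow> nat \<Rightarrow> nat \<Rightarrow> complex" where
  "coeff3 F i j k = coeff (coeff (coeff F k) j) i"

definition homogeneous :: "nat \<Rightarrow> poly3 \<Rightarrow> bool" where
  "homogeneous d F \<longleftrightarrow> (\<forall>i j k. coeff3 F i j k \<noteq> 0 \<longrightarrow> i + j + k = d)"

text \<open>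
  Substitution of \<open>a, b, c\<close> for $X, Y, Z$ in a ring to which the complex numbers are mapped by
  \<open>\<phi>\<close>.
\<close>

definition eval3 :: "(complex \<Rightarrow> 'r::comm_ring_1) \<Rightarrow> poly3 \<Rightarrow> 'r \<Rightarrow> 'r \<Rightarrow> 'r \<Rightarrow> 'r" where
  "eval3 \<phi> F a b c =
     poly (map_poly (\<lambda>G. poly (map_poly (\<lambda>H. poly (map_poly \<phi> H) a) G) b) F) c"

definition value_at :: "poly3 \<Rightarrow> complex ^ 3 \<Rightarrow> complex" where
  "value_at F v = eval3 (\<lambda>c. c) F (v $ 1) (v $ 2) (v $ 3)"

definition gradient :: "poly3 \<Rightarrow> complex ^ 3 \<Rightarrow> complex ^ 3" where
  "gradient F v =
     vector [value_at (map_poly (map_poly pderiv) F) v,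
             value_at (map_poly pderiv F) v,
             value_at (pderiv F) v]"

text \<open>The linear form $a_1 X + a_2 Y + a_3 Z$.\<close>

definition linear_form :: "complex ^ 3 \<Rightarrow> poly3" where
  "linear_form a = [: [: [:0, a $ 1:], [:a $ 2:] :], [: [:a $ 3:] :] :]"


section \<open>The projective plane\<close>

definition proj_rel :: "((complex ^ 3) \<times> (complex ^ 3)) set" where
  "proj_rel = {(u, v). u \<noteq> 0 \<and> v \<noteq> 0 \<and> (\<exists>c. v = c *s u)}"

definition proj_plane :: "(complex ^ 3) set set" where
  "proj_plane = (UNIV - {0}) // proj_rel"

text \<open>Homogeneous coordinates of a point.\<close>

definition coords :: "(complex ^ 3) set \<Rightarrow> complex ^ 3" where
  "coords p = (SOME v. v \<in> p)"


section \<open>Plane germs\<close>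

text \<open>
  Germs at the origin of the plane with local coordinates $s, t$ are described by their equations
  in $\mathbb{C}[[s]][[t]] = \mathbb{C}[[s,t]]$, with inner variable $s$ and outer variable $t$.
\<close>

type_synonym germ = "complex fps fps"

definition germ_const :: "complex \<Rightarrow> germ" where
  "germ_const c = fps_const (fps_const c)"

definition germ_s :: germ where "germ_s = fps_const fps_X"

definition germ_t :: germ where "germ_t = fps_X"

definition germ_coeff :: "germ \<Rightarrow> nat \<Rightarrow> nat \<Rightarrow> complex" where
  "germ_coeff f i j = fps_nth (fps_nth f j) i"

definition germ_mult :: "germ \<Rightarrow> nat" where
  "germ_mult f = (LEAST m. \<exists>i j. i + j = m \<and> germ_coeff f i j \<noteq> 0)"

interpretation germ: vector_space "\<lambda>c f. germ_const c * f"
  by unfold_locales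
     (simp_all add: germ_const_def algebra_simps
       flip: fps_const_add fps_const_mult)

text \<open>
  Intersection multiplicity of two germs: the dimension of the complex vector space
  $\mathbb{C}[[s,t]]/(f,g)$, that is, the least number of elements spanning $\mathbb{C}[[s,t]]$
  modulo the ideal $(f,g)$ (infinite if there is no finite spanning set).
\<close>

definition germ_int_mult :: "germ \<Rightarrow> germ \<Rightarrow> enat" where
  "germ_int_mult f g =
     (INF B \<in> {B. finite B \<and> germ.span (B \<union> {a * f + b * g | a b. True}) = UNIV}. enat (card B))"

definition smooth_germ :: "germ \<Rightarrow> bool" where
  "smooth_germ f \<longleftrightarrow> germ_coeff f 0 0 = 0 \<and> (germ_coeff f 1 0 \<noteq> 0 \<or> germ_coeff f 0 1 \<noteq> 0)"

text \<open>The tangent line of a smooth germ, as a set of points and by its equation.\<close>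

definition germ_tangent :: "germ \<Rightarrow> (complex \<times> complex) set" where
  "germ_tangent f = {(x, y). germ_coeff f 1 0 * x + germ_coeff f 0 1 * y = 0}"

definition germ_tangent_eq :: "germ \<Rightarrow> germ" where
  "germ_tangent_eq f = germ_const (germ_coeff f 1 0) * germ_s + germ_const (germ_coeff f 0 1) * germ_t"

text \<open>
  The germ $f = 0$ consists of the \<open>k\<close> smooth branches \<open>C 0, \<dots>, C (k - 1)\<close>, whose tangent lines are
  pairwise distinct. As an equation is only determined up to a unit, so is the product of the
  equations of the branches.
\<close>

definition transversal_branches :: "germ \<Rightarrow> nat \<Rightarrow> (nat \<Rightarrow> germ) \<Rightarrow> bool" where
  "transversal_branches f k C \<longleftrightarrow>
     (\<forall>j<k. smooth_germ (C j)) \<and>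
     inj_on (\<lambda>j. germ_tangent (C j)) {..<k} \<and>
     (\<exists>u. u dvd 1 \<and> f = u * (\<Prod>j<k. C j))"


section \<open>Plane curves\<close>

text \<open>
  The germ at a point $(x:y:z)$ of the curve $F = 0$: its equation in the affine chart
  $z \neq 0$, $y \neq 0$ or $x \neq 0$ (the first of these containing the point), with the
  coordinates translated to the point.
\<close>

definition local_eq :: "poly3 \<Rightarrow> complex ^ 3 \<Rightarrow> germ" where
  "local_eq F v =
     (let x = v $ 1; y = v $ 2; z = v $ 3; ev = eval3 germ_const F in
      if z \<noteq> 0 then ev (germ_const (x / z) + germ_s) (germ_const (y / z) + germ_t) 1
      else if y \<noteq> 0 then ev (germ_const (x / y) + germ_s) 1 (germ_const (z / y) + germ_t)
      else ev 1 (germ_const (y / x) + germ_s) (germ_const (z / x) + germ_t))"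

lemma local_eq_scale: "c \<noteq> 0 \<Longrightarrow> local_eq F (c *s v) = local_eq F v"
  by (simp add: local_eq_def Let_def)

definition germ_at :: "poly3 \<Rightarrow> (complex ^ 3) set \<Rightarrow> germ" where
  "germ_at F p = local_eq F (coords p)"

lemma germ_at_eq:
  assumes "p \<in> proj_plane" and "v \<in> p"
  shows "germ_at F p = local_eq F v"
proof -
  obtain u where u: "p = proj_rel `` {u}" and "u \<noteq> 0"
    using assms(1) unfolding proj_plane_def by (auto elim!: quotientE)
  have "local_eq F w = local_eq F u" if "w \<in> p" for w
    using that local_eq_scale[of _ F u] unfolding u proj_rel_def by auto
  moreover have "coords p \<in> p"
    unfolding coords_def using assms(2) by (rule someI)
  ultimately show ?thesis
    using assms(2) by (simp add: germ_at_def)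
qed

definition curve_points :: "poly3 \<Rightarrow> (complex ^ 3) set set" where
  "curve_points F = {p \<in> proj_plane. \<forall>v\<in>p. value_at F v = 0}"

definition singular_points :: "poly3 \<Rightarrow> (complex ^ 3) set set" where
  "singular_points F = {p \<in> curve_points F. \<forall>v\<in>p. gradient F v = 0}"

definition multiplicity_at :: "poly3 \<Rightarrow> (complex ^ 3) set \<Rightarrow> nat" where
  "multiplicity_at F p = germ_mult (germ_at F p)"

definition int_mult :: "poly3 \<Rightarrow> poly3 \<Rightarrow> (complex ^ 3) set \<Rightarrow> enat" where
  "int_mult F G p = germ_int_mult (germ_at F p) (germ_at G p)"

definition tangent_line :: "poly3 \<Rightarrow> (complex ^ 3) set \<Rightarrow> poly3" where
  "tangent_line F p = linear_form (gradient F (coords p))"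

text \<open>
  The intersection multiplicity below is finite unless the tangent line is a component of the curve.
\<close>

definition inflection_order :: "poly3 \<Rightarrow> (complex ^ 3) set \<Rightarrow> int" where
  "inflection_order F p = int (the_enat (int_mult F (tangent_line F p) p)) - 2"

definition inflection_points :: "poly3 \<Rightarrow> (complex ^ 3) set set" where
  "inflection_points F = {p \<in> curve_points F - singular_points F. inflection_order F p > 0}"

definition total_inflection :: "poly3 \<Rightarrow> int" where
  "total_inflection F = (\<Sum>p\<in>inflection_points F. inflection_order F p)"

definition ordinary_simple_multiple_point :: "poly3 \<Rightarrow> nat \<Rightarrow> (complex ^ 3) set \<Rightarrow> bool" where
  "ordinary_simple_multiple_point F k p \<longleftrightarrow>
     p \<in> singular_points F \<and>
     (\<exists>C. transversal_branches (germ_at F p) k C \<and>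
          (\<forall>j<k. germ_int_mult (C j) (germ_tangent_eq (C j)) = 2))"

text \<open>
  A curve is given by an equation, so a reduced curve is given by a squarefree one, and its
  irreducible components are the irreducible factors of the equation.
\<close>

definition reduced_curve :: "nat \<Rightarrow> poly3 \<Rightarrow> bool" where
  "reduced_curve d F \<longleftrightarrow> homogeneous d F \<and> squarefree F"

definition is_component :: "poly3 \<Rightarrow> poly3 \<Rightarrow> bool" where
  "is_component G F \<longleftrightarrow> irreducible G \<and> G dvd F"

definition is_line :: "poly3 \<Rightarrow> bool" where
  "is_line G \<longleftrightarrow> (\<exists>a. a \<noteq> 0 \<and> G = linear_form a)"

end

theory Submission imports Defs begin

text \<open>
  The curve $F = 0$ is compared with its Hessian $H$, but without Bezout's theorem. Project from a centre
  $p$ in general position, and let $r$ be the product of the values of $H$ at the $d$ points of the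
  curve on a moving line through $p$. By Newton's identities $r$ is a polynomial in the parameter of
  the line, and by homogeneity its degree is $3d(d-2)$ if $H$ has no zero on the curve at infinity. The
  order of $r$ at a zero is found from limits of $H$ along sequences of points of the curve.

  By Euler's relations, $H$ is on the curve, up to a nonzero factor, the affine expression
  $f_{xx} f_y^2 - 2 f_{xy} f_x f_y + f_{yy} f_x^2$. Hence a smooth point contributes exactly its inflection
  order. At an $m$-fold point let $f_m$ and $f_{m+1}$ be the homogeneous parts of degrees $m$ and
  $m + 1$ of the local equation. Along points of the curve whose directions tend to $w$, a root of $f_m$, the
  expression has order at least $3(m-1)$, and its coefficient of that order is
  $2 f_{m+1}(w) (\partial_u f_m(w))^2$ for a transversal direction $u$. So the point contributes at least
  $3m(m-1)$, with equality iff every root of $f_m$ is simple and is not a root of $f_{m+1}$. By Hensel's lemma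
  this means that the point is an ordinary simple $m$-multiple point.
\<close>

no_notation fps_nth (infixl "$" 75)

section \<open>Evaluation of ternary forms\<close>

text \<open>Local intersection numbers of the curve with $H$ would require a theory of branches at
  arbitrary singularities. The order of a zero of a polynomial in one variable is instead determined
  by its growth along a single sequence, and along a sequence the points of the curve can be
  followed by compactness: the leading coefficient on the moving line is fixed, so the roots stay
  bounded, and on a subsequence they and their slopes at singular points converge. At an $m$-fold
  point $m$ roots come together, each with exponent $3(m-1)$; this is the origin of $3m(m-1)$. The
  bound $3d(d-2)$ is $d$ points on a line times the degree $3(d-2)$ of $H$. The centre is kept off
  the curve and off the tangent cones of the finitely many singular points, while tangents at smooth
  points may pass through it; there the exponents of the single roots become fractions. That some
  line through the centre can serve as the line at infinity, with $H$ nonzero at its points of the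
  curve, follows from the same local limit applied near a line that misses all singular
  points.\<close>

definition is_hom :: "('a::comm_ring_1 \<Rightarrow> 'b::comm_ring_1) \<Rightarrow> bool" where
  "is_hom h \<longleftrightarrow> h 0 = 0 \<and> h 1 = 1 \<and> (\<forall>a b. h (a + b) = h a + h b) \<and> (\<forall>a b. h (a * b) = h a * h b)"

lemma is_homI:
  assumes "h 0 = 0" "h 1 = 1" "\<And>a b. h (a + b) = h a + h b" "\<And>a b. h (a * b) = h a * h b"
  shows "is_hom h"
  using assms by (auto simp: is_hom_def)

lemma is_hom_simps:
  assumes "is_hom h"
  shows "h 0 = 0" "h 1 = 1" "h (a + b) = h a + h b" "h (a * b) = h a * h b"
  using assms by (auto simp: is_hom_def)

lemma is_hom_uminus:
  assumes "is_hom h"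
  shows "h (- a) = - h a"
proof -
  have "h a + h (- a) = h (a + - a)" by (simp only: is_hom_simps(3)[OF assms])
  also have "\<dots> = 0" by (simp add: is_hom_simps(1)[OF assms])
  finally show ?thesis by (simp add: eq_neg_iff_add_eq_0 add.commute)
qed

lemma is_hom_diff:
  assumes "is_hom h"
  shows "h (a - b) = h a - h b"
  using is_hom_simps(3)[OF assms, of a "- b"] by (simp add: is_hom_uminus[OF assms])

lemma is_hom_power: "is_hom h \<Longrightarrow> h (a ^ n) = h a ^ n"
  by (induction n) (auto simp: is_hom_simps)

lemma is_hom_sum: "is_hom h \<Longrightarrow> h (sum f A) = (\<Sum>x\<in>A. h (f x))"
  by (induction A rule: infinite_finite_induct) (auto simp: is_hom_simps)

lemma is_hom_prod: "is_hom h \<Longrightarrow> h (prod f A) = (\<Prod>x\<in>A. h (f x))"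
  by (induction A rule: infinite_finite_induct) (auto simp: is_hom_simps)

lemma is_hom_comp: "is_hom f \<Longrightarrow> is_hom g \<Longrightarrow> is_hom (\<lambda>x. f (g x))"
  by (auto simp: is_hom_def)

lemma is_hom_id: "is_hom (\<lambda>x. x)"
  by (auto simp: is_hom_def)

lemma is_hom_poly: "is_hom (\<lambda>p. poly p x)"
  by (auto simp: is_hom_def)

lemma is_hom_pCons: "is_hom (\<lambda>c. [:c:])"
  by (rule is_homI) (auto simp: one_pCons)

lemma is_hom_fps_const: "is_hom fps_const"
  by (auto simp: is_hom_def)

lemma is_hom_fps_of_poly: "is_hom fps_of_poly"
  by (auto simp: is_hom_def fps_of_poly_add fps_of_poly_mult)

lemma is_hom_map_poly:
  assumes h: "is_hom h"
  shows "is_hom (map_poly h)"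
proof (rule is_homI)
  show "map_poly h (p * q) = map_poly h p * map_poly h q" for p q
    by (rule poly_eqI)
       (simp add: coeff_map_poly coeff_mult is_hom_simps[OF h] is_hom_sum[OF h])
  show "map_poly h 1 = 1"
    by (simp add: is_hom_simps[OF h])
  show "map_poly h (p + q) = map_poly h p + map_poly h q" for p q
    by (rule poly_eqI) (simp add: coeff_map_poly is_hom_simps[OF h])
qed simp

lemma map_poly_hom_pCons: "is_hom h \<Longrightarrow> map_poly h (pCons a p) = pCons (h a) (map_poly h p)"
  by (rule poly_eqI) (auto simp: coeff_map_poly coeff_pCons is_hom_simps split: nat.splits)

lemma poly_map_poly_hom:
  assumes "is_hom h" "g 0 = 0"
  shows "h (poly (map_poly g p) x) = poly (map_poly (\<lambda>y. h (g y)) p) (h x)"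
  by (induction p) (auto simp: map_poly_pCons assms is_hom_simps)

text \<open>Naturality of substitution. Values, restrictions to lines and local equations are all
  instances of \<open>eval3\<close>, and they are compared with each other through this
  fact.\<close>

lemma eval3_hom:
  assumes h: "is_hom h" and "\<phi> 0 = 0"
  shows "h (eval3 \<phi> F a b c) = eval3 (\<lambda>x. h (\<phi> x)) F (h a) (h b) (h c)"
  unfolding eval3_def using assms by (simp add: poly_map_poly_hom[OF h])

lemma is_hom_poly_map: "is_hom h \<Longrightarrow> is_hom (\<lambda>p. poly (map_poly h p) x)"
  using is_hom_comp[OF is_hom_poly is_hom_map_poly] .

lemma is_hom_eval3: "is_hom \<phi> \<Longrightarrow> is_hom (\<lambda>F. eval3 \<phi> F a b c)"
  unfolding eval3_def by (intro is_hom_poly_map)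

lemma is_hom_value_at: "is_hom (\<lambda>F. value_at F v)"
  unfolding value_at_def by (rule is_hom_eval3[OF is_hom_id])

definition const3 :: "complex \<Rightarrow> poly3" where
  "const3 c = [:[:[:c:]:]:]"

lemma eval3_const3: "is_hom \<phi> \<Longrightarrow> eval3 \<phi> (const3 k) a b c = \<phi> k"
  by (simp add: eval3_def const3_def map_poly_pCons is_hom_simps)

section \<open>Expansion into monomials\<close>

lemma poly_as_sum_le: "degree p \<le> N \<Longrightarrow> poly p (x :: 'a :: comm_ring_1) = (\<Sum>k\<le>N. coeff p k * x ^ k)"
  unfolding poly_altdef
  by (rule sum.mono_neutral_left) (auto simp: coeff_eq_0)

lemma coeff3_bound: "\<exists>N. \<forall>i j k. coeff3 F i j k \<noteq> 0 \<longrightarrow> i \<le> N \<and> j \<le> N \<and> k \<le> N"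
proof -
  define N where "N = degree F + (\<Sum>k\<le>degree F. degree (coeff F k))
     + (\<Sum>k\<le>degree F. \<Sum>j\<le>degree (coeff F k). degree (coeff (coeff F k) j))"
  have "i \<le> N \<and> j \<le> N \<and> k \<le> N" if nz: "coeff3 F i j k \<noteq> 0" for i j k
  proof -
    have k: "k \<le> degree F" using nz unfolding coeff3_def
      by (metis coeff_0 le_degree)
    have j: "j \<le> degree (coeff F k)" using nz unfolding coeff3_def
      by (metis coeff_0 le_degree)
    have i: "i \<le> degree (coeff (coeff F k) j)" using nz unfolding coeff3_def
      by (metis le_degree)
    have 1: "degree (coeff F k) \<le> (\<Sum>k\<le>degree F. degree (coeff F k))"
      using k by (intro member_le_sum) auto
    have "degree (coeff (coeff F k) j) \<le> (\<Sum>j\<le>degree (coeff F k). degree (coeff (coeff F k) j))"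
      using j by (intro member_le_sum) auto
    also have "\<dots> \<le> (\<Sum>k\<le>degree F. \<Sum>j\<le>degree (coeff F k). degree (coeff (coeff F k) j))"
      using k by (intro member_le_sum) auto
    finally show ?thesis using i j k 1 unfolding N_def by linarith
  qed
  then show ?thesis by blast
qed

text \<open>One bound for all three exponents. It depends on \<open>F\<close> only, so a sum over
  this box has a fixed range when the point of evaluation passes to a limit.\<close>

definition box3 :: "poly3 \<Rightarrow> nat" where
  "box3 F = (SOME N. (\<forall>i j k. coeff3 F i j k \<noteq> 0 \<longrightarrow> i \<le> N \<and> j \<le> N \<and> k \<le> N))"

lemma box3: "coeff3 F i j k \<noteq> 0 \<Longrightarrow> i \<le> box3 F \<and> j \<le> box3 F \<and> k \<le> box3 F"
  using someI_ex[OF coeff3_bound[of F]] unfolding box3_def by blast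

lemma eval3_sum:
  fixes \<phi> :: "complex \<Rightarrow> 'r :: comm_ring_1"
  assumes "is_hom \<phi>"
  shows "eval3 \<phi> F a b c = (\<Sum>k\<le>box3 F. (\<Sum>j\<le>box3 F. (\<Sum>i\<le>box3 F. \<phi> (coeff3 F i j k) * a ^ i) * b ^ j) * c ^ k)"
proof -
  have p: "poly (map_poly g p) x = (\<Sum>k\<le>N. g (coeff p k) * x ^ k)"
    if "g 0 = 0" and "\<And>k. coeff p k \<noteq> 0 \<Longrightarrow> k \<le> N"
    for N and g :: "'c::zero \<Rightarrow> 'r" and p :: "'c poly" and x
  proof -
    have "degree (map_poly g p) \<le> N"
      using that by (intro degree_le) (metis coeff_map_poly not_le)
    then show ?thesis using that by (simp add: poly_as_sum_le coeff_map_poly)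
  qed
  note h = is_hom_simps[OF assms]
  have k: "k \<le> box3 F" if nz: "coeff F k \<noteq> 0" for k
  proof -
    obtain j where "coeff (coeff F k) j \<noteq> 0" using nz poly_eqI[of "coeff F k" 0] by auto
    then obtain i where "coeff (coeff (coeff F k) j) i \<noteq> 0"
      using poly_eqI[of "coeff (coeff F k) j" 0] by auto
    then show ?thesis using box3[of F i j k] by (simp add: coeff3_def)
  qed
  have j: "j \<le> box3 F" if nz: "coeff (coeff F k) j \<noteq> 0" for j k
  proof -
    obtain i where "coeff (coeff (coeff F k) j) i \<noteq> 0"
      using nz poly_eqI[of "coeff (coeff F k) j" 0] by auto
    then show ?thesis using box3[of F i j k] by (simp add: coeff3_def)
  qed
  have i: "i \<le> box3 F" if "coeff (coeff (coeff F k) j) i \<noteq> 0" for i j k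
    using that box3[of F i j k] by (simp add: coeff3_def)
  show ?thesis unfolding eval3_def
    by (simp add: p[OF _ k] p[OF _ j] p[OF _ i] h coeff3_def)
qed

lemma eval3_scale:
  assumes "is_hom \<phi>" "homogeneous d F"
  shows "eval3 \<phi> F (s * a) (s * b) (s * c) = s ^ d * eval3 \<phi> F a b c"
proof -
  have t: "\<phi> (coeff3 F i j k) * (s * a) ^ i * (s * b) ^ j * (s * c) ^ k
     = s ^ d * (\<phi> (coeff3 F i j k) * a ^ i * b ^ j * c ^ k)" for i j k
  proof (cases "coeff3 F i j k = 0")
    case False
    then have d: "d = i + j + k" using assms(2) unfolding homogeneous_def by metis
    show ?thesis unfolding d by (simp add: power_mult_distrib power_add mult_ac)
  qed (simp add: is_hom_simps[OF assms(1)])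
  show ?thesis
    unfolding eval3_sum[OF assms(1)] sum_distrib_right t unfolding sum_distrib_left ..
qed

section \<open>Restriction of forms to lines\<close>

text \<open>The restriction of \<open>F\<close> to the line \<open>v + x *s w\<close>. Its k-th
  coefficient is the Taylor term of degree k of \<open>F\<close> at \<open>v\<close>, as a form in
  the direction \<open>w\<close>; multiplicities, tangents and contact orders are all expressed by
  these coefficients.\<close>

definition LP :: "poly3 \<Rightarrow> complex ^ 3 \<Rightarrow> complex ^ 3 \<Rightarrow> complex poly" where
  "LP F v w = eval3 (\<lambda>c. [:c:]) F [:v $ 1, w $ 1:] [:v $ 2, w $ 2:] [:v $ 3, w $ 3:]"

lemma poly_LP: "poly (LP F v w) x = value_at F (v + x *s w)"
  unfolding LP_def value_at_def
  by (subst eval3_hom[OF is_hom_poly]) (simp_all add: algebra_simps)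

lemma is_hom_LP: "is_hom (\<lambda>F. LP F v w)"
  unfolding LP_def by (rule is_hom_eval3[OF is_hom_pCons])

lemma coeff_0_LP: "coeff (LP F v w) 0 = value_at F v"
  using poly_LP[of F v w 0] by (simp add: poly_0_coeff_0)

text \<open>\<open>LP\<close> for a line whose base point and direction move linearly with the inner
  variable. It shows that Taylor coefficients are polynomial in this parameter.\<close>

definition LPP :: "poly3 \<Rightarrow> complex ^ 3 \<Rightarrow> complex ^ 3 \<Rightarrow> complex ^ 3 \<Rightarrow> complex ^ 3 \<Rightarrow> complex poly poly" where
  "LPP F v v' w w' = eval3 (\<lambda>c. [:[:c:]:]) F [:[:v $ 1, v' $ 1:], [:w $ 1, w' $ 1:]:]
     [:[:v $ 2, v' $ 2:], [:w $ 2, w' $ 2:]:] [:[:v $ 3, v' $ 3:], [:w $ 3, w' $ 3:]:]"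

lemma map_poly_LPP: "map_poly (\<lambda>p. poly p x) (LPP F v v' w w') = LP F (v + x *s v') (w + x *s w')"
  unfolding LPP_def LP_def
  by (subst eval3_hom[OF is_hom_map_poly[OF is_hom_poly]])
     (simp_all add: map_poly_hom_pCons[OF is_hom_poly])

lemma coeff_LPP: "poly (coeff (LPP F v v' w w') k) x = coeff (LP F (v + x *s v') (w + x *s w')) k"
  by (simp add: coeff_map_poly flip: map_poly_LPP)

lemma degree_LP_le:
  assumes "homogeneous d F"
  shows "degree (LP F v w) \<le> d"
proof -
  have "degree (([:coeff3 F i j k:] * [:v $ 1, w $ 1:] ^ i) * [:v $ 2, w $ 2:] ^ j * [:v $ 3, w $ 3:] ^ k) \<le> d"
    for i j k
  proof (cases "coeff3 F i j k = 0")
    case False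
    then have d: "d = i + j + k" using assms(1) unfolding homogeneous_def by metis
    have l: "degree ([:a, b:] ^ n) \<le> n" for a b :: complex and n
      using degree_power_le[of "[:a,b:]" n] by (cases "b = 0") auto
    have "degree ([:coeff3 F i j k:] * [:v $ 1, w $ 1:] ^ i) \<le> i"
      using order_trans[OF degree_mult_le, of "[:coeff3 F i j k:]"] l by fastforce
    then have "degree ([:coeff3 F i j k:] * [:v $ 1, w $ 1:] ^ i * [:v $ 2, w $ 2:] ^ j) \<le> i + j"
      by (rule order_trans[OF degree_mult_le add_mono[OF _ l]])
    then show ?thesis unfolding d
      by (rule order_trans[OF degree_mult_le add_mono[OF _ l]])
  qed simp
  then show ?thesis
    unfolding LP_def eval3_sum[OF is_hom_pCons] sum_distrib_right
    by (intro degree_sum_le) auto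
qed

lemma value_at_scale: "homogeneous d F \<Longrightarrow> value_at F (c *s v) = c ^ d * value_at F v"
  by (simp add: value_at_def eval3_scale[OF is_hom_id])

text \<open>Infinitely many arguments remain when 0 is left out. Identities obtained by dividing by
  the variable thus extend to all arguments.\<close>

lemma poly_eqI_nonzero:
  fixes p q :: "complex poly"
  assumes "\<And>x. x \<noteq> 0 \<Longrightarrow> poly p x = poly q x"
  shows "p = q"
proof (rule ccontr)
  assume "p \<noteq> q"
  then have "p - q \<noteq> 0" by simp
  then have "finite {x. poly (p - q) x = 0}" by (rule poly_roots_finite)
  moreover have "- {0} \<subseteq> {x. poly (p - q) x = 0}" using assms by auto
  moreover have "infinite (- {0 :: complex})"
    using infinite_UNIV_char_0[where 'a=complex] by (simp add: Compl_eq_Diff_UNIV)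
  ultimately show False using finite_subset by blast
qed

text \<open>For \<open>\<mu> \<noteq> 0\<close> homogeneity pulls out \<open>\<mu>\<close>. Both
  sides are polynomials in \<open>\<mu>\<close>, so the case \<open>\<mu> = 0\<close>, the point of
  the line at infinity, is covered as well.\<close>

lemma value_at_line:
  assumes "homogeneous d F"
  shows "value_at F (\<mu> *s v + \<nu> *s w) = (\<Sum>k\<le>d. coeff (LP F v w) k * \<nu> ^ k * \<mu> ^ (d - k))"
proof -
  define p where "p = (\<Sum>k\<le>d. monom (coeff (LP F v w) k * \<nu> ^ k) (d - k))"
  have "LP F (\<nu> *s w) v = p"
  proof (rule poly_eqI_nonzero)
    fix \<mu> :: complex assume "\<mu> \<noteq> 0"
    then have "\<nu> *s w + \<mu> *s v = \<mu> *s (v + (\<nu> / \<mu>) *s w)"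
      by (simp add: vec_eq_iff field_simps)
    then have "poly (LP F (\<nu> *s w) v) \<mu> = \<mu> ^ d * poly (LP F v w) (\<nu> / \<mu>)"
      by (simp only: poly_LP value_at_scale[OF assms])
    also have "\<dots> = (\<Sum>k\<le>d. \<mu> ^ d * (coeff (LP F v w) k * (\<nu> / \<mu>) ^ k))"
      by (simp add: poly_as_sum_le[OF degree_LP_le[OF assms]] sum_distrib_left)
    also have "\<dots> = poly p \<mu>"
      unfolding p_def poly_sum poly_monom
      using \<open>\<mu> \<noteq> 0\<close> by (intro sum.cong) (auto simp: power_divide power_diff)
    finally show "poly (LP F (\<nu> *s w) v) \<mu> = poly p \<mu>" .
  qed
  then have "value_at F (\<mu> *s v + \<nu> *s w) = poly p \<mu>"
    by (metis poly_LP add.commute)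
  then show ?thesis by (simp add: p_def poly_sum poly_monom)
qed

lemma coeff_LP_degree:
  assumes "homogeneous d F"
  shows "coeff (LP F v w) d = value_at F w"
proof -
  have "value_at F (0 *s v + 1 *s w) = (\<Sum>k\<le>d. if k = d then coeff (LP F v w) k else 0)"
    unfolding value_at_line[OF assms] by (intro sum.cong) auto
  then show ?thesis by simp
qed

text \<open>The order of contact with a line and the first nonvanishing coefficient do not depend, up to
  nonzero factors, on the choice of coordinates of the line.\<close>

lemma LP_shift:
  assumes hom: "homogeneous d F" and z: "\<And>j. j < k \<Longrightarrow> coeff (LP F v w) j = 0"
  shows "j < k \<Longrightarrow> coeff (LP F (c *s v) (a *s w + b *s v)) j = 0"
    and "coeff (LP F (c *s v) (a *s w + b *s v)) k = a ^ k * c ^ (d - k) * coeff (LP F v w) k"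
proof -
  define p where "p = (\<Sum>i\<le>d. smult (coeff (LP F v w) i) ([:0, a:] ^ i * [:c, b:] ^ (d - i)))"
  have "LP F (c *s v) (a *s w + b *s v) = p"
  proof (rule poly_eqI_nonzero)
    fix x :: complex
    have "c *s v + x *s (a *s w + b *s v) = (c + x * b) *s v + (x * a) *s w"
      by (simp add: vec_eq_iff algebra_simps)
    then have "poly (LP F (c *s v) (a *s w + b *s v)) x =
        (\<Sum>k\<le>d. coeff (LP F v w) k * (x * a) ^ k * (c + x * b) ^ (d - k))"
      by (simp only: poly_LP value_at_line[OF hom])
    then show "poly (LP F (c *s v) (a *s w + b *s v)) x = poly p x"
      by (simp add: p_def poly_sum mult_ac)
  qed
  \<comment> \<open>The factor of degree i is divisible by $x^i$, so only the terms with
    \<open>i \<le> j\<close> reach the j-th coefficient, and the first k of them vanish by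
    assumption.\<close>
  moreover have t: "coeff (smult s ([:0, a:] ^ i * [:c, b:] ^ (d - i))) j =
     (if j < i then 0 else s * a ^ i * coeff ([:c, b:] ^ (d - i)) (j - i))" for s i j
  proof -
    have "[:0, a:] = monom a 1" by (simp add: monom_Suc monom_0)
    then have "[:0, a:] ^ i = monom (a ^ i) i" by (simp add: monom_power)
    then show ?thesis by (simp add: coeff_monom_mult)
  qed
  ultimately have c: "coeff (LP F (c *s v) (a *s w + b *s v)) j =
     (\<Sum>i\<le>d. if j < i then 0 else coeff (LP F v w) i * a ^ i * coeff ([:c, b:] ^ (d - i)) (j - i))" for j
    by (simp only: p_def coeff_sum t)
  show "j < k \<Longrightarrow> coeff (LP F (c *s v) (a *s w + b *s v)) j = 0"
    unfolding c by (intro sum.neutral) (auto simp: z)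
  have c0: "coeff ([:c, b:] ^ n) 0 = c ^ n" for n
    by (simp add: coeff_0_power)
  have "coeff (LP F (c *s v) (a *s w + b *s v)) k =
     (\<Sum>i\<le>d. if i = k then coeff (LP F v w) k * a ^ k * c ^ (d - k) else 0)"
    unfolding c by (intro sum.cong refl) (auto simp: z c0)
  also have "\<dots> = a ^ k * c ^ (d - k) * coeff (LP F v w) k"
    using degree_LP_le[OF hom, of v w] by (auto simp: coeff_eq_0)
  finally show "coeff (LP F (c *s v) (a *s w + b *s v)) k = a ^ k * c ^ (d - k) * coeff (LP F v w) k" .
qed

section \<open>Derivatives of forms\<close>

text \<open>Instances are \<open>pderiv\<close> and, for the inner variables,
  \<open>map_poly pderiv\<close> and its iterate; the chain rule for \<open>eval3\<close> is proved
  for all of them at once.\<close>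

definition is_deriv :: "('a::comm_ring_1 \<Rightarrow> 'a) \<Rightarrow> bool" where
  "is_deriv \<delta> \<longleftrightarrow> (\<forall>a b. \<delta> (a + b) = \<delta> a + \<delta> b) \<and> (\<forall>a b. \<delta> (a * b) = \<delta> a * b + a * \<delta> b)"

lemma is_deriv_simps:
  assumes "is_deriv \<delta>"
  shows "\<delta> (a + b) = \<delta> a + \<delta> b" "\<delta> (a * b) = \<delta> a * b + a * \<delta> b" "\<delta> 0 = 0"
proof -
  show a: "\<delta> (a + b) = \<delta> a + \<delta> b" for a b using assms by (auto simp: is_deriv_def)
  show "\<delta> (a * b) = \<delta> a * b + a * \<delta> b" using assms by (auto simp: is_deriv_def)
  show "\<delta> 0 = 0" using a[of 0 0] by simp
qed

lemma is_deriv_pderiv: "is_deriv (pderiv :: 'a::idom poly \<Rightarrow> 'a poly)"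
  by (auto simp: is_deriv_def pderiv_add pderiv_mult)

lemma is_deriv_map_poly:
  assumes "is_deriv \<delta>"
  shows "is_deriv (map_poly \<delta>)"
proof -
  note d = is_deriv_simps[OF assms]
  have s: "\<delta> (sum f A) = (\<Sum>x\<in>A. \<delta> (f x))" for f and A :: "'b set"
    by (induction A rule: infinite_finite_induct) (auto simp: d)
  show ?thesis unfolding is_deriv_def
    by (intro conjI allI poly_eqI)
       (simp_all add: coeff_map_poly d coeff_mult s sum.distrib)
qed

lemma poly_map_poly_times:
  fixes g :: "'a::zero \<Rightarrow> 'b::comm_ring_1"
  assumes "g 0 = 0"
  shows "poly (map_poly (\<lambda>y. g y * s) p) x = poly (map_poly g p) x * s"
  by (induction p) (auto simp: map_poly_pCons assms algebra_simps)

lemma poly_map_poly_plus: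
  fixes g h :: "'a::zero \<Rightarrow> 'b::comm_ring_1"
  assumes "g 0 = 0" "h 0 = 0"
  shows "poly (map_poly (\<lambda>y. g y + h y) p) x = poly (map_poly g p) x + poly (map_poly h p) x"
  by (induction p) (auto simp: map_poly_pCons assms algebra_simps)

lemma map_poly_comp_eq:
  assumes "g 0 = 0" "h 0 = 0"
  shows "map_poly (\<lambda>y. g (h y)) p = map_poly g (map_poly h p)"
  by (rule poly_eqI) (simp add: coeff_map_poly assms)

lemma is_deriv_poly_map:
  fixes p :: "'a::idom poly"
  assumes \<delta>: "is_deriv \<delta>" and g: "is_hom g"
  shows "\<delta> (poly (map_poly g p) x)
    = poly (map_poly (\<lambda>y. \<delta> (g y)) p) x + poly (map_poly g (pderiv p)) x * \<delta> x"
proof (induction p)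
  case 0
  then show ?case by (simp add: is_deriv_simps[OF \<delta>])
next
  case (pCons a p)
  note d = is_deriv_simps[OF \<delta>] and h = is_hom_simps[OF g] is_hom_simps[OF is_hom_map_poly[OF g]]
  have e: "map_poly (\<lambda>y. \<delta> (g y)) (pCons a p) = pCons (\<delta> (g a)) (map_poly (\<lambda>y. \<delta> (g y)) p)"
    using pCons by (subst map_poly_pCons) (auto simp: d h)
  show ?case
    unfolding e map_poly_hom_pCons[OF g] pderiv_pCons
    by (simp add: d h map_poly_hom_pCons[OF g] pCons algebra_simps)
qed

definition pd1 :: "poly3 \<Rightarrow> poly3" where "pd1 = map_poly (map_poly pderiv)"
definition pd2 :: "poly3 \<Rightarrow> poly3" where "pd2 = map_poly pderiv"
definition pd3 :: "poly3 \<Rightarrow> poly3" where "pd3 = pderiv"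

text \<open>The chain rule, taken one variable at a time from the inside: \<open>g1\<close> and
  \<open>g2\<close> evaluate the innermost one and two variables.\<close>

lemma is_deriv_eval3:
  assumes \<delta>: "is_deriv \<delta>" and \<phi>: "is_hom \<phi>" and z: "\<And>c. \<delta> (\<phi> c) = 0"
  shows "\<delta> (eval3 \<phi> F a b c) = eval3 \<phi> (pd1 F) a b c * \<delta> a + eval3 \<phi> (pd2 F) a b c * \<delta> b
     + eval3 \<phi> (pd3 F) a b c * \<delta> c"
proof -
  define g1 where "g1 = (\<lambda>H. poly (map_poly \<phi> H) a)"
  define g2 where "g2 = (\<lambda>G. poly (map_poly g1 G) b)"
  have g1: "is_hom g1" unfolding g1_def by (rule is_hom_poly_map[OF \<phi>])
  have g2: "is_hom g2" unfolding g2_def by (rule is_hom_poly_map[OF g1])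
  have e: "eval3 \<phi> F a b c = poly (map_poly g2 F) c" for F
    by (simp add: eval3_def g2_def g1_def)
  have m: "map_poly (\<lambda>y. 0) p = 0" for p :: "'x::zero poly"
    by (rule poly_eqI) (simp add: coeff_map_poly)
  have d1: "\<delta> (g1 H) = g1 (pderiv H) * \<delta> a" for H
    unfolding g1_def is_deriv_poly_map[OF \<delta> \<phi>] by (simp add: z m)
  have d2: "\<delta> (g2 G) = g2 (map_poly pderiv G) * \<delta> a + g2 (pderiv G) * \<delta> b" for G
    unfolding g2_def is_deriv_poly_map[OF \<delta> g1] d1
    by (simp add: poly_map_poly_times[of "\<lambda>y. g1 (pderiv y)"] is_hom_simps[OF g1] map_poly_comp_eq[of g1 pderiv])
  have z2: "g2 0 = 0" by (rule is_hom_simps(1)[OF g2])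
  show ?thesis
    unfolding e is_deriv_poly_map[OF \<delta> g2] d2
    by (simp add: poly_map_poly_plus poly_map_poly_times[of "\<lambda>y. g2 (pderiv y)"]
         poly_map_poly_times[of "\<lambda>y. g2 (map_poly pderiv y)"] z2 map_poly_comp_eq[of g2 pderiv] map_poly_comp_eq[of g2 "map_poly pderiv"]
         pd1_def pd2_def pd3_def)
qed

lemma pd_commute: "pd2 (pd1 F) = pd1 (pd2 F)" "pd3 (pd1 F) = pd1 (pd3 F)" "pd3 (pd2 F) = pd2 (pd3 F)"
proof -
  have a: "pderiv (map_poly pderiv p) = map_poly pderiv (pderiv p)" for p :: "'a::idom poly poly"
    by (rule poly_eqI) (simp add: coeff_map_poly coeff_pderiv pderiv_mult pderiv_of_nat pderiv_add)
  show "pd3 (pd2 F) = pd2 (pd3 F)" unfolding pd2_def pd3_def by (rule a)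
  show "pd2 (pd1 F) = pd1 (pd2 F)" unfolding pd1_def pd2_def
    by (rule poly_eqI) (simp add: coeff_map_poly a)
  show "pd3 (pd1 F) = pd1 (pd3 F)" unfolding pd1_def pd3_def
    by (intro poly_eqI) (simp add: coeff_map_poly coeff_pderiv of_nat_poly flip: of_nat_Suc)
qed

lemma coeff3_pd:
  "coeff3 (pd1 F) i j k = of_nat (Suc i) * coeff3 F (Suc i) j k"
  "coeff3 (pd2 F) i j k = of_nat (Suc j) * coeff3 F i (Suc j) k"
  "coeff3 (pd3 F) i j k = of_nat (Suc k) * coeff3 F i j (Suc k)"
  by (simp_all add: coeff3_def pd1_def pd2_def pd3_def coeff_map_poly coeff_pderiv of_nat_poly flip: of_nat_Suc)

lemma homogeneous_pd:
  assumes "homogeneous d F"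
  shows "homogeneous (d - 1) (pd1 F)" "homogeneous (d - 1) (pd2 F)" "homogeneous (d - 1) (pd3 F)"
  using assms unfolding homogeneous_def coeff3_pd by fastforce+

section \<open>Directional derivatives and Euler's relation\<close>

definition dird :: "complex ^ 3 \<Rightarrow> poly3 \<Rightarrow> poly3" where
  "dird w F = const3 (w $ 1) * pd1 F + const3 (w $ 2) * pd2 F + const3 (w $ 3) * pd3 F"

lemma value_at_const3: "value_at (const3 c) v = c"
  by (simp add: value_at_def eval3_const3[OF is_hom_id])

lemma LP_const3: "LP (const3 c) v w = [:c:]"
  by (simp add: LP_def eval3_const3[OF is_hom_pCons])

lemma value_at_dird:
  "value_at (dird w F) v = w $ 1 * value_at (pd1 F) v + w $ 2 * value_at (pd2 F) v + w $ 3 * value_at (pd3 F) v"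
  by (simp add: dird_def is_hom_simps[OF is_hom_value_at] value_at_const3)

lemma value_at_dird_gradient: "value_at (dird w F) v = (\<Sum>i\<in>UNIV. gradient F v $ i * w $ i)"
  by (simp add: value_at_dird gradient_def sum_3 pd1_def pd2_def pd3_def)

lemma LP_dird:
  "LP (dird u F) v w = LP (pd1 F) v w * [:u $ 1:] + LP (pd2 F) v w * [:u $ 2:] + LP (pd3 F) v w * [:u $ 3:]"
  by (simp add: dird_def is_hom_simps[OF is_hom_LP] LP_const3)

lemma pderiv_LP: "pderiv (LP F v w) = LP (dird w F) v w"
  unfolding LP_dird unfolding LP_def
  by (subst is_deriv_eval3[OF is_deriv_pderiv is_hom_pCons]) (simp_all add: pderiv_pCons)

lemma coeff_1_LP: "coeff (LP F v w) 1 = value_at (dird w F) v"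
  using coeff_pderiv[of "LP F v w" 0] by (simp add: pderiv_LP coeff_0_LP)

lemma dird_lin: "value_at (dird (a *s u + b *s w) F) v = a * value_at (dird u F) v + b * value_at (dird w F) v"
  by (simp add: value_at_dird algebra_simps)

text \<open>On the line through 0 and \<open>v\<close> the form is $F(v)(1+x)^d$; differentiate at x
  = 0.\<close>

lemma euler:
  assumes "homogeneous d F"
  shows "value_at (dird v F) v = of_nat d * value_at F v"
proof -
  have "LP F v v = smult (value_at F v) ([:1, 1:] ^ d)"
  proof (rule poly_eqI_nonzero)
    fix x :: complex
    have "v + x *s v = (1 + x) *s v" by (simp add: vec_eq_iff algebra_simps)
    then show "poly (LP F v v) x = poly (smult (value_at F v) ([:1, 1:] ^ d)) x"
      by (simp only: poly_LP value_at_scale[OF assms]) simp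
  qed
  moreover have "value_at (dird v F) v = poly (pderiv (LP F v v)) 0"
    by (simp add: pderiv_LP poly_LP)
  ultimately have "value_at (dird v F) v = poly (pderiv (smult (value_at F v) ([:1, 1:] ^ d))) 0"
    by simp
  also have "\<dots> = of_nat d * value_at F v"
    by (cases d) (simp_all add: pderiv_smult pderiv_power_Suc pderiv_pCons del: power_Suc)
  finally show ?thesis .
qed

text \<open>Moving the direction by \<open>x *s u\<close> moves the point with parameter y by
  \<open>y * x\<close> times \<open>u\<close>. The extra factor y is the drop of the index from
  \<open>Suc k\<close> to \<open>k\<close>.\<close>

lemma coeff_LP_deriv:
  "((\<lambda>x. coeff (LP F v (w + x *s u)) (Suc k)) has_field_derivative coeff (LP (dird u F) v w) k) (at 0)"
proof -
  define E where "E = (\<lambda>F. LPP F v 0 w u)"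
  define D where "D = (map_poly pderiv :: complex poly poly \<Rightarrow> complex poly poly)"
  have h: "is_hom (\<lambda>c. [:[:c:]:] :: complex poly poly)"
    using is_hom_comp[OF is_hom_pCons is_hom_pCons] .
  have z: "D [:[:c:]:] = 0" for c
    by (simp add: D_def map_poly_pCons)
  have da: "D [:[:a, 0:], [:b, c:]:] = [:[:c:]:] * [:0, 1:]" for a b c
    by (simp add: D_def map_poly_pCons pderiv_pCons)
  have "D (E F) = ([:[:u $ 1:]:] * E (pd1 F) + [:[:u $ 2:]:] * E (pd2 F) + [:[:u $ 3:]:] * E (pd3 F)) * [:0, 1:]"
    unfolding E_def LPP_def D_def
    by (subst is_deriv_eval3[OF is_deriv_map_poly[OF is_deriv_pderiv] h z[unfolded D_def]])
       (simp only: da[unfolded D_def] zero_index algebra_simps)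
  moreover have "coeff (D (E F)) (Suc k) = pderiv (coeff (E F) (Suc k))"
    by (simp add: D_def coeff_map_poly)
  ultimately have "pderiv (coeff (E F) (Suc k)) =
      [:u $ 1:] * coeff (E (pd1 F)) k + [:u $ 2:] * coeff (E (pd2 F)) k + [:u $ 3:] * coeff (E (pd3 F)) k"
    by simp
  then have "poly (pderiv (coeff (E F) (Suc k))) 0 = coeff (LP (dird u F) v w) k"
    by (simp add: E_def coeff_LPP LP_dird)
  then have "(poly (coeff (E F) (Suc k)) has_field_derivative coeff (LP (dird u F) v w) k) (at 0)"
    using poly_DERIV[of "coeff (E F) (Suc k)" 0] by simp
  moreover have "coeff (LP F v (w + x *s u)) (Suc k) = poly (coeff (E F) (Suc k)) x" for x
    by (simp add: E_def coeff_LPP)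
  ultimately show ?thesis by simp
qed

subsection \<open>The Hessian\<close>

text \<open>The determinant of the matrix of second derivatives, expanded along the first row. Mixed
  derivatives appear in one order only, so symmetry of the matrix is built in.\<close>

definition hessP :: "poly3 \<Rightarrow> poly3" where
  "hessP F = pd1 (pd1 F) * (pd2 (pd2 F) * pd3 (pd3 F) - pd2 (pd3 F) * pd2 (pd3 F))
     - pd1 (pd2 F) * (pd1 (pd2 F) * pd3 (pd3 F) - pd2 (pd3 F) * pd1 (pd3 F))
     + pd1 (pd3 F) * (pd1 (pd2 F) * pd2 (pd3 F) - pd2 (pd2 F) * pd1 (pd3 F))"

lemma sym_det_scale:
  fixes s :: complex
  shows "s * a * (s * b * (s * c) - s * f * (s * f)) - s * g * (s * g * (s * c) - s * f * (s * h))
      + s * h * (s * g * (s * f) - s * b * (s * h))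
    = s * (s * s) * (a * (b * c - f * f) - g * (g * c - f * h) + h * (g * f - b * h))"
  by (simp add: algebra_simps)

lemma hessP_scale:
  assumes "homogeneous d F"
  shows "value_at (hessP F) (c *s v) = c ^ (3 * (d - 2)) * value_at (hessP F) v"
proof -
  note h1 = homogeneous_pd[OF assms]
  have e: "d - 1 - 1 = d - 2" by simp
  note h = h1(1)[THEN homogeneous_pd(1), unfolded e] h1(2)[THEN homogeneous_pd(1), unfolded e]
    h1(2)[THEN homogeneous_pd(2), unfolded e] h1(3)[THEN homogeneous_pd(1), unfolded e]
    h1(3)[THEN homogeneous_pd(2), unfolded e] h1(3)[THEN homogeneous_pd(3), unfolded e]
  have p: "c ^ (3 * (d - 2)) = c ^ (d - 2) * (c ^ (d - 2) * c ^ (d - 2))"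
    by (simp add: numeral_3_eq_3 power_add)
  show ?thesis
    unfolding p hessP_def is_hom_simps[OF is_hom_value_at] is_hom_diff[OF is_hom_value_at]
        value_at_scale[OF h(1)] value_at_scale[OF h(2)] value_at_scale[OF h(3)]
        value_at_scale[OF h(4)] value_at_scale[OF h(5)] value_at_scale[OF h(6)]
    by (rule sym_det_scale)
qed

definition det3 :: "complex ^ 3 \<Rightarrow> complex ^ 3 \<Rightarrow> complex ^ 3 \<Rightarrow> complex" where
  "det3 a b c = a $ 1 * (b $ 2 * c $ 3 - b $ 3 * c $ 2) - a $ 2 * (b $ 1 * c $ 3 - b $ 3 * c $ 1)
     + a $ 3 * (b $ 1 * c $ 2 - b $ 2 * c $ 1)"

lemma pd_plus: "pd1 (F + G) = pd1 F + pd1 G" "pd2 (F + G) = pd2 F + pd2 G" "pd3 (F + G) = pd3 F + pd3 G"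
  unfolding pd1_def pd2_def pd3_def
  by (auto intro!: is_deriv_simps(1) is_deriv_map_poly is_deriv_pderiv)

lemma pd_const3: "pd1 (const3 c * F) = const3 c * pd1 F" "pd2 (const3 c * F) = const3 c * pd2 F"
   "pd3 (const3 c * F) = const3 c * pd3 F"
proof -
  have z: "pd1 (const3 c) = 0" "pd2 (const3 c) = 0" "pd3 (const3 c) = 0"
    by (simp_all add: pd1_def pd2_def pd3_def const3_def map_poly_pCons pderiv_pCons)
  have d: "is_deriv pd1" "is_deriv pd2" "is_deriv pd3"
    unfolding pd1_def pd2_def pd3_def by (intro is_deriv_map_poly is_deriv_pderiv)+
  show "pd1 (const3 c * F) = const3 c * pd1 F" "pd2 (const3 c * F) = const3 c * pd2 F"
   "pd3 (const3 c * F) = const3 c * pd3 F"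
    by (simp_all add: is_deriv_simps(2)[OF d(1)] is_deriv_simps(2)[OF d(2)] is_deriv_simps(2)[OF d(3)] z)
qed

text \<open>The bilinear form of the Hessian matrix of \<open>F\<close> at \<open>z\<close>.\<close>

definition hq :: "poly3 \<Rightarrow> complex ^ 3 \<Rightarrow> complex ^ 3 \<Rightarrow> complex ^ 3 \<Rightarrow> complex" where
  "hq F z a b = value_at (dird a (dird b F)) z"

lemma hq_expand: "hq F z a b =
    a $ 1 * b $ 1 * value_at (pd1 (pd1 F)) z + a $ 2 * b $ 2 * value_at (pd2 (pd2 F)) z
  + a $ 3 * b $ 3 * value_at (pd3 (pd3 F)) z + (a $ 1 * b $ 2 + a $ 2 * b $ 1) * value_at (pd1 (pd2 F)) z
  + (a $ 1 * b $ 3 + a $ 3 * b $ 1) * value_at (pd1 (pd3 F)) z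
  + (a $ 2 * b $ 3 + a $ 3 * b $ 2) * value_at (pd2 (pd3 F)) z"
proof -
  note s = is_hom_simps(3,4)[OF is_hom_value_at]
  show ?thesis
    unfolding hq_def dird_def pd_plus pd_const3 pd_commute s value_at_const3
    by (simp add: algebra_simps)
qed

lemma hq_commute: "hq F z a b = hq F z b a"
  by (simp add: hq_expand algebra_simps)

text \<open>The right-hand side is the determinant of the Gram matrix of a, b, c for this bilinear
  form, that is, of $A M A^T$ with the Hessian matrix M and with a, b, c as the rows of A.\<close>

lemma hess_gram:
  "(det3 a b c)\<^sup>2 * value_at (hessP F) z =
     hq F z a a * (hq F z b b * hq F z c c - hq F z b c * hq F z b c)
   - hq F z a b * (hq F z a b * hq F z c c - hq F z b c * hq F z a c)
   + hq F z a c * (hq F z a b * hq F z b c - hq F z b b * hq F z a c)"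
proof -
  define M :: "complex ^ 3 ^ 3" where
    "M = vector [vector [value_at (pd1 (pd1 F)) z, value_at (pd1 (pd2 F)) z, value_at (pd1 (pd3 F)) z],
                 vector [value_at (pd1 (pd2 F)) z, value_at (pd2 (pd2 F)) z, value_at (pd2 (pd3 F)) z],
                 vector [value_at (pd1 (pd3 F)) z, value_at (pd2 (pd3 F)) z, value_at (pd3 (pd3 F)) z]]"
  define A :: "complex ^ 3 ^ 3" where "A = vector [a, b, c]"
  have dA: "det A = det3 a b c"
    by (simp add: A_def det_3 det3_def algebra_simps)
  have dM: "det M = value_at (hessP F) z"
    unfolding hessP_def is_hom_simps[OF is_hom_value_at] is_hom_diff[OF is_hom_value_at]
    by (simp add: M_def det_3 algebra_simps)
  have q: "(\<Sum>i\<in>UNIV. (\<Sum>j\<in>UNIV. x $ j * M $ j $ i) * y $ i) = hq F z x y" for x y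
    by (simp add: sum_3 M_def hq_expand algebra_simps)
  have e: "(A ** M ** transpose A) $ i $ j = hq F z (A $ i) (A $ j)" for i j
    by (simp add: matrix_matrix_mult_def transpose_def q)
  have "(det3 a b c)\<^sup>2 * value_at (hessP F) z = det (A ** M ** transpose A)"
    by (simp add: det_mul dA dM det_transpose power2_eq_square)
  also have "\<dots> = hq F z a a * (hq F z b b * hq F z c c - hq F z b c * hq F z b c)
   - hq F z a b * (hq F z a b * hq F z c c - hq F z b c * hq F z a c)
   + hq F z a c * (hq F z a b * hq F z b c - hq F z b b * hq F z a c)"
    unfolding det_3 e
    by (simp add: A_def hq_commute[of F z b a] hq_commute[of F z c a] hq_commute[of F z c b] algebra_simps)
  finally show ?thesis .
qed

text \<open>Euler's relation holds at every point \<open>v + x *s b\<close>; its derivative with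
  respect to x at 0 is the claim.\<close>

lemma hq_euler:
  assumes "homogeneous d F"
  shows "hq F v b v = (of_nat d - 1) * value_at (dird b F) v"
proof -
  define p where "p = LP (dird v F) v b + [:0,1:] * LP (dird b F) v b"
  have "p = smult (of_nat d) (LP F v b)"
  proof (rule poly_eqI_nonzero)
    fix x :: complex
    have "poly p x = value_at (dird (v + x *s b) F) (v + x *s b)"
      using dird_lin[of 1 v x b F "v + x *s b"] by (simp add: p_def poly_LP)
    then show "poly p x = poly (smult (of_nat d) (LP F v b)) x"
      by (simp add: euler[OF assms] poly_LP)
  qed
  then have "poly (pderiv p) 0 = of_nat d * poly (pderiv (LP F v b)) 0"
    by (simp add: pderiv_smult)
  then have "hq F v b v + value_at (dird b F) v = of_nat d * value_at (dird b F) v"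
    by (simp add: p_def pderiv_add pderiv_mult pderiv_pCons pderiv_LP poly_LP hq_def)
  then show ?thesis by (simp add: algebra_simps eq_diff_eq)
qed

text \<open>Euler's relations express the Hessian by derivatives along the directions \<open>w\<close> and \<open>u\<close> only.\<close>

lemma hess_identity:
  assumes "homogeneous d F"
  shows "(det3 y w u)\<^sup>2 * value_at (hessP F) y =
     of_nat d * (of_nat d - 1) * value_at F y * (hq F y w w * hq F y u u - (hq F y w u)\<^sup>2)
     - (of_nat d - 1)\<^sup>2 * ((value_at (dird w F) y)\<^sup>2 * hq F y u u
         - 2 * value_at (dird w F) y * value_at (dird u F) y * hq F y w u
         + (value_at (dird u F) y)\<^sup>2 * hq F y w w)"
proof -
  \<comment> \<open>In the Gram determinant of y, w, u every entry that involves y is replaced, by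
    Euler's relations, by a multiple of \<open>F\<close> or of a first derivative at y.\<close>
  have 1: "hq F y y w = (of_nat d - 1) * value_at (dird w F) y"
          "hq F y y u = (of_nat d - 1) * value_at (dird u F) y"
    using hq_euler[OF assms] hq_commute by metis+
  have 2: "hq F y y y = of_nat d * (of_nat d - 1) * value_at F y"
    by (simp add: hq_euler[OF assms] euler[OF assms])
  show ?thesis unfolding hess_gram 1 2 by (simp add: power2_eq_square algebra_simps)
qed

subsection \<open>Limits of Taylor coefficients\<close>

lemma ptend_mult:
  fixes p q :: "'i \<Rightarrow> complex poly"
  assumes "\<And>k. ((\<lambda>n. coeff (p n) k) \<longlongrightarrow> coeff p0 k) A" "\<And>k. ((\<lambda>n. coeff (q n) k) \<longlongrightarrow> coeff q0 k) A"
  shows "((\<lambda>n. coeff (p n * q n) k) \<longlongrightarrow> coeff (p0 * q0) k) A"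
  unfolding coeff_mult by (intro tendsto_intros assms)

lemma ptend_power:
  fixes p :: "'i \<Rightarrow> complex poly"
  assumes "\<And>k. ((\<lambda>n. coeff (p n) k) \<longlongrightarrow> coeff p0 k) A"
  shows "((\<lambda>n. coeff (p n ^ m) k) \<longlongrightarrow> coeff (p0 ^ m) k) A"
  by (induction m arbitrary: k) (simp_all add: ptend_mult[OF assms])

lemma coeff_LP_tendsto:
  assumes "(v \<longlongrightarrow> v0) A" "(w \<longlongrightarrow> w0) A"
  shows "((\<lambda>n. coeff (LP F (v n) (w n)) k) \<longlongrightarrow> coeff (LP F v0 w0) k) A"
proof -
  have l: "((\<lambda>n. coeff [:v n $ i, w n $ i:] k) \<longlongrightarrow> coeff [:v0 $ i, w0 $ i:] k) A" for i k
    using assms by (auto simp: coeff_pCons intro!: tendsto_intros split: nat.splits)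
  show ?thesis
    unfolding LP_def eval3_sum[OF is_hom_pCons] coeff_sum sum_distrib_right
    by (intro tendsto_sum ptend_mult ptend_power l tendsto_const)
qed

lemma degree_LP_box: "degree (LP F v w) \<le> 3 * box3 F"
proof -
  have l: "degree ([:a, b:] ^ n) \<le> N" if "n \<le> N" for a b :: complex and n N
    using degree_power_le[of "[:a,b:]" n] that by (cases "b = 0") auto
  have "degree (([:coeff3 F i j k:] * [:v $ 1, w $ 1:] ^ i) * [:v $ 2, w $ 2:] ^ j * [:v $ 3, w $ 3:] ^ k)
     \<le> 3 * box3 F" if "i \<le> box3 F" "j \<le> box3 F" "k \<le> box3 F" for i j k
  proof -
    have "degree ([:coeff3 F i j k:] * [:v $ 1, w $ 1:] ^ i) \<le> box3 F"
      using order_trans[OF degree_mult_le, of "[:coeff3 F i j k:]"] l[OF that(1)] by fastforce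
    then have "degree ([:coeff3 F i j k:] * [:v $ 1, w $ 1:] ^ i * [:v $ 2, w $ 2:] ^ j) \<le> box3 F + box3 F"
      by (rule order_trans[OF degree_mult_le add_mono[OF _ l[OF that(2)]]])
    then have "degree ([:coeff3 F i j k:] * [:v $ 1, w $ 1:] ^ i * [:v $ 2, w $ 2:] ^ j * [:v $ 3, w $ 3:] ^ k)
        \<le> box3 F + box3 F + box3 F"
      by (rule order_trans[OF degree_mult_le add_mono[OF _ l[OF that(3)]]])
    then show ?thesis by simp
  qed
  then show ?thesis
    unfolding LP_def eval3_sum[OF is_hom_pCons] sum_distrib_right
    by (intro degree_sum_le) auto
qed

lemma poly_div_tendsto:
  fixes p :: "nat \<Rightarrow> complex poly"
  assumes c: "\<And>k. (\<lambda>n. coeff (p n) k) \<longlonglongrightarrow> c k" and D: "\<And>n. degree (p n) \<le> D"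
    and z: "\<And>n k. k < j \<Longrightarrow> coeff (p n) k = 0"
    and e: "\<epsilon> \<longlonglongrightarrow> 0" "\<And>n. \<epsilon> n \<noteq> 0"
  shows "(\<lambda>n. poly (p n) (\<epsilon> n) / \<epsilon> n ^ j) \<longlonglongrightarrow> c j"
proof -
  have "poly (p n) (\<epsilon> n) / \<epsilon> n ^ j = (\<Sum>k\<le>D. if k < j then 0 else coeff (p n) k * \<epsilon> n ^ (k - j))" for n
    unfolding poly_as_sum_le[OF D] sum_divide_distrib
    using e(2)[of n] by (intro sum.cong) (auto simp: z power_diff)
  moreover have "(\<lambda>n. \<Sum>k\<le>D. if k < j then 0 else coeff (p n) k * \<epsilon> n ^ (k - j))
     \<longlonglongrightarrow> (\<Sum>k\<le>D. if k < j then 0 else c k * 0 ^ (k - j))"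
    by (intro tendsto_sum) (auto intro!: tendsto_intros c e(1))
  moreover have "(\<Sum>k\<le>D. if k < j then 0 else c k * 0 ^ (k - j)) = (\<Sum>k\<le>D. if k = j then c j else 0)"
    by (intro sum.cong) (auto simp: power_0_left)
  moreover have "\<dots> = c j"
  \<comment> \<open>Beyond the degree bound all j-th coefficients are 0, and so is their
    limit.\<close>
  proof (cases "j \<le> D")
    case False
    then have "(\<lambda>n. coeff (p n) j) = (\<lambda>n. 0)" using D by (metis coeff_eq_0 le_less_trans not_le)
    then have "c j = 0" using c[of j] by (simp add: LIMSEQ_const_iff)
    then show ?thesis by simp
  qed simp
  ultimately show ?thesis by simp
qed

section \<open>Roots of polynomials with varying coefficients\<close>

text \<open>The roots are numbered by the indices below d with repetition, so that single roots can
  be followed along a sequence.\<close>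

lemma complex_poly_factors:
  fixes p :: "complex poly"
  assumes "degree p = d"
  shows "\<exists>z. p = smult (coeff p d) (\<Prod>i<d. [:- z i, 1:])"
  using assms
proof (induction d arbitrary: p)
  case 0
  then show ?case by (auto elim: degree_eq_zeroE)
next
  case (Suc d)
  then obtain a where a: "poly p a = 0"
    using fundamental_theorem_of_algebra[of p] by (auto simp: constant_degree)
  then obtain q where q: "p = [:- a, 1:] * q" by (metis poly_eq_0_iff_dvd dvdE)
  then have "q \<noteq> 0" using Suc.prems by auto
  then have "degree p = degree [:- a, 1:] + degree q" unfolding q by (intro degree_mult_eq) auto
  then have dq: "degree q = d" using Suc.prems by simp
  then obtain z where z: "q = smult (coeff q d) (\<Prod>i<d. [:- z i, 1:])" using Suc.IH by blast
  have "coeff p (Suc d) = coeff q d"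
    unfolding q using dq by (simp add: coeff_eq_0)
  moreover have "(\<Prod>i<d. [:- (z(d := a)) i, 1:]) = (\<Prod>i<d. [:- z i, 1:])"
    by (intro prod.cong) auto
  ultimately have "p = smult (coeff p (Suc d)) (\<Prod>i<Suc d. [:- (z(d := a)) i, 1:])"
    unfolding prod.lessThan_Suc fun_upd_same using z q by (metis mult.commute mult_smult_left)
  then show ?case by blast
qed

lemma degree_prod_linear: "degree (\<Prod>i<d. [:- w i, 1:] :: complex poly) = (d :: nat)"
proof -
  have "degree (\<Prod>i<d. [:- w i, 1:]) = (\<Sum>i<d. degree [:- w i, 1:])"
    by (rule degree_prod_eq_sum_degree) auto
  then show ?thesis by simp
qed

lemma lead_coeff_prod_linear: "coeff (\<Prod>i<d. [:- w i, 1:] :: complex poly) (d :: nat) = 1"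
  using lead_coeff_prod[of "\<lambda>i. [:- w i, 1:]" "{..<d}"] by (simp add: degree_prod_linear)

text \<open>Each factor with \<open>b i = 0\<close> contributes one to the order of vanishing at 0,
  and the other factors none. Later \<open>b i\<close> is the difference of a point and a
  root.\<close>

lemma coeff_prod_linear_zero:
  fixes b :: "nat \<Rightarrow> complex"
  defines "p \<equiv> \<lambda>d. (\<Prod>i<d. [:b i, 1:])" and "m \<equiv> \<lambda>d. card {i. i < d \<and> b i = 0}"
  shows "(\<forall>j<m d. coeff (p d) j = 0) \<and> coeff (p d) (m d) \<noteq> 0"
proof (induction d)
  case 0
  then show ?case by (simp add: p_def m_def)
next
  case (Suc d)
  have "{i. i < Suc d \<and> b i = 0} = {i. i < d \<and> b i = 0} \<union> (if b d = 0 then {d} else {})"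
    by (auto simp: less_Suc_eq)
  then have m: "m (Suc d) = m d + (if b d = 0 then 1 else 0)"
    by (auto simp: m_def)
  have p: "p (Suc d) = [:b d, 1:] * p d" by (simp add: p_def)
  show ?case
  proof (cases "b d = 0")
    case True
    have "coeff (p (Suc d)) j = (if j = 0 then 0 else coeff (p d) (j - 1))" for j
      using True by (cases j) (simp_all add: p)
    then show ?thesis using Suc True by (auto simp: m)
  next
    case False
    have "coeff (p (Suc d)) j = b d * coeff (p d) j + (if j = 0 then 0 else coeff (p d) (j - 1))" for j
      by (cases j) (simp_all add: p)
    moreover have "(if m d = 0 then 0 else coeff (p d) (m d - 1)) = 0" using Suc by auto
    ultimately show ?thesis using Suc False by (auto simp: m)
  qed
qed

text \<open>Cauchy's bound: for a root of norm greater than 1 the lower terms together are at most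
  the sum of the norms of their coefficients times the power of degree d - 1, and they must balance
  the leading term.\<close>

lemma root_bound:
  fixes p :: "complex poly"
  assumes "degree p \<le> d" "coeff p d = c" "c \<noteq> 0" "poly p x = 0" "d > 0"
  shows "norm x \<le> 1 + (\<Sum>k<d. norm (coeff p k)) / norm c"
proof (cases "norm x \<le> 1")
  case True
  have "0 \<le> (\<Sum>k<d. norm (coeff p k)) / norm c" by (simp add: sum_nonneg)
  then show ?thesis using True by linarith
next
  case False
  then have x: "norm x > 1" by simp
  obtain e where e: "d = Suc e" using assms(5) by (cases d) auto
  have "0 = (\<Sum>k<d. coeff p k * x ^ k) + c * x ^ d"
    using assms(4) unfolding poly_as_sum_le[OF assms(1)] e lessThan_Suc_atMost[symmetric]
    by (simp add: assms(2)[unfolded e])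
  then have "norm (c * x ^ d) = norm (\<Sum>k<d. coeff p k * x ^ k)"
    by (metis add_eq_0_iff norm_minus_cancel)
  also have "\<dots> \<le> (\<Sum>k<d. norm (coeff p k) * norm x ^ k)"
    by (rule order_trans[OF norm_sum]) (simp add: norm_mult norm_power)
  also have "\<dots> \<le> (\<Sum>k<d. norm (coeff p k) * norm x ^ e)"
    using x by (intro sum_mono mult_left_mono power_increasing) (auto simp: e)
  also have "\<dots> = (\<Sum>k<d. norm (coeff p k)) * norm x ^ e" by (simp add: sum_distrib_right)
  finally have "norm c * norm x * norm x ^ e \<le> (\<Sum>k<d. norm (coeff p k)) * norm x ^ e"
    by (simp add: norm_mult norm_power e mult_ac)
  then have "norm c * norm x \<le> (\<Sum>k<d. norm (coeff p k))"
    by (rule mult_right_le_imp_le) (insert x, rule zero_less_power, linarith)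
  then have "norm x \<le> (\<Sum>k<d. norm (coeff p k)) / norm c"
    using assms(3) by (simp add: field_simps)
  then show ?thesis by simp
qed

lemma subseq_finite_family:
  fixes z :: "nat \<Rightarrow> nat \<Rightarrow> complex"
  assumes "\<And>i. i < d \<Longrightarrow> bounded (range (\<lambda>n. z n i))"
  shows "\<exists>\<sigma> l. strict_mono \<sigma> \<and> (\<forall>i<d. (\<lambda>n. z (\<sigma> n) i) \<longlonglongrightarrow> l i)"
  using assms
proof (induction d)
  case 0
  show ?case by (rule exI[of _ "\<lambda>n. n"]) (auto simp: strict_mono_def)
next
  case (Suc d)
  then obtain \<sigma> l where \<sigma>: "strict_mono \<sigma>" "\<And>i. i < d \<Longrightarrow> (\<lambda>n. z (\<sigma> n) i) \<longlonglongrightarrow> l i" by auto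
  have "bounded (range (\<lambda>n. z (\<sigma> n) d))"
    by (rule bounded_subset[OF Suc.prems[of d]]) auto
  then obtain a \<rho> where \<rho>: "strict_mono \<rho>" "((\<lambda>n. z (\<sigma> n) d) \<circ> \<rho>) \<longlonglongrightarrow> a"
    using bounded_imp_convergent_subsequence by blast
  have "(\<lambda>n. z ((\<sigma> \<circ> \<rho>) n) i) \<longlonglongrightarrow> (l(d := a)) i" if "i < Suc d" for i
    using \<rho>(2) LIMSEQ_subseq_LIMSEQ[OF \<sigma>(2) \<rho>(1), of i] that
    by (cases "i = d") (auto simp: o_def)
  then show ?case using strict_mono_o[OF \<sigma>(1) \<rho>(1)] by blast
qed

text \<open>A substitute for continuity of roots. As the leading coefficient is constant, no root
  escapes to infinity; on a subsequence all roots converge, and comparing coefficients shows that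
  the limits are the roots of the limit polynomial with multiplicity.\<close>

lemma roots_subseq:
  fixes P :: "nat \<Rightarrow> complex poly" and d :: nat
  assumes f: "\<And>n. P n = smult c (\<Prod>i<d. [:- z n i, 1:])" and c: "c \<noteq> 0"
    and l: "\<And>k. (\<lambda>n. coeff (P n) k) \<longlonglongrightarrow> coeff P0 k"
  shows "\<exists>\<sigma> l. strict_mono \<sigma> \<and> (\<forall>i<d. (\<lambda>n. z (\<sigma> n) i) \<longlonglongrightarrow> l i) \<and> P0 = smult c (\<Prod>i<d. [:- l i, 1:])"
proof -
  note m = degree_prod_linear lead_coeff_prod_linear
  have "bounded (range (\<lambda>n. z n i))" if i: "i < d" for i
  proof -
    have "bounded (range (\<lambda>n. (\<Sum>k<d. norm (coeff (P n) k))))"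
      by (rule convergent_imp_bounded[of _ "\<Sum>k<d. norm (coeff P0 k)"]) (intro tendsto_intros l)
    then obtain B where B: "\<And>n. norm (\<Sum>k<d. norm (coeff (P n) k)) \<le> B"
      unfolding bounded_iff by auto
    have "norm (z n i) \<le> 1 + B / norm c" for n
    proof -
      have "poly (P n) (z n i) = 0" unfolding f using i by (auto simp: poly_prod intro!: prod_zero)
      then have "norm (z n i) \<le> 1 + (\<Sum>k<d. norm (coeff (P n) k)) / norm c"
        using c m i by (intro root_bound) (auto simp: f)
      also have "\<dots> \<le> 1 + B / norm c"
        using B[of n] by (intro add_left_mono divide_right_mono) auto
      finally show ?thesis .
    qed
    then show ?thesis unfolding bounded_iff by auto
  qed
  from subseq_finite_family[of d z, OF this] obtain \<sigma> w
    where \<sigma>: "strict_mono \<sigma>" and w: "\<And>i. i < d \<Longrightarrow> (\<lambda>n. z (\<sigma> n) i) \<longlonglongrightarrow> w i" by blast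
  have "P0 = smult c (\<Prod>i<d. [:- w i, 1:])"
  proof (rule poly_eqI)
    fix k
    have pr: "(\<lambda>n. coeff (\<Prod>i<e. [:- z (\<sigma> n) i, 1:]) j) \<longlonglongrightarrow> coeff (\<Prod>i<e. [:- w i, 1:]) j" if "e \<le> d" for e j
      using that
    proof (induction e arbitrary: j)
      case (Suc e)
      have "(\<lambda>n. coeff ((\<Prod>i<e. [:- z (\<sigma> n) i, 1:]) * [:- z (\<sigma> n) e, 1:]) j) \<longlonglongrightarrow>
        coeff ((\<Prod>i<e. [:- w i, 1:]) * [:- w e, 1:]) j"
      proof (rule ptend_mult)
        show "(\<lambda>n. coeff [:- z (\<sigma> n) e, 1:] k) \<longlonglongrightarrow> coeff [:- w e, 1:] k" for k
          using w[of e] Suc.prems by (auto simp: coeff_pCons intro!: tendsto_intros split: nat.splits)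
      qed (use Suc in auto)
      then show ?case by (simp del: mult_pCons_right)
    qed simp
    have "(\<lambda>n. coeff (P (\<sigma> n)) k) \<longlonglongrightarrow> coeff (smult c (\<Prod>i<d. [:- w i, 1:])) k"
      unfolding f coeff_smult by (intro tendsto_mult tendsto_const pr) simp
    moreover have "(\<lambda>n. coeff (P (\<sigma> n)) k) \<longlonglongrightarrow> coeff P0 k"
      using LIMSEQ_subseq_LIMSEQ[OF l \<sigma>] by (simp add: o_def)
    ultimately show "coeff P0 k = coeff (smult c (\<Prod>i<d. [:- w i, 1:])) k"
      using LIMSEQ_unique by blast
  qed
  then show ?thesis using \<sigma> w by blast
qed

text \<open>Write r as the k-th power of the linear factor times q with q nonzero at x0. Then r
  decays exactly like the k-th power of \<open>\<tau>\<close> along any sequence, so one sequence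
  already decides k.\<close>

lemma order_from_limit:
  fixes r :: "complex poly"
  assumes r: "r \<noteq> 0" and t: "\<tau> \<longlonglongrightarrow> 0" "\<And>n. \<tau> n \<noteq> 0"
    and l: "(\<lambda>n. norm (poly r (x0 + \<tau> n)) / norm (\<tau> n) ^ s) \<longlonglongrightarrow> L"
  shows "s \<le> order x0 r" "order x0 r = s \<longleftrightarrow> L \<noteq> 0"
proof -
  define k where "k = order x0 r"
  obtain q where q: "r = [:- x0, 1:] ^ k * q" "\<not> [:- x0, 1:] dvd q"
    using order_decomp[OF r, of x0] k_def by blast
  then have q0: "poly q x0 \<noteq> 0" by (simp add: poly_eq_0_iff_dvd)
  have e: "norm (poly r (x0 + \<tau> n)) = norm (\<tau> n) ^ k * norm (poly q (x0 + \<tau> n))" for n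
    by (simp add: q(1) norm_mult norm_power)
  have ql: "(\<lambda>n. norm (poly q (x0 + \<tau> n))) \<longlonglongrightarrow> norm (poly q (x0 + 0))"
    by (intro tendsto_intros t)
  have tn: "(\<lambda>n. norm (\<tau> n)) \<longlonglongrightarrow> 0" using tendsto_norm[OF t(1)] by simp
  show sk: "s \<le> order x0 r"
  proof (rule ccontr)
    assume "\<not> s \<le> order x0 r"
    then have ks: "k < s" by (simp add: k_def)
    have "norm (poly q (x0 + \<tau> n)) = (norm (poly r (x0 + \<tau> n)) / norm (\<tau> n) ^ s) * norm (\<tau> n) ^ (s - k)" for n
      using ks t(2)[of n] by (simp add: e power_diff)
    then have "(\<lambda>n. norm (poly q (x0 + \<tau> n))) \<longlonglongrightarrow> L * 0 ^ (s - k)"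
      by (simp only:) (intro tendsto_intros l tn)
    then have "norm (poly q x0) = L * 0 ^ (s - k)" using LIMSEQ_unique ql by fastforce
    then show False using q0 ks by (auto simp: power_0_left)
  qed
  have "norm (poly r (x0 + \<tau> n)) / norm (\<tau> n) ^ s = norm (\<tau> n) ^ (k - s) * norm (poly q (x0 + \<tau> n))" for n
    using sk t(2)[of n] by (simp add: e power_diff k_def)
  then have "(\<lambda>n. norm (poly r (x0 + \<tau> n)) / norm (\<tau> n) ^ s) \<longlonglongrightarrow> 0 ^ (k - s) * norm (poly q (x0 + 0))"
    by (simp only:) (intro tendsto_intros tn t)
  then have "L = 0 ^ (k - s) * norm (poly q x0)" using LIMSEQ_unique l by fastforce
  then show "order x0 r = s \<longleftrightarrow> L \<noteq> 0"
    using q0 sk by (auto simp: k_def power_0_left split: if_splits)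
qed

subsection \<open>Norms via Newton's identities\<close>

lemma geometric_fps:
  "(1 - fps_const (c :: complex) * fps_X) * Abs_fps (\<lambda>k. if k = 0 then 0 else c ^ k) = fps_const c * fps_X"
proof (rule fps_ext)
  fix n
  show "fps_nth ((1 - fps_const c * fps_X) * Abs_fps (\<lambda>k. if k = 0 then 0 else c ^ k)) n =
        fps_nth (fps_const c * fps_X) n"
    by (cases n rule: nat.exhaust; cases "n = 1")
       (auto simp: algebra_simps fps_X_mult_nth mult.assoc simp flip: mult.assoc split: if_splits,
        auto simp: mult.assoc fps_mult_left_const_nth power_eq_if)
qed

text \<open>The logarithmic derivative of the product: each factor contributes a geometric series,
  and these add up to the generating series of the power sums.\<close>

lemma newton_fps:
  fixes z :: "nat \<Rightarrow> complex"
  defines "f \<equiv> \<lambda>d. (\<Prod>i<d. 1 - fps_const (z i) * fps_X)"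
    and "p \<equiv> \<lambda>d. Abs_fps (\<lambda>k. if k = 0 then 0 else \<Sum>i<d. z i ^ k)"
  shows "fps_X * fps_deriv (f d) = - f d * p d"
proof (induction d)
  case 0
  have "p 0 = 0" by (rule fps_ext) (simp add: p_def)
  then show ?case by (simp add: f_def)
next
  case (Suc d)
  define g where "g = Abs_fps (\<lambda>k. if k = 0 then 0 else z d ^ k)"
  define a where "a = fps_const (z d) * fps_X"
  have g: "(1 - a) * g = a" unfolding a_def g_def by (rule geometric_fps)
  have pS: "p (Suc d) = p d + g" by (rule fps_ext) (simp add: p_def g_def)
  have fS: "f (Suc d) = f d * (1 - a)" by (simp add: f_def a_def)
  have da: "fps_X * fps_deriv a = a" by (simp add: a_def)
  have "fps_X * fps_deriv (f (Suc d)) = f d * (- (fps_X * fps_deriv a)) + (fps_X * fps_deriv (f d)) * (1 - a)"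
    unfolding fS by (simp add: algebra_simps)
  also have "\<dots> = - (f d * (1 - a)) * p d - f d * ((1 - a) * g)"
    unfolding da Suc g by (simp add: algebra_simps)
  also have "\<dots> = - f (Suc d) * p (Suc d)" unfolding fS pS by (simp add: algebra_simps)
  finally show ?case .
qed

lemma newton_coeff:
  fixes z :: "nat \<Rightarrow> complex" and d :: nat
  defines "f \<equiv> (\<Prod>i<d. 1 - fps_const (z i) * fps_X)"
  assumes "k > 0"
  shows "of_nat k * fps_nth f k = - (\<Sum>i<k. fps_nth f i * (\<Sum>j<d. z j ^ (k - i)))"
proof -
  have "fps_nth (fps_X * fps_deriv f) k = of_nat k * fps_nth f k"
    using assms(2) by (cases k) (auto simp: fps_X_mult_nth)
  moreover have "fps_nth (- f * Abs_fps (\<lambda>k. if k = 0 then 0 else \<Sum>i<d. z i ^ k)) k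
      = - (\<Sum>i<k. fps_nth f i * (\<Sum>j<d. z j ^ (k - i)))"
  proof -
    \<comment> \<open>The term with i = k is absent because the series of power sums has no constant
      term.\<close>
    have "{0..k} = insert k {..<k}" by auto
    then show ?thesis by (auto simp: fps_mult_nth sum_negf intro!: sum.cong)
  qed
  ultimately show ?thesis using newton_fps[of z d] by (simp add: f_def)
qed

text \<open>The product on the left is the reversed polynomial; this connects Newton's identities
  for the series with the coefficients of a polynomial having the roots z.\<close>

lemma fps_nth_prod_linear:
  fixes z :: "nat \<Rightarrow> complex"
  shows "fps_nth (\<Prod>i<d. 1 - fps_const (z i) * fps_X) k = (if k \<le> d then coeff (\<Prod>i<d. [:- z i, 1:]) (d - k) else 0)"
proof (induction d arbitrary: k)
  case 0
  then show ?case by (auto)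
next
  case (Suc d)
  have "(\<Prod>i<Suc d. 1 - fps_const (z i) * fps_X) = (\<Prod>i<d. 1 - fps_const (z i) * fps_X)
     - fps_const (z d) * (fps_X * (\<Prod>i<d. 1 - fps_const (z i) * fps_X))"
    by (simp add: algebra_simps)
  then have "fps_nth (\<Prod>i<Suc d. 1 - fps_const (z i) * fps_X) k =
     fps_nth (\<Prod>i<d. 1 - fps_const (z i) * fps_X) k
     - z d * (if k = 0 then 0 else fps_nth (\<Prod>i<d. 1 - fps_const (z i) * fps_X) (k - 1))"
    by (simp add: fps_X_mult_nth)
  moreover have dg: "coeff (\<Prod>i<d. [:- z i, 1:]) j = 0" if "j > d" for j
    using that by (intro coeff_eq_0) (simp add: degree_prod_linear)
  moreover have "coeff (\<Prod>i<Suc d. [:- z i, 1:]) j =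
     - z d * coeff (\<Prod>i<d. [:- z i, 1:]) j + (if j = 0 then 0 else coeff (\<Prod>i<d. [:- z i, 1:]) (j - 1))" for j
    by (cases j) (simp_all)
  ultimately show ?case
    by (auto simp: Suc dg Suc_diff_le not_le less_Suc_eq)
qed

text \<open>The relation \<open>R x z\<close> is meant to say that \<open>z\<close> lists the roots over the point \<open>x\<close>.\<close>

definition polyfun :: "(complex \<Rightarrow> (nat \<Rightarrow> complex) \<Rightarrow> bool) \<Rightarrow> (complex \<Rightarrow> (nat \<Rightarrow> complex) \<Rightarrow> complex) \<Rightarrow> bool" where
  "polyfun R g \<longleftrightarrow> (\<exists>p. \<forall>x z. R x z \<longrightarrow> g x z = poly p x)"

lemma polyfunI: "(\<And>x z. R x z \<Longrightarrow> g x z = poly p x) \<Longrightarrow> polyfun R g"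
  by (auto simp: polyfun_def)

lemma polyfun_mult: "polyfun R f \<Longrightarrow> polyfun R g \<Longrightarrow> polyfun R (\<lambda>x z. f x z * g x z)"
  unfolding polyfun_def by (metis poly_mult)

lemma polyfun_add: "polyfun R f \<Longrightarrow> polyfun R g \<Longrightarrow> polyfun R (\<lambda>x z. f x z + g x z)"
  unfolding polyfun_def by (metis poly_add)

lemma polyfun_const: "polyfun R (\<lambda>x z. c)"
  by (rule polyfunI[of _ _ "[:c:]"]) simp

lemma polyfun_poly: "polyfun R (\<lambda>x z. poly p x)"
  by (rule polyfunI) simp

lemma polyfun_uminus: "polyfun R f \<Longrightarrow> polyfun R (\<lambda>x z. - f x z)"
  using polyfun_mult[OF polyfun_const[of R "-1"]] by simp

lemma polyfun_sum: "(\<And>a. a \<in> A \<Longrightarrow> polyfun R (f a)) \<Longrightarrow> polyfun R (\<lambda>x z. \<Sum>a\<in>A. f a x z)"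
  by (induction A rule: infinite_finite_induct) (auto intro: polyfun_const polyfun_add)

text \<open>The sum over the roots of a power of Q is a combination of power sums of the roots, with
  coefficients polynomial in x; the product of the values of Q is not so directly accessible.
  Newton's identities lead from the coefficients of P to the power sums of the roots, and from the
  power sums of the values of Q back to their product. The relation admits every enumeration z, so
  the roots may be numbered anew at each x.\<close>

lemma norm_polynomial:
  fixes P Q :: "complex poly poly" and d :: nat
  assumes c: "c \<noteq> 0"
  shows "\<exists>r. \<forall>x z. map_poly (\<lambda>p. poly p x) P = smult c (\<Prod>i<d. [:- z i, 1:]) \<longrightarrow>
     poly r x = (\<Prod>i<d. poly (map_poly (\<lambda>p. poly p x) Q) (z i))"
proof -
  define R where "R = (\<lambda>x z. map_poly (\<lambda>p. poly p x) P = smult c (\<Prod>i<d. [:- z i, 1:]))"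
  define e where "e = (\<lambda>z :: nat \<Rightarrow> complex. \<Prod>i<d. 1 - fps_const (z i) * fps_X)"
  have ez: "(\<Prod>i<d. 1 - fps_const (z i) * fps_X) = e z" for z by (simp add: e_def)
  have e0: "fps_nth (e z) 0 = 1" for z
    by (simp add: e_def fps_nth_prod_linear lead_coeff_prod_linear)
  have pe: "polyfun R (\<lambda>x z. fps_nth (e z) k)" for k
  proof (cases "k \<le> d")
    case True
    show ?thesis
    proof (rule polyfunI[where p = "smult (1 / c) (coeff P (d - k))"])
      fix x z assume "R x z"
      then have "coeff (map_poly (\<lambda>p. poly p x) P) (d - k) = c * coeff (\<Prod>i<d. [:- z i, 1:]) (d - k)"
        by (simp add: R_def)
      then show "fps_nth (e z) k = poly (smult (1 / c) (coeff P (d - k))) x"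
        using c True by (simp add: e_def fps_nth_prod_linear coeff_map_poly)
    qed
  next
    case False
    then show ?thesis by (simp add: e_def fps_nth_prod_linear polyfun_const)
  qed
  have pp: "polyfun R (\<lambda>x z. \<Sum>j<d. z j ^ k)" for k
  proof (induction k rule: less_induct)
    case (less k)
    show ?case
    proof (cases "k = 0")
      case False
      have "(\<Sum>j<d. z j ^ k) = - (of_nat k * fps_nth (e z) k)
         + - (\<Sum>i\<in>{1..<k}. fps_nth (e z) i * (\<Sum>j<d. z j ^ (k - i)))" for z :: "nat \<Rightarrow> complex"
      proof -
        have "{..<k} = insert 0 {1..<k}" using False by auto
        then show ?thesis
          using newton_coeff[of k z d] False unfolding ez by (simp add: e0)
      qed
      then show ?thesis
        by (simp only:) (intro polyfun_add polyfun_uminus polyfun_sum polyfun_mult polyfun_const pe less; use False in auto)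
    qed (simp add: polyfun_const)
  qed
  have pq: "polyfun R (\<lambda>x z. \<Sum>i<d. poly (map_poly (\<lambda>p. poly p x) Q) (z i) ^ k)" for k
  proof -
    have "poly (map_poly (\<lambda>p. poly p x) Q) y ^ k = (\<Sum>j\<le>degree (Q ^ k). poly (coeff (Q ^ k) j) x * y ^ j)" for x y
    proof -
      have "poly (map_poly (\<lambda>p. poly p x) Q) y ^ k = poly (map_poly (\<lambda>p. poly p x) (Q ^ k)) y"
        by (simp add: is_hom_power[OF is_hom_map_poly[OF is_hom_poly]])
      also have "\<dots> = (\<Sum>j\<le>degree (Q ^ k). poly (coeff (Q ^ k) j) x * y ^ j)"
        by (subst poly_as_sum_le[OF map_poly_degree_leq]) (simp add: coeff_map_poly)
      finally show ?thesis .
    qed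
    then have "(\<Sum>i<d. poly (map_poly (\<lambda>p. poly p x) Q) (z i) ^ k)
       = (\<Sum>j\<le>degree (Q ^ k). poly (coeff (Q ^ k) j) x * (\<Sum>i<d. z i ^ j))" for x z
      by (simp add: sum_distrib_left) (rule sum.swap)
    then show ?thesis
      by (simp only:) (intro polyfun_sum polyfun_mult polyfun_poly pp)
  qed
  define g where "g = (\<lambda>x z. \<Prod>i<d. 1 - fps_const (poly (map_poly (\<lambda>p. poly p x) Q) (z i)) * fps_X)"
  have ge: "g x z = e (\<lambda>i. poly (map_poly (\<lambda>p. poly p x) Q) (z i))" for x z
    by (simp add: g_def e_def)
  \<comment> \<open>Newton's identities in the reverse direction, dividing by k: the power sums of
    the values of Q give their elementary symmetric functions up to sign.\<close>
  have pg: "polyfun R (\<lambda>x z. fps_nth (g x z) k)" for k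
  proof (induction k rule: less_induct)
    case (less k)
    show ?case
    proof (cases "k = 0")
      case True
      have "fps_nth (g x z) 0 = 1" for x z
        using e0[of "\<lambda>i. poly (map_poly (\<lambda>p. poly p x) Q) (z i)"] by (simp add: g_def e_def)
      then show ?thesis using True by (simp add: polyfun_const)
    next
      case False
      have "fps_nth (g x z) k = (1 / of_nat k) *
         (- (\<Sum>i<k. fps_nth (g x z) i * (\<Sum>j<d. poly (map_poly (\<lambda>p. poly p x) Q) (z j) ^ (k - i))))" for x z
        using newton_coeff[of k "\<lambda>i. poly (map_poly (\<lambda>p. poly p x) Q) (z i)" d] False
        unfolding ez by (simp add: ge field_simps)
      then show ?thesis
        by (simp only:) (intro polyfun_uminus polyfun_sum polyfun_mult polyfun_const pq less; simp)
    qed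
  qed
  have "(\<Prod>i<d. w i) = (- 1) ^ d * fps_nth (\<Prod>i<d. 1 - fps_const (w i) * fps_X) d" for w :: "nat \<Rightarrow> complex"
  proof -
    have "coeff (\<Prod>i<d. [:- w i, 1:]) 0 = (\<Prod>i<d. - w i)"
      by (simp add: poly_prod flip: poly_0_coeff_0)
    also have "\<dots> = (\<Prod>i<d. (- 1) * w i)" by simp
    also have "\<dots> = (- 1) ^ d * (\<Prod>i<d. w i)" by (subst prod.distrib) simp
    finally show ?thesis by (simp add: fps_nth_prod_linear flip: mult.assoc power_mult_distrib)
  qed
  then have "(\<Prod>i<d. poly (map_poly (\<lambda>p. poly p x) Q) (z i)) = (- 1) ^ d * fps_nth (g x z) d" for x z
    by (simp add: g_def)
  then have "polyfun R (\<lambda>x z. \<Prod>i<d. poly (map_poly (\<lambda>p. poly p x) Q) (z i))"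
    by (simp only:) (intro polyfun_mult polyfun_const pg)
  then show ?thesis unfolding polyfun_def R_def by metis
qed

subsection \<open>Points of general position\<close>

text \<open>A weak substitute for being a polynomial function on the whole space: a point of general
  position is found by moving along a line joining two points.\<close>

definition poly_on_lines :: "(complex ^ 3 \<Rightarrow> complex) \<Rightarrow> bool" where
  "poly_on_lines f \<longleftrightarrow> (\<forall>a b. \<exists>p. \<forall>x. f (a + x *s b) = poly p x)"

lemma poly_on_lines_mult: "poly_on_lines f \<Longrightarrow> poly_on_lines g \<Longrightarrow> poly_on_lines (\<lambda>v. f v * g v)"
  unfolding poly_on_lines_def by (metis poly_mult)

lemma poly_on_lines_prod:
  "finite S \<Longrightarrow> (\<And>f. f \<in> S \<Longrightarrow> poly_on_lines f) \<Longrightarrow> poly_on_lines (\<lambda>v. \<Prod>f\<in>S. f v)"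
proof (induction S rule: finite_induct)
  case empty
  show ?case unfolding poly_on_lines_def by (auto intro: exI[of _ 1])
next
  case (insert f S)
  then show ?case using poly_on_lines_mult[of f] by simp
qed

text \<open>Join a point that is good for S to a point that is good for f. On this line both
  conditions are given by nonzero polynomials, so their product has a nonzero value
  somewhere.\<close>

lemma general_point:
  assumes "finite S" "\<And>f. f \<in> S \<Longrightarrow> poly_on_lines f" "\<And>f. f \<in> S \<Longrightarrow> \<exists>v. f v \<noteq> 0"
  shows "\<exists>v. \<forall>f\<in>S. f v \<noteq> 0"
  using assms
proof (induction S rule: finite_induct)
  case (insert f S)
  then obtain a where a: "\<And>g. g \<in> S \<Longrightarrow> g a \<noteq> 0" by auto
  obtain b where b: "f b \<noteq> 0" using insert.prems by auto
  have "poly_on_lines (\<lambda>v. \<Prod>g\<in>S. g v)" using insert by (intro poly_on_lines_prod) auto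
  then obtain p where p: "\<And>x. (\<Prod>g\<in>S. g (a + x *s (b - a))) = poly p x"
    unfolding poly_on_lines_def by meson
  obtain q where q: "\<And>x. f (a + x *s (b - a)) = poly q x"
    using insert.prems(1)[of f] unfolding poly_on_lines_def by (meson insertI1)
  have "poly p 0 \<noteq> 0" using p[of 0] a insert.hyps(1) by auto
  moreover have "poly q 1 \<noteq> 0" using q[of 1] b by auto
  ultimately have "p * q \<noteq> 0" by auto
  then have "finite {x. poly (p * q) x = 0}" by (rule poly_roots_finite)
  then obtain x where "poly (p * q) x \<noteq> 0"
    using infinite_UNIV_char_0[where 'a=complex] by (metis (mono_tags, lifting) Collect_cong ex_new_if_finite mem_Collect_eq)
  then have "f (a + x *s (b - a)) \<noteq> 0" "(\<Prod>g\<in>S. g (a + x *s (b - a))) \<noteq> 0" using p q by auto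
  then have "\<forall>g\<in>insert f S. g (a + x *s (b - a)) \<noteq> 0"
    using insert.hyps(1) by (auto simp: prod_zero_iff)
  then show ?case by blast
qed simp

section \<open>The Hessian along a sequence of points of the curve\<close>

lemma poly_tendsto_coeffs:
  fixes p :: "nat \<Rightarrow> complex poly"
  assumes c: "\<And>k. (\<lambda>n. coeff (p n) k) \<longlonglongrightarrow> coeff q k" and D: "\<And>n. degree (p n) \<le> D"
    and x: "x \<longlonglongrightarrow> y"
  shows "(\<lambda>n. poly (p n) (x n)) \<longlonglongrightarrow> poly q y"
proof -
  have "degree q \<le> D"
  proof (rule degree_le, intro allI impI)
    fix k assume "D < k"
    then have "(\<lambda>n. coeff (p n) k) = (\<lambda>n. 0)" using D by (metis coeff_eq_0 le_less_trans)
    then show "coeff q k = 0" using c[of k] by (simp add: LIMSEQ_const_iff)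
  qed
  then show ?thesis
    unfolding poly_as_sum_le[OF D] by (simp add: poly_as_sum_le) (intro tendsto_intros c x)
qed

lemma value_at_LP_tendsto:
  assumes "(v \<longlonglongrightarrow> v0)" "(w \<longlonglongrightarrow> w0)" "x \<longlonglongrightarrow> y"
  shows "(\<lambda>n. value_at F (v n + x n *s w n)) \<longlonglongrightarrow> value_at F (v0 + y *s w0)"
  unfolding poly_LP[symmetric]
  by (rule poly_tendsto_coeffs[OF coeff_LP_tendsto degree_LP_box]) (rule assms)+

lemma value_at_tendsto:
  assumes "v \<longlonglongrightarrow> v0"
  shows "(\<lambda>n. value_at F (v n)) \<longlonglongrightarrow> value_at F v0"
  using value_at_LP_tendsto[OF assms tendsto_const[of 0] tendsto_const[of 0]] by simp

lemma tendsto_scale_vec: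
  assumes "(c \<longlonglongrightarrow> c0)" "(v \<longlonglongrightarrow> v0)"
  shows "(\<lambda>n. c n *s (v n :: complex ^ 3)) \<longlonglongrightarrow> c0 *s v0"
  by (rule vec_tendstoI) (auto intro!: tendsto_intros assms)

lemma det3_shift: "det3 (v + x *s w) w u = det3 v w u" "det3 v (e + x *s u) u = det3 v e u"
  by (simp_all add: det3_def algebra_simps)

text \<open>The coefficient of \<open>F\<close> one degree higher vanishes for every direction, and
  its derivative along u is the coefficient in question.\<close>

lemma coeff_LP_dird_vanish:
  assumes "\<And>w j. j < m \<Longrightarrow> coeff (LP F v w) j = 0" "j < m - 1"
  shows "coeff (LP (dird u F) v w) j = 0"
proof -
  have "(\<lambda>x. coeff (LP F v (w + x *s u)) (Suc j)) = (\<lambda>x. 0)" using assms by auto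
  then show ?thesis
    using coeff_LP_deriv[of F v w u j] by (metis DERIV_const DERIV_unique)
qed

text \<open>In \<open>hess_identity\<close> every derivative is divided by the power of
  \<open>\<tau>\<close> that matches its own order. The delicate ones are the derivatives along the
  moving direction: the leading form tends to 0 there without being 0, at a rate known only through
  the vanishing of \<open>F\<close> at the points.\<close>

lemma sing_seq:
  assumes hom: "homogeneous d F"
    and z: "\<And>w j. j < m \<Longrightarrow> coeff (LP F v w) j = 0" and m: "m \<ge> 2"
    and det: "det3 v e u \<noteq> 0"
    and \<eta>: "\<eta> \<longlonglongrightarrow> a" and \<tau>: "\<tau> \<longlonglongrightarrow> 0" "\<And>n. \<tau> n \<noteq> 0"
    and 0: "\<And>n. value_at F (v + \<tau> n *s (e + \<eta> n *s u)) = 0"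
  shows "coeff (LP F v (e + a *s u)) m = 0"
    and "(\<lambda>n. value_at (hessP F) (v + \<tau> n *s (e + \<eta> n *s u)) / \<tau> n ^ (3 * (m - 1))) \<longlonglongrightarrow>
       - ((of_nat d - 1)\<^sup>2 * (2 * coeff (LP F v (e + a *s u)) (m + 1)
          * (coeff (LP (dird u F) v (e + a *s u)) (m - 1))\<^sup>2)) / (det3 v e u)\<^sup>2"
proof -
  obtain k where k: "m = k + 2" using m by (metis add.commute le_iff_add)
  define \<omega> where "\<omega> = (\<lambda>n. e + \<eta> n *s u)"
  define \<omega>0 where "\<omega>0 = e + a *s u"
  define y where "y = (\<lambda>n. v + \<tau> n *s \<omega> n)"
  define G where "G = dird u F"
  define B where "B = coeff (LP F v \<omega>0) (m + 1)"
  define A where "A = coeff (LP G v \<omega>0) (m - 1)"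
  define A2 where "A2 = coeff (LP (dird u G) v \<omega>0) (m - 2)"
  have \<omega>: "\<omega> \<longlonglongrightarrow> \<omega>0"
    unfolding \<omega>_def \<omega>0_def by (intro tendsto_intros tendsto_scale_vec \<eta>)
  have c: "(\<lambda>n. coeff (LP H v (\<omega> n)) k) \<longlonglongrightarrow> coeff (LP H v \<omega>0) k" for H k
    by (rule coeff_LP_tendsto[OF tendsto_const \<omega>])
  have zG: "coeff (LP G v w) j = 0" if "j < m - 1" for w j
    unfolding G_def by (rule coeff_LP_dird_vanish[OF z that])
  have zGG: "coeff (LP (dird u G) v w) j = 0" if "j < m - 2" for w j
    by (rule coeff_LP_dird_vanish[OF zG]) (use that in auto)
  have y0: "value_at F (y n) = 0" for n using 0 by (simp add: y_def \<omega>_def)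
  have "(\<lambda>n. poly (LP F v (\<omega> n)) (\<tau> n) / \<tau> n ^ m) \<longlonglongrightarrow> coeff (LP F v \<omega>0) m"
    by (rule poly_div_tendsto[OF c degree_LP_box z \<tau>])
  moreover have "(\<lambda>n. poly (LP F v (\<omega> n)) (\<tau> n) / \<tau> n ^ m) = (\<lambda>n. 0)"
    using y0 by (simp add: poly_LP y_def)
  ultimately have t0: "coeff (LP F v \<omega>0) m = 0" by (simp add: LIMSEQ_const_iff)
  then show "coeff (LP F v (e + a *s u)) m = 0" by (simp add: \<omega>0_def)
  have a1: "(\<lambda>n. value_at (dird (\<omega> n) F) (y n) / \<tau> n ^ (k + 2)) \<longlonglongrightarrow> B"
  proof -
    \<comment> \<open>For f the restriction of \<open>F\<close> to the line, this is $x f' - m f$.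
      At the points of the sequence it equals $x f'$, since f vanishes there, and its coefficient of
      degree m is zero; so the uncontrolled value of the leading form disappears and the order rises
      to m + 1.\<close>
    define p where "p = (\<lambda>n. pCons 0 (pderiv (LP F v (\<omega> n))) - smult (of_nat m) (LP F v (\<omega> n)))"
    have pc: "coeff (p n) j = (of_nat j - of_nat m) * coeff (LP F v (\<omega> n)) j" for n j
      by (cases j) (auto simp: p_def coeff_pderiv algebra_simps)
    have "(\<lambda>n. poly (p n) (\<tau> n) / \<tau> n ^ (m + 1)) \<longlonglongrightarrow> (of_nat (m + 1) - of_nat m) * coeff (LP F v \<omega>0) (m + 1)"
    proof (rule poly_div_tendsto[where c = "\<lambda>j. (of_nat j - of_nat m) * coeff (LP F v \<omega>0) j" and D = "3 * box3 F"])
      show "(\<lambda>n. coeff (p n) j) \<longlonglongrightarrow> (of_nat j - of_nat m) * coeff (LP F v \<omega>0) j" for j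
        unfolding pc by (intro tendsto_intros c)
      show "degree (p n) \<le> 3 * box3 F" for n
        by (rule degree_le) (use degree_LP_box[of F v "\<omega> n"] in \<open>auto simp: pc coeff_eq_0\<close>)
      show "coeff (p n) j = 0" if "j < m + 1" for n j
        using that z[of j] by (cases "j = m") (auto simp: pc)
    qed (use \<tau> in auto)
    moreover have "poly (p n) (\<tau> n) / \<tau> n ^ (m + 1) = value_at (dird (\<omega> n) F) (y n) / \<tau> n ^ (k + 2)" for n
    proof -
      have "poly (p n) (\<tau> n) = \<tau> n * value_at (dird (\<omega> n) F) (y n)"
        using y0[of n] by (simp add: p_def pderiv_LP poly_LP y_def)
      then show ?thesis using \<tau>(2)[of n] by (simp add: k)
    qed
    ultimately show ?thesis by (simp add: B_def)
  qed
  have a2: "(\<lambda>n. hq F (y n) (\<omega> n) (\<omega> n) / \<tau> n ^ (k + 1)) \<longlonglongrightarrow> 2 * of_nat m * B"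
  proof -
    \<comment> \<open>In the same way $x^2 f'' - m(m-1) f$; in degree m + 1 its factor is $(m+1)m -
      m(m-1) = 2m$.\<close>
    define p where "p = (\<lambda>n. pCons 0 (pCons 0 (pderiv (pderiv (LP F v (\<omega> n)))))
        - smult (of_nat m * (of_nat m - 1)) (LP F v (\<omega> n)))"
    have pc: "coeff (p n) j = (of_nat j * (of_nat j - 1) - of_nat m * (of_nat m - 1)) * coeff (LP F v (\<omega> n)) j" for n j
      by (auto simp: p_def coeff_pderiv coeff_pCons algebra_simps split: nat.splits)
    have pl: "(\<lambda>n. poly (p n) (\<tau> n) / \<tau> n ^ (m + 1)) \<longlonglongrightarrow>
      (of_nat (m + 1) * (of_nat (m + 1) - 1) - of_nat m * (of_nat m - 1)) * coeff (LP F v \<omega>0) (m + 1)"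
    proof (rule poly_div_tendsto[where c = "\<lambda>j. (of_nat j * (of_nat j - 1) - of_nat m * (of_nat m - 1)) * coeff (LP F v \<omega>0) j"
          and D = "3 * box3 F"])
      show "(\<lambda>n. coeff (p n) j) \<longlonglongrightarrow> (of_nat j * (of_nat j - 1) - of_nat m * (of_nat m - 1)) * coeff (LP F v \<omega>0) j" for j
        unfolding pc by (intro tendsto_intros c)
      show "degree (p n) \<le> 3 * box3 F" for n
        by (rule degree_le) (use degree_LP_box[of F v "\<omega> n"] in \<open>auto simp: pc coeff_eq_0\<close>)
      show "coeff (p n) j = 0" if "j < m + 1" for n j
        using that z[of j] by (cases "j = m") (auto simp: pc)
    qed (use \<tau> in auto)
    have pq: "poly (p n) (\<tau> n) / \<tau> n ^ (m + 1) = hq F (y n) (\<omega> n) (\<omega> n) / \<tau> n ^ (k + 1)" for n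
    proof -
      have "poly (p n) (\<tau> n) = \<tau> n * (\<tau> n * hq F (y n) (\<omega> n) (\<omega> n))"
        using y0[of n] by (simp add: p_def pderiv_LP poly_LP y_def hq_def)
      then show ?thesis using \<tau>(2)[of n] by (simp add: k)
    qed
    have "of_nat (m + 1) * (of_nat (m + 1) - 1) - of_nat m * (of_nat m - 1) = (2 * of_nat m :: complex)"
      by (simp add: algebra_simps)
    then show ?thesis using pl unfolding pq B_def by (simp only:)
  qed
  have a3: "(\<lambda>n. value_at G (y n) / \<tau> n ^ (k + 1)) \<longlonglongrightarrow> A"
    using poly_div_tendsto[where j = "m - 1", OF c degree_LP_box zG \<tau>] by (simp add: k poly_LP y_def A_def)
  have a4: "(\<lambda>n. \<tau> n * hq F (y n) (\<omega> n) u / \<tau> n ^ (k + 1)) \<longlonglongrightarrow> (of_nat m - 1) * A"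
  proof -
    define p where "p = (\<lambda>n. pCons 0 (pderiv (LP G v (\<omega> n))))"
    have pc: "coeff (p n) j = of_nat j * coeff (LP G v (\<omega> n)) j" for n j
      by (cases j) (auto simp: p_def coeff_pderiv)
    have "(\<lambda>n. poly (p n) (\<tau> n) / \<tau> n ^ (m - 1)) \<longlonglongrightarrow> of_nat (m - 1) * coeff (LP G v \<omega>0) (m - 1)"
    proof (rule poly_div_tendsto[where c = "\<lambda>j. of_nat j * coeff (LP G v \<omega>0) j" and D = "3 * box3 G"])
      show "(\<lambda>n. coeff (p n) j) \<longlonglongrightarrow> of_nat j * coeff (LP G v \<omega>0) j" for j
        unfolding pc by (intro tendsto_intros c)
      show "degree (p n) \<le> 3 * box3 G" for n
        by (rule degree_le) (use degree_LP_box[of G v "\<omega> n"] in \<open>auto simp: pc coeff_eq_0\<close>)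
      show "coeff (p n) j = 0" if "j < m - 1" for n j
        using that zG[of j] by (auto simp: pc)
    qed (use \<tau> in auto)
    then show ?thesis
      by (simp add: p_def pderiv_LP poly_LP y_def hq_def k G_def A_def)
  qed
  have a5: "(\<lambda>n. hq F (y n) u u / \<tau> n ^ k) \<longlonglongrightarrow> A2"
    using poly_div_tendsto[where j = "m - 2", OF c degree_LP_box zGG \<tau>] by (simp add: k poly_LP y_def A2_def hq_def G_def)
  define h where "h = (\<lambda>n. (value_at (dird (\<omega> n) F) (y n) / \<tau> n ^ (k + 2))\<^sup>2 * (hq F (y n) u u / \<tau> n ^ k) * \<tau> n
     - 2 * (value_at (dird (\<omega> n) F) (y n) / \<tau> n ^ (k + 2)) * (value_at G (y n) / \<tau> n ^ (k + 1))
         * (\<tau> n * hq F (y n) (\<omega> n) u / \<tau> n ^ (k + 1))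
     + (value_at G (y n) / \<tau> n ^ (k + 1))\<^sup>2 * (hq F (y n) (\<omega> n) (\<omega> n) / \<tau> n ^ (k + 1)))"
  have hl: "h \<longlonglongrightarrow> B\<^sup>2 * A2 * 0 - 2 * B * A * ((of_nat m - 1) * A) + A\<^sup>2 * (2 * of_nat m * B)"
    unfolding h_def by (intro tendsto_intros a1 a2 a3 a4 a5 \<tau>)
  have "value_at (hessP F) (y n) / \<tau> n ^ (3 * (m - 1)) = - ((of_nat d - 1)\<^sup>2 * h n) / (det3 v e u)\<^sup>2" for n
  proof -
    have dd: "det3 (y n) (\<omega> n) u = det3 v e u"
      unfolding y_def det3_shift(1) unfolding \<omega>_def by (rule det3_shift(2))
    have e3: "3 * (m - 1) = 3 * k + 3" using k by simp
    have "h n * \<tau> n ^ (3 * k + 3) = (value_at (dird (\<omega> n) F) (y n))\<^sup>2 * hq F (y n) u u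
         - 2 * value_at (dird (\<omega> n) F) (y n) * value_at G (y n) * hq F (y n) (\<omega> n) u
         + (value_at G (y n))\<^sup>2 * hq F (y n) (\<omega> n) (\<omega> n)"
      using \<tau>(2)[of n] unfolding h_def
      by (simp add: field_simps power2_eq_square power_add power_mult power3_eq_cube)
    then have "(det3 v e u)\<^sup>2 * value_at (hessP F) (y n) = - ((of_nat d - 1)\<^sup>2 * (h n * \<tau> n ^ (3 * k + 3)))"
      using hess_identity[OF hom, of "y n" "\<omega> n" u] unfolding dd y0 G_def by simp
    then show ?thesis unfolding e3 using \<tau>(2)[of n] det by (simp add: field_simps)
  qed
  moreover have "(\<lambda>n. - ((of_nat d - 1)\<^sup>2 * h n) / (det3 v e u)\<^sup>2) \<longlonglongrightarrow>
     - ((of_nat d - 1)\<^sup>2 * (B\<^sup>2 * A2 * 0 - 2 * B * A * ((of_nat m - 1) * A) + A\<^sup>2 * (2 * of_nat m * B))) / (det3 v e u)\<^sup>2"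
    by (intro tendsto_intros hl) (use det in auto)
  \<comment> \<open>The surviving summands contribute $-2(m-1)$ and $2m$ times $B A^2$.\<close>
  moreover have "B\<^sup>2 * A2 * 0 - 2 * B * A * ((of_nat m - 1) * A) + A\<^sup>2 * (2 * of_nat m * B) = 2 * B * A\<^sup>2"
    by (simp add: algebra_simps power2_eq_square)
  ultimately show "(\<lambda>n. value_at (hessP F) (v + \<tau> n *s (e + \<eta> n *s u)) / \<tau> n ^ (3 * (m - 1))) \<longlonglongrightarrow>
       - ((of_nat d - 1)\<^sup>2 * (2 * coeff (LP F v (e + a *s u)) (m + 1)
          * (coeff (LP (dird u F) v (e + a *s u)) (m - 1))\<^sup>2)) / (det3 v e u)\<^sup>2"
    by (simp add: y_def \<omega>_def \<omega>0_def A_def B_def G_def)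
qed

text \<open>As u is not a tangent direction, a cone of directions around u contains no points of the
  curve close to v other than v: points of the curve with directions tending to u would make the
  leading form vanish at u. Outside this cone the quotient of the two coordinates is
  bounded.\<close>

lemma sing_seq_bounded:
  assumes z: "\<And>w j. j < m \<Longrightarrow> coeff (LP F v w) j = 0" and nz: "coeff (LP F v u) m \<noteq> 0"
    and \<tau>: "\<tau> \<longlonglongrightarrow> 0" "\<And>n. \<tau> n \<noteq> 0" and \<zeta>: "\<zeta> \<longlonglongrightarrow> 0"
    and 0: "\<And>n. value_at F (v + \<tau> n *s e + \<zeta> n *s u) = 0"
  shows "bounded (range (\<lambda>n. \<zeta> n / \<tau> n))"
proof -
  have "\<exists>\<delta>>0. \<forall>\<sigma> x. norm \<sigma> < \<delta> \<longrightarrow> x \<noteq> 0 \<longrightarrow> norm x < \<delta> \<longrightarrow> value_at F (v + x *s (u + \<sigma> *s e)) \<noteq> 0"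
  proof (rule ccontr)
    assume neg: "\<not> ?thesis"
    have "\<exists>\<sigma> x. norm \<sigma> < 1 / real (Suc n) \<and> x \<noteq> 0 \<and> norm x < 1 / real (Suc n) \<and> value_at F (v + x *s (u + \<sigma> *s e)) = 0" for n
    proof -
      have "1 / real (Suc n) > 0" by simp
      then show ?thesis using neg by meson
    qed
    then obtain \<sigma> x where sx: "\<And>n. norm (\<sigma> n :: complex) < 1 / real (Suc n)" "\<And>n. x n \<noteq> 0"
       "\<And>n. norm (x n) < 1 / real (Suc n)" "\<And>n. value_at F (v + x n *s (u + \<sigma> n *s e)) = 0"
      by metis
    have l: "f \<longlonglongrightarrow> 0" if "\<And>n. norm (f n) < 1 / real (Suc n)" for f :: "nat \<Rightarrow> complex"
      using that by (intro Lim_null_comparison[OF _ LIMSEQ_inverse_real_of_nat])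
        (auto simp: inverse_eq_divide intro!: always_eventually less_imp_le)
    have w: "(\<lambda>n. u + \<sigma> n *s e) \<longlonglongrightarrow> u + 0 *s e"
      by (intro tendsto_intros tendsto_scale_vec l sx)
    have "(\<lambda>n. poly (LP F v (u + \<sigma> n *s e)) (x n) / x n ^ m) \<longlonglongrightarrow> coeff (LP F v (u + 0 *s e)) m"
      by (rule poly_div_tendsto[OF coeff_LP_tendsto[OF tendsto_const w] degree_LP_box z l[OF sx(3)] sx(2)])
    moreover have "poly (LP F v (u + \<sigma> n *s e)) (x n) = 0" for n by (simp only: poly_LP sx(4))
    ultimately show False using nz by (simp add: LIMSEQ_const_iff)
  qed
  then obtain \<delta> where \<delta>: "\<delta> > 0"
    "\<And>\<sigma> x. norm \<sigma> < \<delta> \<Longrightarrow> x \<noteq> 0 \<Longrightarrow> norm x < \<delta> \<Longrightarrow> value_at F (v + x *s (u + \<sigma> *s e)) \<noteq> 0" by blast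
  obtain N where N: "\<And>n. n \<ge> N \<Longrightarrow> norm (\<zeta> n) < \<delta>"
    using \<zeta> \<delta>(1) unfolding lim_sequentially by (auto simp: dist_norm)
  have "norm (\<zeta> n / \<tau> n) \<le> 1 / \<delta>" if "n \<ge> N" for n
  proof (cases "\<zeta> n = 0")
    case False
    \<comment> \<open>The same point, seen as lying in a direction close to u when
      \<open>\<tau> n / \<zeta> n\<close> is small.\<close>
    have ve: "v + \<zeta> n *s (u + (\<tau> n / \<zeta> n) *s e) = v + \<tau> n *s e + \<zeta> n *s u"
      using False by (simp add: vec_eq_iff field_simps)
    have "\<not> norm (\<tau> n / \<zeta> n) < \<delta>"
      using \<delta>(2)[of "\<tau> n / \<zeta> n" "\<zeta> n", unfolded ve] False N[OF that] 0[of n] by blast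
    then have "\<delta> * norm (\<zeta> n) \<le> norm (\<tau> n)"
      using False by (simp add: norm_divide not_less field_simps)
    then show ?thesis using \<tau>(2)[of n] \<delta>(1) by (simp add: norm_divide field_simps)
  qed (use \<delta>(1) in auto)
  then have "Bseq (\<lambda>n. \<zeta> (n + N) / \<tau> (n + N))"
    by (intro BseqI'[of _ "1 / \<delta>"]) auto
  then have "Bseq (\<lambda>n. \<zeta> n / \<tau> n)" by (rule Bseq_offset)
  then show ?thesis by (simp add: Bseq_eq_bounded)
qed

text \<open>Compare with the point y on the tangent line. There \<open>F\<close> is of order
  \<open>s ^ k\<close>, so the correction \<open>\<zeta>\<close> along the transversal direction has
  the same order, with limit \<open>- c / b\<close>. The Hessian at y is dominated by the second
  derivative along the tangent, of order k - 2, and the correction changes it only at order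
  k.\<close>

lemma smooth_seq:
  assumes hom: "homogeneous d F" and d: "d \<ge> 2"
    and z: "\<And>j. j < k \<Longrightarrow> coeff (LP F v w) j = 0" and k: "k \<ge> 2"
    and nz: "coeff (LP F v w) k \<noteq> 0"
    and u: "value_at (dird u F) v \<noteq> 0" and det: "det3 v w u \<noteq> 0"
    and s: "s \<longlonglongrightarrow> 0" "\<And>n. s n \<noteq> 0" and \<zeta>: "\<zeta> \<longlonglongrightarrow> 0"
    and 0: "\<And>n. value_at F (v + s n *s w + \<zeta> n *s u) = 0"
  shows "\<exists>b. b \<noteq> 0 \<and> (\<lambda>n. \<zeta> n / s n ^ k) \<longlonglongrightarrow> b"
    and "\<exists>C. C \<noteq> 0 \<and> (\<lambda>n. value_at (hessP F) (v + s n *s w + \<zeta> n *s u) / s n ^ (k - 2)) \<longlonglongrightarrow> C"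
proof -
  obtain j where j: "k = j + 2" using k by (metis add.commute le_iff_add)
  define c where "c = coeff (LP F v w) k"
  define y where "y = (\<lambda>n. v + s n *s w)"
  have y: "y \<longlonglongrightarrow> v + 0 *s w"
    unfolding y_def by (intro tendsto_intros tendsto_scale_vec s)
  then have yl: "y \<longlonglongrightarrow> v" by simp
  define q where "q = (\<lambda>H n. poly (poly_shift 1 (LP H (y n) u)) (\<zeta> n))"
  have qe: "value_at H (v + s n *s w + \<zeta> n *s u) = value_at H (y n) + \<zeta> n * q H n" for H n
  proof -
    have "LP H (y n) u = pCons (value_at H (y n)) (poly_shift 1 (LP H (y n) u))"
      by (rule poly_eqI) (auto simp: coeff_pCons coeff_poly_shift coeff_0_LP split: nat.splits)
    then have "poly (LP H (y n) u) (\<zeta> n) = value_at H (y n) + \<zeta> n * q H n"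
      unfolding q_def by (metis poly_pCons)
    then show ?thesis by (simp add: poly_LP y_def)
  qed
  have ql: "q H \<longlonglongrightarrow> poly (poly_shift 1 (LP H v u)) 0" for H
    unfolding q_def
  proof (rule poly_tendsto_coeffs[OF _ _ \<zeta>])
    show "(\<lambda>n. coeff (poly_shift 1 (LP H (y n) u)) i) \<longlonglongrightarrow> coeff (poly_shift 1 (LP H v u)) i" for i
      unfolding coeff_poly_shift by (rule coeff_LP_tendsto[OF yl tendsto_const])
    show "degree (poly_shift 1 (LP H (y n) u)) \<le> 3 * box3 H" for n
      by (rule degree_le) (use degree_LP_box[of H "y n" u] in \<open>auto simp: coeff_poly_shift coeff_eq_0\<close>)
  qed
  have b: "poly (poly_shift 1 (LP F v u)) 0 = value_at (dird u F) v"
    using coeff_1_LP[of F v u] by (simp add: poly_0_coeff_0 coeff_poly_shift)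
  define b where "b = value_at (dird u F) v"
  have ql1: "q F \<longlonglongrightarrow> b" using ql[of F] by (simp only: b b_def)
  have \<Phi>: "(\<lambda>n. value_at F (y n) / s n ^ k) \<longlonglongrightarrow> c"
    using poly_div_tendsto[OF tendsto_const degree_LP_box z s] by (simp add: poly_LP y_def c_def)
  have \<zeta>l: "(\<lambda>n. \<zeta> n / s n ^ k) \<longlonglongrightarrow> - c / b"
  proof (rule Lim_transform_eventually)
    show "(\<lambda>n. - (value_at F (y n) / s n ^ k) / q F n) \<longlonglongrightarrow> - c / b"
      using u by (intro tendsto_intros \<Phi> ql1) (simp add: b_def)
    have "eventually (\<lambda>n. q F n \<noteq> 0) sequentially"
      using tendsto_imp_eventually_ne[OF ql1] u by (simp add: b_def)
    then show "eventually (\<lambda>n. - (value_at F (y n) / s n ^ k) / q F n = \<zeta> n / s n ^ k) sequentially"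
    proof (eventually_elim)
      case (elim n)
      have "\<zeta> n * q F n = - value_at F (y n)" using 0[of n] qe[of F n] by (simp add: add_eq_0_iff)
      then have "\<zeta> n = - value_at F (y n) / q F n" using elim by (simp add: field_simps)
      then show ?case by (simp add: field_simps)
    qed
  qed
  then show "\<exists>b. b \<noteq> 0 \<and> (\<lambda>n. \<zeta> n / s n ^ k) \<longlonglongrightarrow> b"
    using nz u by (intro exI[of _ "- c / b"]) (auto simp: c_def b_def)
  have w1: "(\<lambda>n. value_at (dird w F) (y n) / s n ^ (j + 1)) \<longlonglongrightarrow> of_nat k * c"
  proof -
    have "(\<lambda>n. poly (pderiv (LP F v w)) (s n) / s n ^ (j + 1)) \<longlonglongrightarrow> coeff (pderiv (LP F v w)) (j + 1)"
      by (rule poly_div_tendsto[OF tendsto_const order_refl _ s]) (use z in \<open>auto simp: coeff_pderiv j\<close>)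
    then show ?thesis by (simp add: pderiv_LP poly_LP y_def) (simp add: coeff_pderiv c_def j flip: pderiv_LP)
  qed
  have w2: "(\<lambda>n. hq F (y n) w w / s n ^ j) \<longlonglongrightarrow> of_nat k * (of_nat k - 1) * c"
  proof -
    have "(\<lambda>n. poly (pderiv (pderiv (LP F v w))) (s n) / s n ^ j) \<longlonglongrightarrow> coeff (pderiv (pderiv (LP F v w))) j"
      by (rule poly_div_tendsto[OF tendsto_const order_refl _ s]) (use z in \<open>auto simp: coeff_pderiv j\<close>)
    moreover have "coeff (pderiv (pderiv (LP F v w))) j = of_nat k * (of_nat k - 1) * c"
      by (simp add: coeff_pderiv c_def j algebra_simps)
    ultimately show ?thesis by (simp add: pderiv_LP poly_LP y_def hq_def)
  qed
  have vl: "(\<lambda>n. value_at H (y n)) \<longlonglongrightarrow> value_at H v" for H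
    by (rule value_at_tendsto[OF yl])
  \<comment> \<open>The points y lie on the tangent and in general not on the curve, so the summand
    of \<open>hess_identity\<close> with \<open>F\<close> remains; it still carries
    \<open>(s n)\<^sup>2\<close> after the division and drops out in the limit.\<close>
  define h where "h = (\<lambda>n. of_nat d * (of_nat d - 1) * ((value_at F (y n) / s n ^ k) * (s n)\<^sup>2
        * (hq F (y n) w w * hq F (y n) u u - (hq F (y n) w u)\<^sup>2))
     - (of_nat d - 1)\<^sup>2 * ((value_at (dird w F) (y n) / s n ^ (j + 1))\<^sup>2 * s n ^ (j + 2) * hq F (y n) u u
       - 2 * (value_at (dird w F) (y n) / s n ^ (j + 1)) * s n * value_at (dird u F) (y n) * hq F (y n) w u
       + (value_at (dird u F) (y n))\<^sup>2 * (hq F (y n) w w / s n ^ j)))"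
  have "h \<longlonglongrightarrow> of_nat d * (of_nat d - 1) * (c * 0\<^sup>2
        * (hq F v w w * hq F v u u - (hq F v w u)\<^sup>2))
     - (of_nat d - 1)\<^sup>2 * ((of_nat k * c)\<^sup>2 * 0 ^ (j + 2) * hq F v u u
       - 2 * (of_nat k * c) * 0 * value_at (dird u F) v * hq F v w u
       + (value_at (dird u F) v)\<^sup>2 * (of_nat k * (of_nat k - 1) * c))"
    unfolding h_def by (intro tendsto_intros \<Phi> w1 w2 s vl vl[of "dird _ (dird _ _)", folded hq_def])
  then have hl: "h \<longlonglongrightarrow> - (of_nat d - 1)\<^sup>2 * (b\<^sup>2 * (of_nat k * (of_nat k - 1) * c))"
    by (simp add: b_def)
  have hh: "value_at (hessP F) (y n) / s n ^ j = h n / (det3 v w u)\<^sup>2" for n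
  proof -
    have dd: "det3 (y n) w u = det3 v w u" by (simp add: y_def det3_shift)
    have "(det3 v w u)\<^sup>2 * value_at (hessP F) (y n) = h n * s n ^ j"
      unfolding hess_identity[OF hom, of "y n" w u, unfolded dd] h_def j
      using s(2)[of n] by (simp add: field_simps power2_eq_square power_add)
    then show ?thesis using s(2)[of n] det by (simp add: field_simps)
  qed
  \<comment> \<open>Passing from y to the point of the curve adds
    \<open>\<zeta> n * q (hessP F) n\<close>, which divided by the power k - 2 of \<open>s n\<close>
    tends to 0.\<close>
  have "(\<lambda>n. h n / (det3 v w u)\<^sup>2 + (\<zeta> n / s n ^ k) * (s n)\<^sup>2 * q (hessP F) n) \<longlonglongrightarrow>
     - (of_nat d - 1)\<^sup>2 * (b\<^sup>2 * (of_nat k * (of_nat k - 1) * c)) / (det3 v w u)\<^sup>2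
      + (- c / b) * 0\<^sup>2 * poly (poly_shift 1 (LP (hessP F) v u)) 0"
    using det by (intro tendsto_intros hl \<zeta>l s ql) auto
  moreover have "value_at (hessP F) (v + s n *s w + \<zeta> n *s u) / s n ^ (k - 2) =
     h n / (det3 v w u)\<^sup>2 + (\<zeta> n / s n ^ k) * (s n)\<^sup>2 * q (hessP F) n" for n
    unfolding qe hh[symmetric] j using s(2)[of n]
    by (simp add: field_simps power_add power2_eq_square)
  ultimately have "(\<lambda>n. value_at (hessP F) (v + s n *s w + \<zeta> n *s u) / s n ^ (k - 2)) \<longlonglongrightarrow>
     - (of_nat d - 1)\<^sup>2 * (b\<^sup>2 * (of_nat k * (of_nat k - 1) * c)) / (det3 v w u)\<^sup>2" by simp
  moreover have "of_nat d - 1 \<noteq> (0 :: complex)"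
    using d by (metis One_nat_def eq_iff_diff_eq_0 not_less_eq_eq numeral_2_eq_2 of_nat_1 of_nat_eq_iff order_refl)
  moreover have "of_nat k - 1 \<noteq> (0 :: complex)" "of_nat k \<noteq> (0 :: complex)"
    using k of_nat_eq_iff[of k 1, where 'a = complex] by auto
  ultimately show "\<exists>C. C \<noteq> 0 \<and> (\<lambda>n. value_at (hessP F) (v + s n *s w + \<zeta> n *s u) / s n ^ (k - 2)) \<longlonglongrightarrow> C"
    using nz u det by (intro exI[of _ "- (of_nat d - 1)\<^sup>2 * (b\<^sup>2 * (of_nat k * (of_nat k - 1) * c)) / (det3 v w u)\<^sup>2"])
      (auto simp: c_def b_def)
qed

section \<open>The points of the curve on a line through the centre of projection\<close>

definition is_mult :: "poly3 \<Rightarrow> complex ^ 3 \<Rightarrow> nat \<Rightarrow> bool" where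
  "is_mult F v m \<longleftrightarrow> (\<forall>j<m. \<forall>w. coeff (LP F v w) j = 0) \<and> (\<exists>w. coeff (LP F v w) m \<noteq> 0)"

definition sing_pt :: "poly3 \<Rightarrow> complex ^ 3 \<Rightarrow> nat \<Rightarrow> bool" where
  "sing_pt F v m \<longleftrightarrow> m \<ge> 2 \<and> is_mult F v m"

text \<open>Here k is the contact order with the tangent line. Directions are vectors of the ambient
  space: multiples of v do not move the projective point and are excluded, and all remaining tangent
  directions describe the same line.\<close>

definition smooth_pt :: "poly3 \<Rightarrow> complex ^ 3 \<Rightarrow> nat \<Rightarrow> bool" where
  "smooth_pt F v k \<longleftrightarrow> k \<ge> 2 \<and> value_at F v = 0 \<and> (\<exists>u. value_at (dird u F) v \<noteq> 0) \<and>
     (\<forall>w. value_at (dird w F) v = 0 \<longrightarrow> (\<nexists>c. w = c *s v) \<longrightarrow>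
        (\<forall>j<k. coeff (LP F v w) j = 0) \<and> coeff (LP F v w) k \<noteq> 0)"

text \<open>All tangent directions at \<open>v\<close> are simple roots of the leading form, and not roots of the next one.\<close>

definition good_pt :: "poly3 \<Rightarrow> complex ^ 3 \<Rightarrow> nat \<Rightarrow> bool" where
  "good_pt F v m \<longleftrightarrow> (\<forall>w. (\<nexists>c. w = c *s v) \<longrightarrow> coeff (LP F v w) m = 0 \<longrightarrow>
     coeff (LP F v w) (m + 1) \<noteq> 0 \<and> (\<exists>u. coeff (LP (dird u F) v w) (m - 1) \<noteq> 0))"

lemma is_mult_unique: "is_mult F v m \<Longrightarrow> is_mult F v m' \<Longrightarrow> m = m'"
  unfolding is_mult_def by (metis nat_neq_iff)

lemma sing_pt_unique: "sing_pt F v m \<Longrightarrow> sing_pt F v m' \<Longrightarrow> m = m'"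
  unfolding sing_pt_def using is_mult_unique by blast

lemma sing_not_smooth: "sing_pt F v m \<Longrightarrow> smooth_pt F v k \<Longrightarrow> False"
  using coeff_1_LP[of F v] unfolding sing_pt_def smooth_pt_def is_mult_def
  by (metis One_nat_def Suc_1 Suc_le_lessD)

lemma basis3:
  assumes "det3 a b c \<noteq> 0"
  shows "\<exists>x y z. u = x *s a + y *s b + z *s c"
proof -
  define D where "D = det3 a b c"
  have D: "D \<noteq> 0" using assms by (simp add: D_def)
  have "D *s u = det3 u b c *s a + det3 a u c *s b + det3 a b u *s c"
    by (simp add: vec_eq_iff forall_3 D_def det3_def algebra_simps)
  then have "(1 / D) *s (D *s u) = (det3 u b c / D) *s a + (det3 a u c / D) *s b + (det3 a b u / D) *s c"
    by (simp add: vec_eq_iff field_simps)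
  then have "u = (det3 u b c / D) *s a + (det3 a u c / D) *s b + (det3 a b u / D) *s c"
    using D by simp
  then show ?thesis by blast
qed

lemma det3_not_multiple: "det3 v w u \<noteq> 0 \<Longrightarrow> w \<noteq> c *s v"
  by (auto simp: det3_def algebra_simps)

lemma homogeneous_dird:
  assumes "homogeneous d F"
  shows "homogeneous (d - 1) (dird u F)"
proof -
  have "coeff3 (dird u F) i j k =
     u $ 1 * coeff3 (pd1 F) i j k + u $ 2 * coeff3 (pd2 F) i j k + u $ 3 * coeff3 (pd3 F) i j k" for i j k
    by (simp add: dird_def coeff3_def const3_def)
  then show ?thesis
    using homogeneous_pd[OF assms] unfolding homogeneous_def
    by (metis (no_types, lifting) add_0 mult_zero_right)
qed

lemma coeff_LP_lin: "coeff (LP (dird (a *s u + b *s w) F) v x) k =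
    a * coeff (LP (dird u F) v x) k + b * coeff (LP (dird w F) v x) k"
  by (simp add: LP_dird algebra_simps)

text \<open>Adding a multiple of v to the direction leaves the leading Taylor form unchanged, so its
  derivative along v is 0.\<close>

lemma dird_self_zero:
  assumes hom: "homogeneous d F" and mult: "is_mult F v m" and m: "m \<ge> 1"
  shows "coeff (LP (dird v F) v w) (m - 1) = 0"
proof -
  have "coeff (LP F v (w + x *s v)) m = coeff (LP F v w) m" for x
    using LP_shift(2)[OF hom, where k = m and v = v and w = w and c = 1 and a = 1 and b = x] mult
    by (simp add: is_mult_def)
  then have "((\<lambda>x. coeff (LP F v w) m) has_field_derivative coeff (LP (dird v F) v w) (m - 1)) (at 0)"
    using coeff_LP_deriv[of F v w v "m - 1"] m by simp
  then show ?thesis by (metis DERIV_const DERIV_unique)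
qed

text \<open>At a root w of the leading form the derivatives along v and along w vanish, the latter
  by Euler's relation for this form. A nonzero derivative in any direction must therefore come from
  the component along p.\<close>

lemma good_direction:
  assumes hom: "homogeneous d F" and mult: "is_mult F v m" and m: "m \<ge> 1" and det: "det3 v w p \<noteq> 0"
    and z: "coeff (LP F v w) m = 0" and u: "coeff (LP (dird u F) v w) (m - 1) \<noteq> 0"
  shows "coeff (LP (dird p F) v w) (m - 1) \<noteq> 0"
proof -
  have "coeff (LP (dird w F) v w) (m - 1) = 0"
    using z m by (simp add: coeff_pderiv flip: pderiv_LP)
  moreover have "coeff (LP (dird v F) v w) (m - 1) = 0" by (rule dird_self_zero[OF hom mult m])
  moreover obtain x y t where "u = x *s v + y *s w + t *s p" using basis3[OF det] by blast
  then have "coeff (LP (dird u F) v w) (m - 1) = 1 * (x * coeff (LP (dird v F) v w) (m - 1) +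
     y * coeff (LP (dird w F) v w) (m - 1)) + t * coeff (LP (dird p F) v w) (m - 1)"
    using coeff_LP_lin[of 1 "x *s v + y *s w" t p F v w "m - 1"] by (simp add: coeff_LP_lin)
  ultimately show ?thesis using u by auto
qed

text \<open>If p is transversal to the curve, then \<open>\<kappa> = 1\<close> and
  \<open>\<tau>\<close> is, to first order, a parameter along the tangent. If p is the tangent
  direction, then \<open>\<kappa> = k\<close> and the roles change: \<open>\<zeta>\<close> is the
  parameter and \<open>\<tau>\<close> is of order \<open>\<zeta> ^ k\<close>, which turns the
  exponent k - 2 into the fraction (k - 2)/k.\<close>

lemma smooth_local:
  assumes hom: "homogeneous d F" and d: "d \<ge> 2" and sm: "smooth_pt F v k" and det: "det3 v e p \<noteq> 0"
    and \<kappa>: "\<And>j. j < \<kappa> \<Longrightarrow> coeff (LP F v p) j = 0" "coeff (LP F v p) \<kappa> \<noteq> 0"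
    and \<tau>: "\<tau> \<longlonglongrightarrow> 0" "\<And>n. \<tau> n \<noteq> 0" and \<zeta>: "\<zeta> \<longlonglongrightarrow> 0"
    and 0: "\<And>n. value_at F (v + \<tau> n *s e + \<zeta> n *s p) = 0"
  shows "\<exists>L>0. (\<lambda>n. norm (value_at (hessP F) (v + \<tau> n *s e + \<zeta> n *s p))
       / norm (\<tau> n) powr (real (k - 2) / real \<kappa>)) \<longlonglongrightarrow> L"
proof -
  have k: "k \<ge> 2" and v: "value_at F v = 0"
    and con: "\<And>w. value_at (dird w F) v = 0 \<Longrightarrow> (\<nexists>c. w = c *s v) \<Longrightarrow>
        (\<forall>j<k. coeff (LP F v w) j = 0) \<and> coeff (LP F v w) k \<noteq> 0"
    using sm unfolding smooth_pt_def by auto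
  show ?thesis
  proof (cases "value_at (dird p F) v = 0")
    case False
    define a where "a = - value_at (dird e F) v / value_at (dird p F) v"
    define w where "w = e + a *s p"
    have dw: "det3 v w p \<noteq> 0" using det by (simp add: w_def det3_shift)
    have "value_at (dird w F) v = 0"
      using dird_lin[of 1 e a p F v] False by (simp add: w_def a_def)
    then have kw: "\<And>j. j < k \<Longrightarrow> coeff (LP F v w) j = 0" "coeff (LP F v w) k \<noteq> 0"
      using con[of w] det3_not_multiple[OF dw] by auto
    have "\<kappa> = 1"
    proof -
      have "coeff (LP F v p) 0 = 0" using v by (simp add: coeff_0_LP)
      moreover have "coeff (LP F v p) 1 \<noteq> 0" using False coeff_1_LP[of F v p] by simp
      ultimately show ?thesis using \<kappa> by (metis less_one linorder_neqE_nat)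
    qed
    have e: "v + \<tau> n *s w + (\<zeta> n - a * \<tau> n) *s p = v + \<tau> n *s e + \<zeta> n *s p" for n
      by (simp add: w_def vec_eq_iff algebra_simps)
    have z0: "value_at F (v + \<tau> n *s w + (\<zeta> n - a * \<tau> n) *s p) = 0" for n
      unfolding e by (rule 0)
    have "(\<lambda>n. \<zeta> n - a * \<tau> n) \<longlonglongrightarrow> 0 - a * 0" by (intro tendsto_intros \<zeta> \<tau>)
    then have zl: "(\<lambda>n. \<zeta> n - a * \<tau> n) \<longlonglongrightarrow> 0" by simp
    obtain C where "C \<noteq> 0"
      "(\<lambda>n. value_at (hessP F) (v + \<tau> n *s w + (\<zeta> n - a * \<tau> n) *s p) / \<tau> n ^ (k - 2)) \<longlonglongrightarrow> C"
      using smooth_seq(2)[OF hom d kw(1) k kw(2) False dw \<tau> zl z0] by blast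
    then have "(\<lambda>n. norm (value_at (hessP F) (v + \<tau> n *s e + \<zeta> n *s p) / \<tau> n ^ (k - 2))) \<longlonglongrightarrow> norm C"
      unfolding e by (intro tendsto_norm)
    then show ?thesis
      using \<open>C \<noteq> 0\<close> \<tau>(2)
      by (intro exI[of _ "norm C"]) (simp add: \<open>\<kappa> = 1\<close> norm_divide norm_power powr_realpow)
  next
    case True
    have dpe: "det3 v p e \<noteq> 0" using det by (simp add: det3_def algebra_simps)
    have kp: "\<And>j. j < k \<Longrightarrow> coeff (LP F v p) j = 0" "coeff (LP F v p) k \<noteq> 0"
      using con[OF True] det3_not_multiple[OF dpe] by auto
    have "\<kappa> = k" using \<kappa> kp by (metis linorder_neqE_nat)
    have e0: "value_at (dird e F) v \<noteq> 0"
    proof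
      assume z: "value_at (dird e F) v = 0"
      obtain u where u: "value_at (dird u F) v \<noteq> 0" using sm unfolding smooth_pt_def by auto
      obtain x y t where "u = x *s v + y *s e + t *s p" using basis3[OF det] by blast
      then have "value_at (dird u F) v = 1 * (x * value_at (dird v F) v + y * value_at (dird e F) v)
           + t * value_at (dird p F) v"
        using dird_lin[of 1 "x *s v + y *s e" t p F v] by (simp add: dird_lin)
      then show False using u z True euler[OF hom, of v] v by simp
    qed
    \<comment> \<open>The line in direction e is transversal here and meets the curve near v only in
      v. So \<open>\<zeta> n\<close> is eventually nonzero and, after dropping finitely many terms,
      can serve as the parameter.\<close>
    have "(\<lambda>n. poly (LP F v e) (\<tau> n) / \<tau> n ^ 1) \<longlonglongrightarrow> coeff (LP F v e) 1"
      by (rule poly_div_tendsto[OF tendsto_const order_refl _ \<tau>]) (use v in \<open>auto simp: coeff_0_LP\<close>)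
    then have "eventually (\<lambda>n. poly (LP F v e) (\<tau> n) / \<tau> n ^ 1 \<noteq> 0) sequentially"
      by (rule tendsto_imp_eventually_ne) (use e0 coeff_1_LP[of F v e] in simp)
    then have "eventually (\<lambda>n. \<zeta> n \<noteq> 0) sequentially"
    proof eventually_elim
      case (elim n)
      then show ?case using 0[of n] by (auto simp: poly_LP)
    qed
    then obtain N where N: "\<And>n. n \<ge> N \<Longrightarrow> \<zeta> n \<noteq> 0" unfolding eventually_sequentially by auto
    define \<tau>' where "\<tau>' = (\<lambda>n. \<tau> (n + N))"
    define \<zeta>' where "\<zeta>' = (\<lambda>n. \<zeta> (n + N))"
    have \<tau>': "\<tau>' \<longlonglongrightarrow> 0" "\<And>n. \<tau>' n \<noteq> 0" using \<tau> by (auto simp: \<tau>'_def intro: LIMSEQ_ignore_initial_segment)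
    have \<zeta>': "\<zeta>' \<longlonglongrightarrow> 0" "\<And>n. \<zeta>' n \<noteq> 0" using \<zeta> N by (auto simp: \<zeta>'_def intro: LIMSEQ_ignore_initial_segment)
    have z0: "value_at F (v + \<zeta>' n *s p + \<tau>' n *s e) = 0" for n
      using 0[of "n + N"] by (simp add: \<tau>'_def \<zeta>'_def add_ac)
    obtain b C where b: "b \<noteq> 0" "(\<lambda>n. \<tau>' n / \<zeta>' n ^ k) \<longlonglongrightarrow> b" and
      C: "C \<noteq> 0" "(\<lambda>n. value_at (hessP F) (v + \<zeta>' n *s p + \<tau>' n *s e) / \<zeta>' n ^ (k - 2)) \<longlonglongrightarrow> C"
      using smooth_seq[OF hom d kp(1) k kp(2) e0 dpe \<zeta>' \<tau>'(1) z0] by blast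
    define \<rho> where "\<rho> = real (k - 2) / real k"
    have bl: "(\<lambda>n. norm (\<tau>' n / \<zeta>' n ^ k) powr \<rho>) \<longlonglongrightarrow> norm b powr \<rho>"
      using b by (intro tendsto_powr tendsto_norm tendsto_const) auto
    have "(\<lambda>n. norm (value_at (hessP F) (v + \<zeta>' n *s p + \<tau>' n *s e) / \<zeta>' n ^ (k - 2)) / norm (\<tau>' n / \<zeta>' n ^ k) powr \<rho>)
       \<longlonglongrightarrow> norm C / norm b powr \<rho>"
      using b by (intro tendsto_divide tendsto_norm C bl) auto
    moreover have "norm (value_at (hessP F) (v + \<zeta>' n *s p + \<tau>' n *s e) / \<zeta>' n ^ (k - 2)) / norm (\<tau>' n / \<zeta>' n ^ k) powr \<rho>
       = norm (value_at (hessP F) (v + \<tau>' n *s e + \<zeta>' n *s p)) / norm (\<tau>' n) powr \<rho>" for n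
    proof -
      have "(norm (\<zeta>' n) ^ k) powr \<rho> = norm (\<zeta>' n) ^ (k - 2)"
      proof -
        have "(norm (\<zeta>' n) ^ k) powr \<rho> = (norm (\<zeta>' n) powr real k) powr \<rho>"
          using \<zeta>'(2)[of n] by (simp add: powr_realpow)
        also have "\<dots> = norm (\<zeta>' n) powr real (k - 2)" using k by (simp add: powr_powr \<rho>_def)
        also have "\<dots> = norm (\<zeta>' n) ^ (k - 2)" using \<zeta>'(2)[of n] by (simp add: powr_realpow)
        finally show ?thesis .
      qed
      then show ?thesis using \<zeta>'(2)[of n]
        by (simp add: norm_divide norm_power powr_divide add_ac)
    qed
    ultimately have "(\<lambda>n. norm (value_at (hessP F) (v + \<tau>' n *s e + \<zeta>' n *s p)) / norm (\<tau>' n) powr \<rho>)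
       \<longlonglongrightarrow> norm C / norm b powr \<rho>" by simp
    then have "(\<lambda>n. norm (value_at (hessP F) (v + \<tau> n *s e + \<zeta> n *s p)) / norm (\<tau> n) powr \<rho>)
       \<longlonglongrightarrow> norm C / norm b powr \<rho>"
      unfolding \<tau>'_def \<zeta>'_def by (rule LIMSEQ_offset)
    then show ?thesis using b C by (intro exI[of _ "norm C / norm b powr \<rho>"]) (auto simp: \<rho>_def \<open>\<kappa> = k\<close>)
  qed
qed

lemma LP_base_shift:
  assumes "LP F q p = smult c (\<Prod>i<d. [:- l i, 1:])"
  shows "LP F (q + x *s p) p = smult c (\<Prod>i<d. [:x - l i, 1:])"
proof (rule poly_eqI_nonzero)
  fix y :: complex
  have "poly (LP F (q + x *s p) p) y = poly (LP F q p) (x + y)"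
    by (simp add: poly_LP vec_eq_iff algebra_simps)
  also have "\<dots> = poly (smult c (\<Prod>i<d. [:x - l i, 1:])) y"
    unfolding assms by (simp add: poly_prod algebra_simps)
  finally show "poly (LP F (q + x *s p) p) y = poly (smult c (\<Prod>i<d. [:x - l i, 1:])) y" .
qed

text \<open>
  The exponent \<open>cf x\<close> of a point is shared equally by the \<open>\<kappa>\<close> roots that tend to it. At a smooth point
  whose tangent passes through the centre of projection \<open>p\<close> the shares are fractions.
\<close>

lemma local_limit:
  fixes d :: nat and cf :: "complex \<Rightarrow> nat"
  assumes hom: "homogeneous d F" and d: "d \<ge> 2" and det: "det3 q e p \<noteq> 0" and p: "value_at F p \<noteq> 0"
    and pts: "\<And>x. value_at F (q + x *s p) = 0 \<Longrightarrow>
       (\<exists>m. sing_pt F (q + x *s p) m \<and> coeff (LP F (q + x *s p) p) m \<noteq> 0 \<and> cf x = 3 * m * (m - 1)) \<or>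
       (\<exists>k. smooth_pt F (q + x *s p) k \<and> cf x = k - 2)"
    and \<tau>: "\<tau> \<longlonglongrightarrow> 0" "\<And>n. \<tau> n \<noteq> 0"
    and roots: "\<And>n. LP F (q + \<tau> n *s e) p = smult (value_at F p) (\<Prod>i<d. [:- z n i, 1:])"
  shows "\<exists>\<sigma> L. strict_mono \<sigma> \<and>
     (\<lambda>n. norm (\<Prod>i<d. value_at (hessP F) (q + \<tau> (\<sigma> n) *s e + z (\<sigma> n) i *s p))
        / norm (\<tau> (\<sigma> n)) ^ (\<Sum>x | value_at F (q + x *s p) = 0. cf x)) \<longlonglongrightarrow> L \<and>
     (L \<noteq> 0 \<longleftrightarrow> (\<forall>x m. value_at F (q + x *s p) = 0 \<longrightarrow> sing_pt F (q + x *s p) m \<longrightarrow> good_pt F (q + x *s p) m))"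
proof -
  define c where "c = value_at F p"
  have c: "c \<noteq> 0" using p by (simp add: c_def)
  define v where "v = (\<lambda>x. q + x *s p)"
  have detv: "det3 (v x) e p \<noteq> 0" for x
    using det by (simp add: v_def det3_def algebra_simps)
  have qe: "(\<lambda>n. q + \<tau> n *s e) \<longlonglongrightarrow> q"
    using tendsto_add[OF tendsto_const tendsto_scale_vec[OF \<tau>(1) tendsto_const], of q e] by simp
  obtain \<sigma>1 l where \<sigma>1: "strict_mono \<sigma>1" and l: "\<And>i. i < d \<Longrightarrow> (\<lambda>n. z (\<sigma>1 n) i) \<longlonglongrightarrow> l i"
    and P0: "LP F q p = smult c (\<Prod>i<d. [:- l i, 1:])"
    using roots_subseq[OF roots[folded c_def] c coeff_LP_tendsto[OF qe tendsto_const]] by blast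
  \<comment> \<open>The number of roots tending to x. By the factorisation of the restriction it is
    the contact order of the line through p with the curve at \<open>v x\<close>.\<close>
  define \<kappa> where "\<kappa> = (\<lambda>x. card {i. i < d \<and> l i = x})"
  have \<kappa>: "(\<forall>j<\<kappa> x. coeff (LP F (v x) p) j = 0) \<and> coeff (LP F (v x) p) (\<kappa> x) \<noteq> 0" for x
    unfolding v_def LP_base_shift[OF P0]
    using coeff_prod_linear_zero[of d "\<lambda>i. x - l i"] c by (simp add: \<kappa>_def eq_commute[of x])
  have zeros: "value_at F (v x) = 0 \<longleftrightarrow> x \<in> l ` {..<d}" for x
  proof -
    have "value_at F (v x) = poly (LP F q p) x" by (simp add: poly_LP v_def)
    also have "\<dots> = c * (\<Prod>i<d. x - l i)" unfolding P0 by (simp add: poly_prod)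
    finally show ?thesis using c by auto
  qed
  define Sg where "Sg = (\<lambda>i. \<exists>m. sing_pt F (v (l i)) m)"
  \<comment> \<open>Slopes of the roots as seen from their limit point. At smooth points, where a
    tangent through p would make them unbounded, the value 0 is put in, so that all indices can be
    treated together.\<close>
  define \<eta>1 where "\<eta>1 = (\<lambda>n i. if Sg i then (z (\<sigma>1 n) i - l i) / \<tau> (\<sigma>1 n) else 0)"
  have \<tau>1: "(\<lambda>n. \<tau> (\<sigma>1 n)) \<longlonglongrightarrow> 0" using LIMSEQ_subseq_LIMSEQ[OF \<tau>(1) \<sigma>1] by (simp add: o_def)
  have zero: "value_at F (q + \<tau> n *s e + z n i *s p) = 0" if "i < d" for n i
  proof -
    have "value_at F (q + \<tau> n *s e + z n i *s p) = poly (LP F (q + \<tau> n *s e) p) (z n i)" by (simp add: poly_LP)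
    also have "\<dots> = 0" unfolding roots using that by (auto simp: poly_prod intro!: prod_zero)
    finally show ?thesis .
  qed
  have ev: "v x + t *s e + (y - x) *s p = q + t *s e + y *s p" for x y t
    by (simp add: v_def vec_eq_iff algebra_simps)
  have sing_nz: "coeff (LP F (v x) p) m \<noteq> 0 \<and> cf x = 3 * m * (m - 1) \<and> m = \<kappa> x"
    if "value_at F (v x) = 0" "sing_pt F (v x) m" for x m
  proof -
    have "coeff (LP F (v x) p) m \<noteq> 0 \<and> cf x = 3 * m * (m - 1)"
      using pts[of x] that sing_pt_unique[OF that(2)] sing_not_smooth[OF that(2)] unfolding v_def by blast
    moreover have "m = \<kappa> x" using \<kappa>[of x] that(2) calculation
      unfolding sing_pt_def is_mult_def by (metis linorder_neqE_nat)
    ultimately show ?thesis by blast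
  qed
  have zl: "value_at F (v (l i)) = 0" if "i < d" for i using zeros that by auto
  have zll: "(\<lambda>n. z (\<sigma>1 n) i - l i) \<longlonglongrightarrow> 0" if "i < d" for i
    using tendsto_diff[OF l[OF that] tendsto_const, of "l i"] by simp
  have "bounded (range (\<lambda>n. \<eta>1 n i))" if i: "i < d" for i
  proof (cases "Sg i")
    case True
    then obtain m where m: "sing_pt F (v (l i)) m" by (auto simp: Sg_def)
    have "bounded (range (\<lambda>n. (z (\<sigma>1 n) i - l i) / \<tau> (\<sigma>1 n)))"
    proof (rule sing_seq_bounded[where m = m and v = "v (l i)" and e = e and u = p and F = F])
      show "coeff (LP F (v (l i)) w) j = 0" if "j < m" for w j
        using m that by (auto simp: sing_pt_def is_mult_def)
      show "coeff (LP F (v (l i)) p) m \<noteq> 0" using sing_nz[OF zl[OF i] m] by blast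
      show "value_at F (v (l i) + \<tau> (\<sigma>1 n) *s e + (z (\<sigma>1 n) i - l i) *s p) = 0" for n
        unfolding ev by (rule zero[OF i])
    qed (use \<tau>1 \<tau>(2) zll[OF i] in auto)
    then show ?thesis using True by (simp add: \<eta>1_def)
  qed (simp add: \<eta>1_def)
  \<comment> \<open>A second passage to a subsequence lets the slopes at singular points converge as
    well.\<close>
  from subseq_finite_family[of d \<eta>1, OF this] obtain \<sigma>2 a where \<sigma>2: "strict_mono \<sigma>2"
    and a: "\<And>i. i < d \<Longrightarrow> (\<lambda>n. \<eta>1 (\<sigma>2 n) i) \<longlonglongrightarrow> a i" by blast
  define \<sigma> where "\<sigma> = \<sigma>1 \<circ> \<sigma>2"
  have \<sigma>: "strict_mono \<sigma>" unfolding \<sigma>_def by (rule strict_mono_o[OF \<sigma>1 \<sigma>2])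
  define t where "t = (\<lambda>n. \<tau> (\<sigma> n))"
  define y where "y = (\<lambda>n i. z (\<sigma> n) i)"
  have t: "t \<longlonglongrightarrow> 0" "\<And>n. t n \<noteq> 0"
    using LIMSEQ_subseq_LIMSEQ[OF \<tau>(1) \<sigma>] \<tau>(2) by (auto simp: t_def o_def)
  have yl: "(\<lambda>n. y n i) \<longlonglongrightarrow> l i" if "i < d" for i
    using LIMSEQ_subseq_LIMSEQ[OF l[OF that] \<sigma>2] by (simp add: y_def \<sigma>_def o_def)
  have yll: "(\<lambda>n. y n i - l i) \<longlonglongrightarrow> 0" if "i < d" for i
    using tendsto_diff[OF yl[OF that] tendsto_const, of "l i"] by simp
  have \<eta>: "(\<lambda>n. (y n i - l i) / t n) \<longlonglongrightarrow> a i" if "i < d" "Sg i" for i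
    using a[OF that(1)] that(2) by (simp add: \<eta>1_def y_def t_def \<sigma>_def)
  have y0: "value_at F (q + t n *s e + y n i *s p) = 0" if "i < d" for n i
    unfolding t_def y_def by (rule zero[OF that])
  define H where "H = (\<lambda>n i. value_at (hessP F) (q + t n *s e + y n i *s p))"
  have sing: "coeff (LP F (v (l i)) (e + a i *s p)) m = 0 \<and>
     (\<exists>L. (\<lambda>n. norm (H n i) / norm (t n) powr (real (cf (l i)) / real (\<kappa> (l i)))) \<longlonglongrightarrow> L \<and>
       (L \<noteq> 0 \<longleftrightarrow> coeff (LP F (v (l i)) (e + a i *s p)) (m + 1) \<noteq> 0 \<and>
          coeff (LP (dird p F) (v (l i)) (e + a i *s p)) (m - 1) \<noteq> 0))"
    if i: "i < d" and m: "sing_pt F (v (l i)) m" for i m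
  proof -
    have mm: "m \<ge> 2" "\<And>w j. j < m \<Longrightarrow> coeff (LP F (v (l i)) w) j = 0"
      using m by (auto simp: sing_pt_def is_mult_def)
    have Sgi: "Sg i" using m by (auto simp: Sg_def)
    have e: "v (l i) + t n *s (e + ((y n i - l i) / t n) *s p) = q + t n *s e + y n i *s p" for n
      using t(2)[of n] by (simp add: v_def vec_eq_iff field_simps)
    note S = sing_seq[OF hom mm(2) mm(1) detv \<eta>[OF i Sgi] t, unfolded e, OF _ y0[OF i]]
    \<comment> \<open>At a singular point the line through p is not tangent, so exactly m roots tend
      to it, and the share of each in 3m(m - 1) is 3(m - 1).\<close>
    have ex: "real (cf (l i)) / real (\<kappa> (l i)) = real (3 * (m - 1))"
      using sing_nz[OF zl[OF i] m] mm(1) by auto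
    define C where "C = - ((of_nat d - 1)\<^sup>2 * (2 * coeff (LP F (v (l i)) (e + a i *s p)) (m + 1)
          * (coeff (LP (dird p F) (v (l i)) (e + a i *s p)) (m - 1))\<^sup>2)) / (det3 (v (l i)) e p)\<^sup>2"
    have "of_nat d - 1 \<noteq> (0 :: complex)" using d of_nat_eq_iff[of d 1, where 'a = complex] by auto
    then have "norm C \<noteq> 0 \<longleftrightarrow> coeff (LP F (v (l i)) (e + a i *s p)) (m + 1) \<noteq> 0 \<and>
          coeff (LP (dird p F) (v (l i)) (e + a i *s p)) (m - 1) \<noteq> 0"
      using detv by (auto simp: C_def)
    moreover have "(\<lambda>n. norm (H n i / t n ^ (3 * (m - 1)))) \<longlonglongrightarrow> norm C"
      using S(2) unfolding C_def H_def by (intro tendsto_norm) simp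
    then have "(\<lambda>n. norm (H n i) / norm (t n) powr (real (cf (l i)) / real (\<kappa> (l i)))) \<longlonglongrightarrow> norm C"
      unfolding ex using t(2) by (simp add: norm_divide norm_power powr_realpow del: of_nat_mult)
    ultimately show ?thesis using S(1) by blast
  qed
  have smooth: "\<exists>L. (\<lambda>n. norm (H n i) / norm (t n) powr (real (cf (l i)) / real (\<kappa> (l i)))) \<longlonglongrightarrow> L \<and> L \<noteq> 0"
    if i: "i < d" and m: "\<not> Sg i" for i
  proof -
    obtain k where k: "smooth_pt F (v (l i)) k" "cf (l i) = k - 2"
      using pts[of "l i"] zl[OF i] m unfolding v_def Sg_def by blast
    have y0': "value_at F (v (l i) + t n *s e + (y n i - l i) *s p) = 0" for n
      unfolding ev by (rule y0[OF i])
    have \<kappa>1: "\<And>j. j < \<kappa> (l i) \<Longrightarrow> coeff (LP F (v (l i)) p) j = 0"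
      and \<kappa>2: "coeff (LP F (v (l i)) p) (\<kappa> (l i)) \<noteq> 0" using \<kappa> by auto
    obtain L where "L > 0" "(\<lambda>n. norm (value_at (hessP F) (v (l i) + t n *s e + (y n i - l i) *s p))
       / norm (t n) powr (real (k - 2) / real (\<kappa> (l i)))) \<longlonglongrightarrow> L"
      using smooth_local[OF hom d k(1) detv \<kappa>1 \<kappa>2 t yll[OF i] y0'] by blast
    then show ?thesis unfolding ev k(2) H_def by (intro exI[of _ L]) simp
  qed
  have "\<exists>L. (\<lambda>n. norm (H n i) / norm (t n) powr (real (cf (l i)) / real (\<kappa> (l i)))) \<longlonglongrightarrow> L" if "i < d" for i
    using sing[OF that] smooth[OF that] by (auto simp: Sg_def)
  then obtain L where L: "\<And>i. i < d \<Longrightarrow> (\<lambda>n. norm (H n i) / norm (t n) powr (real (cf (l i)) / real (\<kappa> (l i)))) \<longlonglongrightarrow> L i"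
    by metis
  have Lsing: "coeff (LP F (v (l i)) (e + a i *s p)) m = 0 \<and> (L i \<noteq> 0 \<longleftrightarrow> coeff (LP F (v (l i)) (e + a i *s p)) (m + 1) \<noteq> 0 \<and>
          coeff (LP (dird p F) (v (l i)) (e + a i *s p)) (m - 1) \<noteq> 0)"
    if "i < d" "sing_pt F (v (l i)) m" for i m
    using sing[OF that] L[OF that(1)] LIMSEQ_unique by blast
  have Lsmooth: "L i \<noteq> 0" if "i < d" "\<not> Sg i" for i
    using smooth[OF that] L[OF that(1)] LIMSEQ_unique by blast
  define S where "S = (\<Sum>x | value_at F (q + x *s p) = 0. cf x)"
  \<comment> \<open>The indices with limit x are \<open>\<kappa> x\<close> in number and carry equal
    shares of \<open>cf x\<close>, so the fractions add up to an integer.\<close>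
  have "(\<Sum>i<d. real (cf (l i)) / real (\<kappa> (l i))) = real S"
  proof -
    have "(\<Sum>i<d. real (cf (l i)) / real (\<kappa> (l i))) =
       (\<Sum>x\<in>l ` {..<d}. \<Sum>i\<in>{i\<in>{..<d}. l i = x}. real (cf (l i)) / real (\<kappa> (l i)))"
      by (rule sum.image_gen) simp
    also have "\<dots> = (\<Sum>x\<in>l ` {..<d}. real (cf x))"
    proof (rule sum.cong[OF refl])
      fix x assume x: "x \<in> l ` {..<d}"
      have "\<kappa> x \<noteq> 0" using x by (auto simp: \<kappa>_def)
      moreover have "(\<Sum>i\<in>{i\<in>{..<d}. l i = x}. real (cf (l i)) / real (\<kappa> (l i)))
        = (\<Sum>i\<in>{i\<in>{..<d}. l i = x}. real (cf x) / real (\<kappa> x))" by (intro sum.cong) auto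
      moreover have "card {i\<in>{..<d}. l i = x} = \<kappa> x" by (simp add: \<kappa>_def)
      ultimately show "(\<Sum>i\<in>{i\<in>{..<d}. l i = x}. real (cf (l i)) / real (\<kappa> (l i))) = real (cf x)" by simp
    qed
    also have "l ` {..<d} = {x. value_at F (q + x *s p) = 0}" using zeros unfolding v_def by auto
    finally show ?thesis by (simp add: S_def)
  qed
  then have pw: "(\<Prod>i<d. norm (t n) powr (real (cf (l i)) / real (\<kappa> (l i)))) = norm (t n) ^ S" for n
    using t(2)[of n] powr_sum[of "norm (t n)" "\<lambda>i. real (cf (l i)) / real (\<kappa> (l i))" "{..<d}"]
    by (simp add: powr_realpow)
  have "(\<lambda>n. \<Prod>i<d. norm (H n i) / norm (t n) powr (real (cf (l i)) / real (\<kappa> (l i)))) \<longlonglongrightarrow> (\<Prod>i<d. L i)"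
    by (intro tendsto_prod L) simp
  then have lim: "(\<lambda>n. norm (\<Prod>i<d. H n i) / norm (t n) ^ S) \<longlonglongrightarrow> (\<Prod>i<d. L i)"
    unfolding prod_dividef pw prod_norm .
  \<comment> \<open>The limit slopes \<open>a i\<close> of the roots tending to x are all the roots,
    with multiplicity, of the leading form on directions \<open>e + b *s p\<close>. So every tangent
    direction is reached by some root, and conditions on the limits \<open>L i\<close> become
    conditions on all tangent directions.\<close>
  have prod: "coeff (LP F (v x) (e + b *s p)) m =
     c * ((\<Prod>i | i < d \<and> l i = x. b - a i) * (\<Prod>i | i < d \<and> l i \<noteq> x. x - l i))"
    if x: "value_at F (v x) = 0" and m: "sing_pt F (v x) m" for x m b
  proof -
    have "(\<lambda>n. poly (LP F (v x) (e + b *s p)) (t n) / t n ^ m) \<longlonglongrightarrow> coeff (LP F (v x) (e + b *s p)) m"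
      by (rule poly_div_tendsto[OF tendsto_const order_refl _ t]) (use m in \<open>auto simp: sing_pt_def is_mult_def\<close>)
    moreover have "poly (LP F (v x) (e + b *s p)) (t n) / t n ^ m =
       c * ((\<Prod>i | i < d \<and> l i = x. b - (y n i - l i) / t n) * (\<Prod>i | i < d \<and> l i \<noteq> x. x + b * t n - y n i))" for n
    proof -
      have "v x + t n *s (e + b *s p) = (q + t n *s e) + (x + b * t n) *s p"
        by (simp add: v_def vec_eq_iff algebra_simps)
      then have "poly (LP F (v x) (e + b *s p)) (t n) = poly (LP F (q + t n *s e) p) (x + b * t n)"
        by (simp only: poly_LP)
      also have "\<dots> = c * (\<Prod>i<d. x + b * t n - y n i)"
        unfolding t_def y_def roots by (simp add: poly_prod c_def)
      also have "(\<Prod>i<d. x + b * t n - y n i) =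
         (\<Prod>i\<in>{i. i < d \<and> l i = x} \<union> {i. i < d \<and> l i \<noteq> x}. x + b * t n - y n i)"
        by (intro prod.cong) auto
      also have "\<dots> = (\<Prod>i | i < d \<and> l i = x. x + b * t n - y n i) * (\<Prod>i | i < d \<and> l i \<noteq> x. x + b * t n - y n i)"
        by (intro prod.union_disjoint) auto
      also have "(\<Prod>i | i < d \<and> l i = x. x + b * t n - y n i) =
         (\<Prod>i | i < d \<and> l i = x. t n * (b - (y n i - l i) / t n))"
        using t(2)[of n] by (intro prod.cong) (auto simp: field_simps)
      also have "\<dots> = t n ^ m * (\<Prod>i | i < d \<and> l i = x. b - (y n i - l i) / t n)"
        using sing_nz[OF x m] by (simp add: prod.distrib \<kappa>_def)
      finally show ?thesis using t(2)[of n] by simp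
    qed
    moreover have "(\<lambda>n. c * ((\<Prod>i | i < d \<and> l i = x. b - (y n i - l i) / t n) * (\<Prod>i | i < d \<and> l i \<noteq> x. x + b * t n - y n i)))
      \<longlonglongrightarrow> c * ((\<Prod>i | i < d \<and> l i = x. b - a i) * (\<Prod>i | i < d \<and> l i \<noteq> x. x + b * 0 - l i))"
      using m by (intro tendsto_intros \<eta> yl t) (auto simp: Sg_def)
    ultimately show ?thesis using LIMSEQ_unique by fastforce
  qed
  have "(\<Prod>i<d. L i) \<noteq> 0 \<longleftrightarrow> (\<forall>x m. value_at F (v x) = 0 \<longrightarrow> sing_pt F (v x) m \<longrightarrow> good_pt F (v x) m)"
  proof
    assume nz: "(\<Prod>i<d. L i) \<noteq> 0"
    show "\<forall>x m. value_at F (v x) = 0 \<longrightarrow> sing_pt F (v x) m \<longrightarrow> good_pt F (v x) m"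
    proof (intro allI impI)
      fix x m assume x: "value_at F (v x) = 0" and m: "sing_pt F (v x) m"
      have mult: "\<And>j w. j < m \<Longrightarrow> coeff (LP F (v x) w) j = 0" "m \<ge> 2"
        using m by (auto simp: sing_pt_def is_mult_def)
      show "good_pt F (v x) m" unfolding good_pt_def
      proof (intro allI impI)
        fix w assume w: "\<nexists>c. w = c *s v x" and z: "coeff (LP F (v x) w) m = 0"
        obtain g \<alpha> \<beta> where wb: "w = g *s v x + \<alpha> *s e + \<beta> *s p" using basis3[OF detv] by blast
        \<comment> \<open>Otherwise p would be a tangent direction at \<open>v x\<close>. Hence w
          is, up to scaling and a multiple of \<open>v x\<close>, of the form
          \<open>e + b *s p\<close>.\<close>
        have \<alpha>: "\<alpha> \<noteq> 0"
        proof
          assume "\<alpha> = 0"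
          then have w': "w = \<beta> *s p + g *s v x" using wb by simp
          then have "coeff (LP F (v x) w) m = \<beta> ^ m * coeff (LP F (v x) p) m"
            using LP_shift(2)[OF hom, where k = m and v = "v x" and w = p and c = 1 and a = \<beta> and b = g] mult(1) by simp
          moreover have "coeff (LP F (v x) p) m \<noteq> 0" using sing_nz[OF x m] by blast
          ultimately have "\<beta> = 0" using z by simp
          then show False using w w' by auto
        qed
        define b where "b = \<beta> / \<alpha>"
        have wb': "w = \<alpha> *s (e + b *s p) + g *s v x"
          using \<alpha> by (simp add: wb b_def vec_eq_iff field_simps)
        have "coeff (LP F (v x) w) m = \<alpha> ^ m * coeff (LP F (v x) (e + b *s p)) m"
          using LP_shift(2)[OF hom, where k = m and v = "v x" and w = "e + b *s p" and c = 1 and a = \<alpha> and b = g] wb' mult(1) by simp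
        then have zb: "coeff (LP F (v x) (e + b *s p)) m = 0" using z \<alpha> by simp
        then have "(\<Prod>i | i < d \<and> l i = x. b - a i) * (\<Prod>i | i < d \<and> l i \<noteq> x. x - l i) = 0"
          using prod[OF x m, of b] c by simp
        then obtain i where i: "i < d" "l i = x" "a i = b" by auto
        have "L i \<noteq> 0" using nz i(1) by (auto simp: prod_zero_iff)
        then have *: "coeff (LP F (v x) (e + b *s p)) (m + 1) \<noteq> 0" "coeff (LP (dird p F) (v x) (e + b *s p)) (m - 1) \<noteq> 0"
          using Lsing[OF i(1), of m] m i by auto
        have "coeff (LP F (v x) w) (m + 1) = \<alpha> ^ (m + 1) * coeff (LP F (v x) (e + b *s p)) (m + 1)"
          using LP_shift(2)[OF hom, where k = "m + 1" and v = "v x" and w = "e + b *s p" and c = 1 and a = \<alpha> and b = g] wb'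
            mult(1) zb by (auto simp: less_Suc_eq)
        moreover have "coeff (LP (dird p F) (v x) w) (m - 1) = \<alpha> ^ (m - 1) * coeff (LP (dird p F) (v x) (e + b *s p)) (m - 1)"
          using LP_shift(2)[OF homogeneous_dird[OF hom], where k = "m - 1" and v = "v x" and w = "e + b *s p" and c = 1 and a = \<alpha> and b = g]
            wb' coeff_LP_dird_vanish[OF mult(1)] by simp
        ultimately show "coeff (LP F (v x) w) (m + 1) \<noteq> 0 \<and> (\<exists>u. coeff (LP (dird u F) (v x) w) (m - 1) \<noteq> 0)"
          using * \<alpha> by (intro conjI exI[of _ p]) auto
      qed
    qed
  next
    assume good: "\<forall>x m. value_at F (v x) = 0 \<longrightarrow> sing_pt F (v x) m \<longrightarrow> good_pt F (v x) m"
    have "L i \<noteq> 0" if i: "i < d" for i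
    proof (cases "Sg i")
      case True
      then obtain m where m: "sing_pt F (v (l i)) m" by (auto simp: Sg_def)
      have g: "good_pt F (v (l i)) m" using good zl[OF i] m by blast
      have dw: "det3 (v (l i)) (e + a i *s p) p \<noteq> 0" using detv by (simp add: det3_shift)
      have z: "coeff (LP F (v (l i)) (e + a i *s p)) m = 0" using Lsing[OF i m] by simp
      then obtain u where u: "coeff (LP F (v (l i)) (e + a i *s p)) (m + 1) \<noteq> 0"
          "coeff (LP (dird u F) (v (l i)) (e + a i *s p)) (m - 1) \<noteq> 0"
        using g det3_not_multiple[OF dw] unfolding good_pt_def by metis
      have "coeff (LP (dird p F) (v (l i)) (e + a i *s p)) (m - 1) \<noteq> 0"
        by (rule good_direction[OF hom _ _ dw z u(2)]) (use m in \<open>auto simp: sing_pt_def\<close>)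
      then show ?thesis using Lsing[OF i m] u(1) by simp
    qed (use Lsmooth i in auto)
    then show "(\<Prod>i<d. L i) \<noteq> 0" by auto
  qed
  then show ?thesis using \<sigma> lim unfolding S_def v_def t_def y_def H_def by blast
qed

section \<open>Germs restricted to lines\<close>

lemma germ_coeff_simps:
  "germ_coeff 0 i j = 0"
  "germ_coeff (f + g) i j = germ_coeff f i j + germ_coeff g i j"
  "germ_coeff (f - g) i j = germ_coeff f i j - germ_coeff g i j"
  "germ_coeff (germ_const c * f) i j = c * germ_coeff f i j"
  "germ_coeff (germ_s * f) i j = (if i = 0 then 0 else germ_coeff f (i - 1) j)"
  "germ_coeff (germ_t * f) i j = (if j = 0 then 0 else germ_coeff f i (j - 1))"
  "germ_coeff (germ_const c) i j = (if i = 0 \<and> j = 0 then c else 0)"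
  "germ_coeff germ_s i j = (if i = 1 \<and> j = 0 then 1 else 0)"
  "germ_coeff germ_t i j = (if i = 0 \<and> j = 1 then 1 else 0)"
  by (auto simp: germ_coeff_def germ_const_def germ_s_def germ_t_def fps_X_nth)

lemma germ_coeff_mult:
  "germ_coeff (f * g) i j = (\<Sum>q\<le>j. \<Sum>p\<le>i. germ_coeff f p q * germ_coeff g (i - p) (j - q))"
  by (simp add: germ_coeff_def fps_mult_nth fps_sum_nth atMost_atLeast0)

lemma germ_eqI: "(\<And>i j. germ_coeff f i j = germ_coeff g i j) \<Longrightarrow> f = g"
  by (auto simp: germ_coeff_def intro!: fps_ext)

text \<open>The substitution \<open>s = a x\<close>, \<open>t = b x\<close>; as a function of \<open>(a, b)\<close>, its \<open>n\<close>-th coefficient is the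
  homogeneous part of degree \<open>n\<close> of the germ.\<close>

definition germ_line :: "complex \<Rightarrow> complex \<Rightarrow> germ \<Rightarrow> complex fps" where
  "germ_line a b f = Abs_fps (\<lambda>n. \<Sum>j\<le>n. germ_coeff f (n - j) j * a ^ (n - j) * b ^ j)"

text \<open>Multiplicativity says that the homogeneous parts of a product are the convolution of the
  homogeneous parts; it is a reindexing of the product of coefficients by total degree in place of
  the exponent of t.\<close>

lemma is_hom_germ_line: "is_hom (germ_line a b)"
proof (rule is_homI)
  show "germ_line a b 0 = 0" by (rule fps_ext) (simp add: germ_line_def germ_coeff_simps)
  show "germ_line a b 1 = 1"
  proof (rule fps_ext)
    fix n
    have "(\<Sum>j\<le>n. germ_coeff 1 (n - j) j * a ^ (n - j) * b ^ j) = (\<Sum>j\<le>n. if j = 0 then (if n = 0 then 1 else 0) else 0)"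
      by (intro sum.cong) (auto simp: germ_coeff_def)
    then show "fps_nth (germ_line a b 1) n = fps_nth 1 n" by (simp add: germ_line_def)
  qed
  show "germ_line a b (f + g) = germ_line a b f + germ_line a b g" for f g
    by (rule fps_ext) (simp add: germ_line_def germ_coeff_simps sum.distrib algebra_simps)
  show "germ_line a b (f * g) = germ_line a b f * germ_line a b g" for f g
  proof (rule fps_ext)
    fix n :: nat
    define A where "A = (SIGMA x:{(j, q). j \<le> n \<and> q \<le> j}. {p. p \<le> n - fst x})"
    define B where "B = (SIGMA x:{(k, q). k \<le> n \<and> q \<le> k}. {r. r \<le> n - fst x})"
    define F where "F = (\<lambda>p q. germ_coeff f p q * a ^ p * b ^ q)"
    define G where "G = (\<lambda>p q. germ_coeff g p q * a ^ p * b ^ q)"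
    have e: "{(j, q). j \<le> n \<and> q \<le> j} = (SIGMA j:{..n}. {..j})" by auto
    have fin: "finite {(j :: nat, q). j \<le> n \<and> q \<le> j}" unfolding e by auto
    have "fps_nth (germ_line a b (f * g)) n = (\<Sum>j\<le>n. \<Sum>q\<le>j. \<Sum>p\<le>n - j. F p q * G (n - j - p) (j - q))"
      unfolding germ_line_def fps_nth_Abs_fps germ_coeff_mult sum_distrib_right
    proof (intro sum.cong refl)
      fix j q p assume "j \<in> {..n}" "q \<in> {..j}" "p \<in> {..n - j}"
      then have "a ^ (n - j) = a ^ p * a ^ (n - j - p)" "b ^ j = b ^ q * b ^ (j - q)"
        by (simp_all flip: power_add)
      then show "germ_coeff f p q * germ_coeff g (n - j - p) (j - q) * a ^ (n - j) * b ^ j = F p q * G (n - j - p) (j - q)"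
        by (simp add: F_def G_def)
    qed
    also have "\<dots> = (\<Sum>(j, q)\<in>{(j, q). j \<le> n \<and> q \<le> j}. \<Sum>p\<le>n - j. F p q * G (n - j - p) (j - q))"
      unfolding e by (rule sum.Sigma) auto
    also have "\<dots> = (\<Sum>((j, q), p)\<in>A. F p q * G (n - j - p) (j - q))"
      unfolding A_def using fin
      by (subst sum.Sigma[symmetric]) (auto simp: case_prod_unfold atMost_def intro!: sum.cong)
    \<comment> \<open>Here k = p + q is the total degree of the term of f, and r = j - q is the
      exponent of t in the term of g.\<close>
    also have "\<dots> = (\<Sum>((k, q), r)\<in>B. F (k - q) q * G (n - k - r) r)"
      by (rule sum.reindex_bij_witness[where i = "\<lambda>((k, q), r). ((q + r, q), k - q)"
            and j = "\<lambda>((j, q), p). ((p + q, q), j - q)"])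
         (auto simp: A_def B_def add.commute)
    also have "\<dots> = (\<Sum>(k, q)\<in>{(k, q). k \<le> n \<and> q \<le> k}. \<Sum>r\<le>n - k. F (k - q) q * G (n - k - r) r)"
      unfolding B_def using fin
      by (subst sum.Sigma[symmetric]) (auto simp: case_prod_unfold atMost_def intro!: sum.cong)
    also have "\<dots> = (\<Sum>k\<le>n. \<Sum>q\<le>k. \<Sum>r\<le>n - k. F (k - q) q * G (n - k - r) r)"
      unfolding e by (rule sum.Sigma[symmetric]) auto
    also have "\<dots> = fps_nth (germ_line a b f * germ_line a b g) n"
      by (simp add: fps_mult_nth germ_line_def F_def G_def sum_product atMost_atLeast0)
    finally show "fps_nth (germ_line a b (f * g)) n = fps_nth (germ_line a b f * germ_line a b g) n" .
  qed
qed

lemma germ_line_const: "germ_line a b (germ_const c) = fps_const c"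
proof (rule fps_ext)
  fix n
  have "(\<Sum>j\<le>n. germ_coeff (germ_const c) (n - j) j * a ^ (n - j) * b ^ j) = (\<Sum>j\<le>n. if j = 0 then (if n = 0 then c else 0) else 0)"
    by (intro sum.cong) (auto simp: germ_coeff_simps)
  then show "fps_nth (germ_line a b (germ_const c)) n = fps_nth (fps_const c) n" by (simp add: germ_line_def)
qed

lemma germ_line_s: "germ_line a b germ_s = fps_const a * fps_X"
proof (rule fps_ext)
  fix n
  have "(\<Sum>j\<le>n. germ_coeff germ_s (n - j) j * a ^ (n - j) * b ^ j) = (\<Sum>j\<le>n. if j = 0 then (if n = 1 then a else 0) else 0)"
    by (intro sum.cong) (auto simp: germ_coeff_simps)
  then show "fps_nth (germ_line a b germ_s) n = fps_nth (fps_const a * fps_X) n" by (simp add: germ_line_def fps_X_def)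
qed

lemma germ_line_t: "germ_line a b germ_t = fps_const b * fps_X"
proof (rule fps_ext)
  fix n
  have "(\<Sum>j\<le>n. germ_coeff germ_t (n - j) j * a ^ (n - j) * b ^ j) = (\<Sum>j\<le>n. if j = 1 then (if n = 1 then b else 0) else 0)"
    by (intro sum.cong) (auto simp: germ_coeff_simps)
  then show "fps_nth (germ_line a b germ_t) n = fps_nth (fps_const b * fps_X) n"
    by (auto simp: germ_line_def fps_X_def)
qed

lemma germ_line_linear:
  "germ_line a b (germ_const \<alpha> * germ_s + germ_const \<beta> * germ_t) = fps_const (\<alpha> * a + \<beta> * b) * fps_X"
  by (simp add: is_hom_simps[OF is_hom_germ_line] germ_line_const germ_line_s germ_line_t algebra_simps
      flip: fps_const_add fps_const_mult)

lemma germ_line_nth_0: "fps_nth (germ_line a b f) 0 = germ_coeff f 0 0"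
  by (simp add: germ_line_def)

lemma germ_line_nth_1: "fps_nth (germ_line a b f) (Suc 0) = germ_coeff f 1 0 * a + germ_coeff f 0 1 * b"
  by (simp add: germ_line_def)

lemma germ_line_scale: "fps_nth (germ_line (c * a) (c * b) f) n = c ^ n * fps_nth (germ_line a b f) n"
  unfolding germ_line_def fps_nth_Abs_fps sum_distrib_left
proof (intro sum.cong refl)
  fix j assume "j \<in> {..n}"
  then have "c ^ n = c ^ (n - j) * c ^ j" by (simp flip: power_add)
  then show "germ_coeff f (n - j) j * (c * a) ^ (n - j) * (c * b) ^ j = c ^ n * (germ_coeff f (n - j) j * a ^ (n - j) * b ^ j)"
    by (simp add: power_mult_distrib)
qed

lemma germ_line_zero_iff:
  "(\<forall>a b. fps_nth (germ_line a b f) n = 0) \<longleftrightarrow> (\<forall>i j. i + j = n \<longrightarrow> germ_coeff f i j = 0)"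
proof
  assume z: "\<forall>a b. fps_nth (germ_line a b f) n = 0"
  define p where "p = (\<Sum>j\<le>n. monom (germ_coeff f (n - j) j) j)"
  have "poly p b = 0" for b
    using z[rule_format, of 1 b] by (simp add: p_def poly_sum poly_monom germ_line_def)
  then have p0: "p = 0" by (metis poly_all_0_iff_0)
  show "\<forall>i j. i + j = n \<longrightarrow> germ_coeff f i j = 0"
  proof (intro allI impI)
    fix i j assume "i + j = n"
    then have "coeff p j = germ_coeff f i j" by (auto simp: p_def coeff_sum)
    then show "germ_coeff f i j = 0" using p0 by simp
  qed
qed (auto simp: germ_line_def)

subsection \<open>Intersection multiplicity with a line\<close>

text \<open>
  The coefficients of $t^j$ in the quotient by $\alpha s + \beta t$ for $\alpha \neq 0$, chosen so that the
  remainder is a series in $t$ alone.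
\<close>

primrec line_quot :: "complex \<Rightarrow> complex \<Rightarrow> germ \<Rightarrow> nat \<Rightarrow> complex fps" where
  "line_quot \<alpha> \<beta> f 0 = fps_const (1 / \<alpha>) * fps_shift 1 (fps_nth f 0)"
| "line_quot \<alpha> \<beta> f (Suc j) = fps_const (1 / \<alpha>) * (fps_shift 1 (fps_nth f (Suc j))
      - fps_const \<beta> * fps_shift 1 (line_quot \<alpha> \<beta> f j))"

lemma germ_line_kernel:
  assumes "\<alpha> \<noteq> 0 \<or> \<beta> \<noteq> 0" "germ_line \<beta> (- \<alpha>) f = 0"
  shows "\<exists>g. f = (germ_const \<alpha> * germ_s + germ_const \<beta> * germ_t) * g"
proof (cases "\<alpha> = 0")
  case True
  have b: "\<beta> \<noteq> 0" using assms True by simp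
  have "germ_coeff f i 0 = 0" for i
  proof -
    have "fps_nth (germ_line \<beta> (- \<alpha>) f) i = (\<Sum>j\<le>i. if j = 0 then germ_coeff f i 0 * \<beta> ^ i else 0)"
      unfolding germ_line_def fps_nth_Abs_fps using True by (intro sum.cong) auto
    then show ?thesis using assms(2) b by simp
  qed
  then have "f = (germ_const \<alpha> * germ_s + germ_const \<beta> * germ_t) * (germ_const (1 / \<beta>) * Abs_fps (\<lambda>j. fps_nth f (Suc j)))"
    using True b
    unfolding distrib_right mult.assoc
    by (intro germ_eqI, unfold germ_coeff_simps) (auto simp: germ_coeff_def)
  then show ?thesis by blast
next
  case False
  define g where "g = Abs_fps (line_quot \<alpha> \<beta> f)"
  define l where "l = germ_const \<alpha> * germ_s + germ_const \<beta> * germ_t"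
  define h where "h = f - l * g"
  have lg: "germ_coeff (l * g) i j = (if i = 0 then 0 else \<alpha> * germ_coeff g (i - 1) j) + (if j = 0 then 0 else \<beta> * germ_coeff g i (j - 1))" for i j
    by (simp add: l_def distrib_right mult.assoc germ_coeff_simps)
  have hi: "germ_coeff h (Suc i) j = 0" for i j
    using False unfolding h_def germ_coeff_simps lg
    by (cases j) (auto simp: g_def germ_coeff_def)
  have "germ_line \<beta> (- \<alpha>) l = 0"
    by (simp add: l_def germ_line_linear)
  then have "germ_line \<beta> (- \<alpha>) h = 0"
    using assms(2) by (simp add: h_def is_hom_diff[OF is_hom_germ_line] is_hom_simps[OF is_hom_germ_line])
  moreover have "fps_nth (germ_line \<beta> (- \<alpha>) h) n = germ_coeff h 0 n * (- \<alpha>) ^ n" for n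
  proof -
    have "fps_nth (germ_line \<beta> (- \<alpha>) h) n = (\<Sum>j\<le>n. if j = n then germ_coeff h 0 n * (- \<alpha>) ^ n else 0)"
      unfolding germ_line_def fps_nth_Abs_fps
    proof (intro sum.cong refl)
      fix j assume "j \<in> {..n}"
      then show "germ_coeff h (n - j) j * \<beta> ^ (n - j) * (- \<alpha>) ^ j = (if j = n then germ_coeff h 0 n * (- \<alpha>) ^ n else 0)"
        using hi by (cases "n - j") auto
    qed
    then show ?thesis by simp
  qed
  ultimately have "germ_coeff h 0 n = 0" for n using False by (metis fps_zero_nth mult_eq_0_iff neg_equal_0_iff_equal power_not_zero)
  then have "h = 0" using hi by (intro germ_eqI) (metis germ_coeff_simps(1) not0_implies_Suc)
  then show ?thesis unfolding h_def l_def by auto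
qed

text \<open>One of the two coordinates is a parameter on the line; a preimage is a series in this
  coordinate alone.\<close>

lemma germ_line_surj:
  assumes "\<alpha> \<noteq> 0 \<or> \<beta> \<noteq> 0"
  shows "\<exists>f. germ_line \<beta> (- \<alpha>) f = q"
proof (cases "\<alpha> = 0")
  case True
  have "germ_line \<beta> (- \<alpha>) (fps_const (Abs_fps (\<lambda>i. fps_nth q i / \<beta> ^ i))) = q"
  proof (rule fps_ext)
    fix n
    have "fps_nth (germ_line \<beta> (- \<alpha>) (fps_const (Abs_fps (\<lambda>i. fps_nth q i / \<beta> ^ i)))) n
      = (\<Sum>j\<le>n. if j = 0 then fps_nth q n else 0)"
      unfolding germ_line_def fps_nth_Abs_fps using True assms
      by (intro sum.cong) (auto simp: germ_coeff_def)
    then show "fps_nth (germ_line \<beta> (- \<alpha>) (fps_const (Abs_fps (\<lambda>i. fps_nth q i / \<beta> ^ i)))) n = fps_nth q n" by simp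
  qed
  then show ?thesis by blast
next
  case False
  have "germ_line \<beta> (- \<alpha>) (Abs_fps (\<lambda>j. fps_const (fps_nth q j / (- \<alpha>) ^ j))) = q"
  proof (rule fps_ext)
    fix n
    have "fps_nth (germ_line \<beta> (- \<alpha>) (Abs_fps (\<lambda>j. fps_const (fps_nth q j / (- \<alpha>) ^ j)))) n
      = (\<Sum>j\<le>n. if j = n then fps_nth q n else 0)"
      unfolding germ_line_def fps_nth_Abs_fps using False
      by (intro sum.cong) (auto simp: germ_coeff_def)
    then show "fps_nth (germ_line \<beta> (- \<alpha>) (Abs_fps (\<lambda>j. fps_const (fps_nth q j / (- \<alpha>) ^ j)))) n = fps_nth q n" by simp
  qed
  then show ?thesis by blast
qed

lemma independent_t_powers:
  "germ.independent ((\<lambda>i. germ_t ^ i) ` {..<k})" "card ((\<lambda>i. germ_t ^ i) ` {..<k}) = k"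
proof -
  have c: "germ_coeff (germ_t ^ i) 0 j = (if i = j then 1 else 0)" for i j
    by (simp add: germ_coeff_def germ_t_def fps_X_power_iff)
  have inj: "inj_on (\<lambda>i. germ_t ^ i) {..<k}"
    by (rule inj_onI) (metis c zero_neq_one)
  then show "card ((\<lambda>i. germ_t ^ i) ` {..<k}) = k" by (simp add: card_image)
  have "u (germ_t ^ i) = 0" if s: "(\<Sum>v\<in>(\<lambda>i. germ_t ^ i) ` {..<k}. germ_const (u v) * v) = 0" and i: "i < k" for u i
  proof -
    have cs: "germ_coeff (sum f A) a b = (\<Sum>x\<in>A. germ_coeff (f x) a b)" for f a b and A :: "nat set"
      by (induction A rule: infinite_finite_induct) (auto simp: germ_coeff_simps)
    have "0 = germ_coeff (\<Sum>i<k. germ_const (u (germ_t ^ i)) * germ_t ^ i) 0 i"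
      using s by (simp add: sum.reindex[OF inj] germ_coeff_simps)
    also have "\<dots> = (\<Sum>j<k. if j = i then u (germ_t ^ i) else 0)"
      unfolding cs germ_coeff_simps c by (intro sum.cong) auto
    also have "\<dots> = u (germ_t ^ i)" using i by simp
    finally show ?thesis by simp
  qed
  then show "germ.independent ((\<lambda>i. germ_t ^ i) ` {..<k})"
    by (subst germ.dependent_finite) auto
qed

text \<open>The map \<open>L\<close> restricts a germ to the line and truncates at order k, writing
  the result in powers of t. It kills the ideal, and its image contains all k powers; so it sends a
  set spanning modulo the ideal to a set spanning a space of dimension at least k. The restriction
  of f may vanish altogether.\<close>

lemma germ_int_mult_line_ge:
  assumes ab: "\<alpha> \<noteq> 0 \<or> \<beta> \<noteq> 0" and z: "\<And>i. i < k \<Longrightarrow> fps_nth (germ_line \<beta> (- \<alpha>) f) i = 0"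
  shows "enat k \<le> germ_int_mult f (germ_const \<alpha> * germ_s + germ_const \<beta> * germ_t)"
proof -
  define l where "l = germ_const \<alpha> * germ_s + germ_const \<beta> * germ_t"
  define \<rho> where "\<rho> = germ_line \<beta> (- \<alpha>)"
  note \<rho> = is_hom_simps[OF is_hom_germ_line, of \<beta> "- \<alpha>", folded \<rho>_def]
  have \<rho>l: "\<rho> l = 0"
    by (simp add: l_def \<rho>_def germ_line_linear)
  have "k \<le> card B" if fin: "finite B" and span: "germ.span (B \<union> {a * f + b * l | a b. True}) = UNIV" for B
  proof -
    define L where "L = (\<lambda>x. \<Sum>i<k. germ_const (fps_nth (\<rho> x) i) * germ_t ^ i)"
    have L0: "L 0 = 0" by (simp add: L_def \<rho> germ_const_def)
    have La: "L (x + y) = L x + L y" for x y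
      by (simp add: L_def \<rho> sum.distrib[symmetric] germ_const_def distrib_right flip: fps_const_add)
    have Ls: "L (germ_const c * x) = germ_const c * L x" for c x
    proof -
      have "\<rho> (germ_const c * x) = fps_const c * \<rho> x"
        by (simp add: \<rho> germ_line_const[of \<beta> "- \<alpha>", folded \<rho>_def])
      then show ?thesis
        by (simp add: L_def sum_distrib_left germ_const_def mult.assoc flip: fps_const_mult)
    qed
    have "germ.subspace {x. L x \<in> germ.span (L ` B)}"
      unfolding germ.subspace_def
      by (auto simp: L0 La Ls intro: germ.span_zero germ.span_add germ.span_scale)
    moreover have "B \<union> {a * f + b * l | a b. True} \<subseteq> {x. L x \<in> germ.span (L ` B)}"
    proof -
      have "L (a * f + b * l) = 0" for a b
      proof -
        have "fps_nth (\<rho> a * \<rho> f) i = 0" if "i < k" for i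
          unfolding fps_mult_nth using that z by (intro sum.neutral) (auto simp: \<rho>_def)
        then show ?thesis by (simp add: L_def \<rho> \<rho>l germ_const_def)
      qed
      then show ?thesis by (auto intro: germ.span_base germ.span_zero)
    qed
    ultimately have "germ.span (B \<union> {a * f + b * l | a b. True}) \<subseteq> {x. L x \<in> germ.span (L ` B)}"
      by (intro germ.span_minimal)
    then have LB: "L x \<in> germ.span (L ` B)" for x unfolding span by blast
    have "(\<lambda>i. germ_t ^ i) ` {..<k} \<subseteq> germ.span (L ` B)"
    proof (rule image_subsetI)
      fix i assume i: "i \<in> {..<k}"
      obtain x where x: "\<rho> x = fps_X ^ i" using germ_line_surj[OF ab] unfolding \<rho>_def by blast
      have "L x = (\<Sum>j<k. if j = i then germ_t ^ i else 0)"
        unfolding L_def x by (intro sum.cong) (auto simp: fps_X_power_iff germ_const_def)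
      then show "germ_t ^ i \<in> germ.span (L ` B)" using LB[of x] i by simp
    qed
    then have "card ((\<lambda>i. germ_t ^ i) ` {..<k}) \<le> card (L ` B)"
      using germ.independent_span_bound[OF _ independent_t_powers(1)] fin by blast
    also have "\<dots> \<le> card B" by (rule card_image_le[OF fin])
    finally show ?thesis by (simp add: independent_t_powers(2))
  qed
  then show ?thesis
    unfolding germ_int_mult_def l_def[symmetric] by (intro INF_greatest) auto
qed

text \<open>Restriction identifies the quotient by the ideal with power series modulo $x^k$: its
  kernel is generated by the linear form, and f restricts to a unit times $x^k$. Lifts of the powers
  of x below k span the quotient.\<close>

lemma germ_int_mult_line:
  assumes ab: "\<alpha> \<noteq> 0 \<or> \<beta> \<noteq> 0" and z: "\<And>i. i < k \<Longrightarrow> fps_nth (germ_line \<beta> (- \<alpha>) f) i = 0"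
    and nz: "fps_nth (germ_line \<beta> (- \<alpha>) f) k \<noteq> 0"
  shows "germ_int_mult f (germ_const \<alpha> * germ_s + germ_const \<beta> * germ_t) = enat k"
proof (rule antisym[OF _ germ_int_mult_line_ge[OF ab z]])
  define l where "l = germ_const \<alpha> * germ_s + germ_const \<beta> * germ_t"
  define \<rho> where "\<rho> = germ_line \<beta> (- \<alpha>)"
  note \<rho> = is_hom_simps[OF is_hom_germ_line, of \<beta> "- \<alpha>", folded \<rho>_def]
  obtain Q where Q: "\<And>q. \<rho> (Q q) = q" using germ_line_surj[OF ab] unfolding \<rho>_def by metis
  define B where "B = (\<lambda>i. Q (fps_X ^ i)) ` {..<k}"
  define S where "S = B \<union> {a * f + b * l | a b. True}"
  have sd: "subdegree (\<rho> f) = k"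
    using nz z by (intro subdegreeI) (auto simp: \<rho>_def)
  have f0: "\<rho> f \<noteq> 0" using nz by (auto simp: \<rho>_def)
  have "x \<in> germ.span S" for x
  proof -
    define y where "y = (\<Sum>i<k. germ_const (fps_nth (\<rho> x) i) * Q (fps_X ^ i))"
    have y: "y \<in> germ.span S"
      unfolding y_def by (intro germ.span_sum germ.span_scale germ.span_base) (auto simp: S_def B_def)
    have \<rho>y: "\<rho> y = (\<Sum>i<k. fps_const (fps_nth (\<rho> x) i) * fps_X ^ i)"
      unfolding y_def \<rho>_def is_hom_sum[OF is_hom_germ_line] is_hom_simps(4)[OF is_hom_germ_line]
      by (simp add: Q[unfolded \<rho>_def] germ_line_const)
    have n: "fps_nth (\<rho> (x - y)) j = 0" if "j < k" for j
    proof -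
      have "fps_nth (\<rho> y) j = (\<Sum>i<k. if i = j then fps_nth (\<rho> x) j else 0)"
        unfolding \<rho>y fps_sum_nth by (intro sum.cong) (auto simp: fps_X_power_iff)
      then show ?thesis using that by (simp add: is_hom_diff[OF is_hom_germ_line] \<rho>_def)
    qed
    have "\<rho> f dvd \<rho> (x - y)"
    proof (cases "\<rho> (x - y) = 0")
      case False
      then have "k \<le> subdegree (\<rho> (x - y))" using n by (metis leI nth_subdegree_nonzero)
      then show ?thesis using fps_dvd_iff[OF f0 False] sd by simp
    qed simp
    then obtain q where q: "\<rho> (x - y) = \<rho> f * q" by (rule dvdE)
    have "\<rho> (x - y - Q q * f) = 0"
      using q unfolding is_hom_diff[OF is_hom_germ_line, of \<beta> "- \<alpha>", folded \<rho>_def] \<rho> by (simp add: Q mult.commute)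
    then obtain g where "x - y - Q q * f = l * g"
      using germ_line_kernel[OF ab] unfolding \<rho>_def l_def by blast
    then have "x = y + (Q q * f + g * l)" by (simp add: algebra_simps)
    moreover have "Q q * f + g * l \<in> germ.span S"
      by (intro germ.span_base) (auto simp: S_def)
    ultimately show ?thesis using y by (metis germ.span_add)
  qed
  then have "germ.span S = UNIV" by auto
  moreover have "finite B" by (simp add: B_def)
  ultimately have "germ_int_mult f l \<le> enat (card B)"
    unfolding germ_int_mult_def S_def by (intro INF_lower) auto
  also have "card B \<le> k" unfolding B_def using card_image_le[of "{..<k}"] by force
  finally show "germ_int_mult f (germ_const \<alpha> * germ_s + germ_const \<beta> * germ_t) \<le> enat k"
    by (simp add: l_def)
qed

subsection \<open>Local equations\<close>

text \<open>The vector \<open>c *s v\<close> is normalised for the affine chart of \<open>local_eq\<close>, and \<open>w1\<close>, \<open>w2\<close> are the directions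
  of the local coordinates \<open>s\<close>, \<open>t\<close>.\<close>

lemma chart:
  assumes "v \<noteq> 0"
  obtains c w1 w2 where "c \<noteq> 0" "det3 (c *s v) w1 w2 \<noteq> 0"
    "\<And>F. local_eq F v = eval3 germ_const F
       (germ_const ((c *s v) $ 1) + germ_const (w1 $ 1) * germ_s + germ_const (w2 $ 1) * germ_t)
       (germ_const ((c *s v) $ 2) + germ_const (w1 $ 2) * germ_s + germ_const (w2 $ 2) * germ_t)
       (germ_const ((c *s v) $ 3) + germ_const (w1 $ 3) * germ_s + germ_const (w2 $ 3) * germ_t)"
proof -
  have g: "germ_const 0 = 0" "germ_const 1 = 1" by (simp_all add: germ_const_def)
  consider "v $ 3 \<noteq> 0" | "v $ 3 = 0" "v $ 2 \<noteq> 0" | "v $ 3 = 0" "v $ 2 = 0" "v $ 1 \<noteq> 0"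
    using assms by (auto simp: vec_eq_iff forall_3)
  then show ?thesis
  proof cases
    case 1
    show ?thesis
      by (rule that[of "1 / v $ 3" "vector [1, 0, 0]" "vector [0, 1, 0]"])
         (use 1 in \<open>auto simp: local_eq_def Let_def det3_def g\<close>)
  next
    case 2
    show ?thesis
      by (rule that[of "1 / v $ 2" "vector [1, 0, 0]" "vector [0, 0, 1]"])
         (use 2 in \<open>auto simp: local_eq_def Let_def det3_def g\<close>)
  next
    case 3
    show ?thesis
      by (rule that[of "1 / v $ 1" "vector [0, 1, 0]" "vector [0, 0, 1]"])
         (use 3 in \<open>auto simp: local_eq_def Let_def det3_def g\<close>)
  qed
qed

text \<open>The bridge between germs and the projective computations: by naturality of
  \<open>eval3\<close>, the homogeneous parts of a local equation are Taylor coefficients of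
  \<open>F\<close> along lines through the point.\<close>

lemma germ_line_eval3:
  "germ_line a b (eval3 germ_const F
       (germ_const (v $ 1) + germ_const (w1 $ 1) * germ_s + germ_const (w2 $ 1) * germ_t)
       (germ_const (v $ 2) + germ_const (w1 $ 2) * germ_s + germ_const (w2 $ 2) * germ_t)
       (germ_const (v $ 3) + germ_const (w1 $ 3) * germ_s + germ_const (w2 $ 3) * germ_t)) =
   fps_of_poly (LP F v (a *s w1 + b *s w2))"
proof -
  have e: "germ_line a b (germ_const c + germ_const x * germ_s + germ_const y * germ_t) = fps_of_poly [:c, a * x + b * y:]"
    for c x y
    by (simp add: is_hom_simps[OF is_hom_germ_line] germ_line_const germ_line_s germ_line_t
        fps_of_poly_pCons algebra_simps flip: fps_const_add fps_const_mult)
  have "fps_of_poly (LP F v (a *s w1 + b *s w2)) = eval3 (\<lambda>c. fps_of_poly [:c:]) F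
     (fps_of_poly [:v $ 1, (a *s w1 + b *s w2) $ 1:]) (fps_of_poly [:v $ 2, (a *s w1 + b *s w2) $ 2:])
     (fps_of_poly [:v $ 3, (a *s w1 + b *s w2) $ 3:])"
    unfolding LP_def by (rule eval3_hom[OF is_hom_fps_of_poly]) simp
  moreover have "germ_line a b (eval3 germ_const F A B C) =
     eval3 (\<lambda>c. fps_of_poly [:c:]) F (germ_line a b A) (germ_line a b B) (germ_line a b C)" for A B C
    by (subst eval3_hom[OF is_hom_germ_line]) (simp_all add: germ_const_def fps_of_poly_const germ_line_const[unfolded germ_const_def])
  ultimately show ?thesis by (simp add: e)
qed

lemma local_eq_polynomial: "\<exists>P :: complex fps poly. local_eq F v = fps_of_poly P"
proof (cases "v = 0")
  case False
  obtain c and w1 w2 :: "complex ^ 3" where le: "local_eq F v = eval3 germ_const F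
       (germ_const ((c *s v) $ 1) + germ_const (w1 $ 1) * germ_s + germ_const (w2 $ 1) * germ_t)
       (germ_const ((c *s v) $ 2) + germ_const (w1 $ 2) * germ_s + germ_const (w2 $ 2) * germ_t)
       (germ_const ((c *s v) $ 3) + germ_const (w1 $ 3) * germ_s + germ_const (w2 $ 3) * germ_t)"
    by (rule chart[OF False]) (rule that)
  have e: "germ_const x + germ_const y * germ_s + germ_const z * germ_t =
      fps_of_poly [:fps_const x + fps_const y * fps_X, fps_const z:]" for x y z
    by (simp add: germ_const_def germ_s_def germ_t_def fps_of_poly_pCons flip: fps_const_add fps_const_mult)
  have "germ_const = (\<lambda>c. fps_of_poly [:fps_const c:])" by (simp add: germ_const_def fun_eq_iff fps_of_poly_const)
  then have "eval3 germ_const F (fps_of_poly A) (fps_of_poly B) (fps_of_poly C) =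
     fps_of_poly (eval3 (\<lambda>c. [:fps_const c:]) F A B C)" for A B C
    by (simp add: eval3_hom[OF is_hom_fps_of_poly])
  then show ?thesis unfolding le e by blast
next
  case True
  \<comment> \<open>For v = 0 the last chart is taken, and division by zero gives 0.\<close>
  have e: "local_eq F v = eval3 germ_const F 1 germ_s germ_t" by (simp add: True local_eq_def germ_const_def)
  have "germ_const = (\<lambda>c. fps_of_poly [:fps_const c:])" by (simp add: germ_const_def fun_eq_iff fps_of_poly_const)
  moreover have "germ_s = fps_of_poly [:fps_X:]" "germ_t = fps_of_poly [:0, 1:]"
    by (simp_all add: germ_s_def germ_t_def fps_of_poly_const fps_of_poly_fps_X fps_of_poly_pCons)
  ultimately have "local_eq F v = fps_of_poly (eval3 (\<lambda>c. [:fps_const c:]) F 1 [:fps_X:] [:0, 1:])"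
    unfolding e by (simp add: eval3_hom[OF is_hom_fps_of_poly])
  then show ?thesis by blast
qed

section \<open>Ordinary multiple points\<close>

subsection \<open>Hensel's lemma for power series\<close>

lemma poly_taylor2: "\<exists>q. poly p (y + e) = poly p y + e * poly (pderiv p) y + e * e * (q :: 'a :: idom)"
proof (induction p)
  case 0
  then show ?case by (intro exI[of _ 0]) simp
next
  case (pCons a p)
  then obtain q where q: "poly p (y + e) = poly p y + e * poly (pderiv p) y + e * e * q" by blast
  show ?case
    by (intro exI[of _ "poly (pderiv p) y + (y + e) * q"])
       (simp only: q poly_pCons pderiv_pCons poly_add, simp add: algebra_simps)
qed

lemma is_hom_fps_nth_0: "is_hom (\<lambda>c :: complex fps. fps_nth c 0)"
  by (auto simp: is_hom_def)

lemma poly_fps_nth_0: "fps_nth (poly p y) 0 = poly (map_poly (\<lambda>c. fps_nth c 0) p) (fps_nth (y :: complex fps) 0)"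
  using poly_map_poly_hom[OF is_hom_fps_nth_0, of "\<lambda>c. c" p y] by simp

lemma poly_fps_cong:
  fixes y y' :: "complex fps"
  assumes "\<And>i. i \<le> n \<Longrightarrow> fps_nth y i = fps_nth y' i" "i \<le> n"
  shows "fps_nth (poly p y) i = fps_nth (poly p y') i"
proof -
  define e where "e = y' - y"
  have "fps_nth e j = 0" if "j \<le> n" for j using assms(1) that by (simp add: e_def)
  then have e: "fps_nth (e * g) j = 0" if "j \<le> n" for g j
    using that by (auto simp: fps_mult_nth intro!: sum.neutral)
  obtain q where "poly p (y + e) = poly p y + e * poly (pderiv p) y + e * e * q"
    using poly_taylor2 by blast
  then have "poly p y' = poly p y + e * (poly (pderiv p) y + e * q)"
    by (simp add: e_def algebra_simps)
  then show ?thesis using e[OF assms(2)] by simp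
qed

text \<open>The root is built coefficient by coefficient. Adding $c X^{n+1}$ changes the value of p
  in degree n + 1 by c times the constant term of p'(y), which is nonzero, and leaves the lower
  degrees alone.\<close>

lemma hensel_fps:
  fixes p :: "complex fps poly"
  assumes z: "poly (map_poly (\<lambda>c. fps_nth c 0) p) b = 0"
    and nz: "poly (map_poly (\<lambda>c. fps_nth c 0) (pderiv p)) b \<noteq> 0"
  shows "\<exists>y. fps_nth y 0 = b \<and> poly p y = 0"
proof -
  define P where "P = (\<lambda>n y. fps_nth y 0 = b \<and> (\<forall>i\<le>n. fps_nth (poly p y) i = 0))"
  have "\<exists>Y. \<forall>n. P n (Y n) \<and> (\<forall>i\<le>n. fps_nth (Y (Suc n)) i = fps_nth (Y n) i)"
  proof (rule dependent_nat_choice)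
    show "\<exists>y. P 0 y" using z by (intro exI[of _ "fps_const b"]) (simp add: P_def poly_fps_nth_0)
  next
    fix y n assume y: "P n y"
    have d: "fps_nth (poly (pderiv p) y) 0 \<noteq> 0" using y nz by (simp add: P_def poly_fps_nth_0)
    define c where "c = - fps_nth (poly p y) (Suc n) / fps_nth (poly (pderiv p) y) 0"
    define e where "e = fps_X ^ Suc n * fps_const c"
    obtain q where q: "poly p (y + e) = poly p y + e * poly (pderiv p) y + e * e * q" using poly_taylor2 by blast
    have "e * poly (pderiv p) y + e * e * q
        = fps_X ^ Suc n * (fps_const c * (poly (pderiv p) y + fps_X * (fps_X ^ n * fps_const c * q)))"
      by (simp add: e_def algebra_simps)
    then have q': "poly p (y + e) = poly p y + fps_X ^ Suc n * (fps_const c * (poly (pderiv p) y + fps_X * (fps_X ^ n * fps_const c * q)))"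
      using q by (simp add: add.assoc)
    have "fps_nth (poly p (y + e)) i = 0" if "i \<le> Suc n" for i
    proof (cases "i = Suc n")
      case True
      then show ?thesis unfolding q' True
        using d by (simp add: fps_X_power_mult_nth c_def del: power_Suc)
    next
      case False
      then show ?thesis using y that unfolding q' by (simp add: fps_X_power_mult_nth P_def del: power_Suc)
    qed
    moreover have ei: "fps_nth e i = 0" if "i \<le> n" for i
      using that by (simp add: e_def fps_X_power_mult_nth del: power_Suc)
    ultimately show "\<exists>y'. P (Suc n) y' \<and> (\<forall>i\<le>n. fps_nth y' i = fps_nth y i)"
      using y by (intro exI[of _ "y + e"]) (simp add: P_def)
  qed
  then obtain Y where Y: "\<And>n. P n (Y n)" "\<And>n i. i \<le> n \<Longrightarrow> fps_nth (Y (Suc n)) i = fps_nth (Y n) i" by blast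
  \<comment> \<open>The n-th approximation is final up to degree n, so the diagonal collects the
    limit.\<close>
  define y where "y = Abs_fps (\<lambda>n. fps_nth (Y n) n)"
  have "fps_nth (Y (i + k)) i = fps_nth (Y i) i" for i k
    by (induction k) (auto simp: Y(2))
  then have yY: "fps_nth y i = fps_nth (Y n) i" if "i \<le> n" for i n
    using that by (metis y_def fps_nth_Abs_fps le_add_diff_inverse)
  have "fps_nth (poly p y) n = 0" for n
  proof -
    have "fps_nth (poly p y) n = fps_nth (poly p (Y n)) n" by (rule poly_fps_cong[where n = n]) (auto simp: yY)
    then show ?thesis using Y(1)[of n] by (simp add: P_def)
  qed
  then have "poly p y = 0" by (intro fps_ext) simp
  moreover have "fps_nth y 0 = b" using Y(1)[of 0] by (simp add: y_def P_def)
  ultimately show ?thesis by blast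
qed

subsection \<open>Leading forms\<close>

definition germ_form :: "germ \<Rightarrow> nat \<Rightarrow> complex \<Rightarrow> complex \<Rightarrow> complex" where
  "germ_form f n a b = fps_nth (germ_line a b f) n"

definition germ_order :: "germ \<Rightarrow> nat \<Rightarrow> bool" where
  "germ_order f m \<longleftrightarrow> (\<forall>i<m. \<forall>a b. germ_form f i a b = 0) \<and> (\<exists>a b. germ_form f m a b \<noteq> 0)"

text \<open>At a zero of the leading form a nonzero directional derivative means a root of
  multiplicity one. It is stated as a derivative of functions because \<open>coeff_LP_deriv\<close>
  provides it in this form.\<close>

definition simple_root :: "germ \<Rightarrow> nat \<Rightarrow> complex \<Rightarrow> complex \<Rightarrow> bool" where
  "simple_root f m a b \<longleftrightarrow> (\<exists>a' b' c. c \<noteq> 0 \<and>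
     ((\<lambda>x. germ_form f m (a + x * a') (b + x * b')) has_field_derivative c) (at 0))"

definition good_germ :: "germ \<Rightarrow> nat \<Rightarrow> bool" where
  "good_germ f m \<longleftrightarrow> (\<forall>a b. (a, b) \<noteq> (0, 0) \<longrightarrow> germ_form f m a b = 0 \<longrightarrow>
     germ_form f (m + 1) a b \<noteq> 0 \<and> simple_root f m a b)"

lemma germ_order_unique: "germ_order f m \<Longrightarrow> germ_order f m' \<Longrightarrow> m = m'"
  unfolding germ_order_def by (metis nat_neq_iff)

lemma germ_mult_eq: "germ_order f m \<Longrightarrow> germ_mult f = m"
  using germ_line_zero_iff[of f] unfolding germ_mult_def germ_order_def germ_form_def
  by (intro Least_equality) (meson, metis not_le)

lemma germ_form_scale: "germ_form f n (c * a) (c * b) = c ^ n * germ_form f n a b"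
  unfolding germ_form_def by (rule germ_line_scale)

lemma germ_form_0: "germ_form f 0 a b = germ_coeff f 0 0"
  by (simp add: germ_form_def germ_line_nth_0)

lemma germ_form_1: "germ_form f (Suc 0) a b = germ_coeff f 1 0 * a + germ_coeff f 0 1 * b"
  by (simp add: germ_form_def germ_line_nth_1)

text \<open>The homogeneous part of degree n, dehomogenised at s = 1.\<close>

definition form_poly :: "germ \<Rightarrow> nat \<Rightarrow> complex poly" where
  "form_poly f n = (\<Sum>j\<le>n. monom (germ_coeff f (n - j) j) j)"

lemma poly_form_poly: "poly (form_poly f n) b = germ_form f n 1 b"
  by (simp add: form_poly_def poly_sum poly_monom germ_form_def germ_line_def)

lemma coeff_form_poly: "coeff (form_poly f n) j = (if j \<le> n then germ_coeff f (n - j) j else 0)"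
  by (simp add: form_poly_def coeff_sum)

lemma form_poly_nz:
  assumes "germ_form f n a b \<noteq> 0"
  shows "form_poly f n \<noteq> 0"
proof
  assume "form_poly f n = 0"
  then have "germ_coeff f i j = 0" if "i + j = n" for i j
    using that coeff_form_poly[of f n j] by auto
  then show False using assms germ_line_zero_iff[of f n] unfolding germ_form_def by blast
qed

lemma nonroot_avoiding:
  fixes p :: "complex poly"
  assumes "p \<noteq> 0"
  shows "\<exists>x. x \<noteq> b \<and> poly p x \<noteq> 0"
proof -
  have "[:- b, 1:] * p \<noteq> 0" using assms by (simp only: mult_eq_0_iff) simp
  then obtain x where "poly ([:- b, 1:] * p) x \<noteq> 0" by (metis poly_all_0_iff_0)
  then show ?thesis by (intro exI[of _ x]) auto
qed

lemma germ_order_exists: "f \<noteq> 0 \<Longrightarrow> \<exists>m. germ_order f m"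
proof -
  assume "f \<noteq> 0"
  then obtain i j where "germ_coeff f i j \<noteq> 0" by (metis germ_eqI germ_coeff_simps(1))
  then have ex: "\<exists>n. \<exists>a b. germ_form f n a b \<noteq> 0"
    using germ_line_zero_iff[of f "i + j"] unfolding germ_form_def by blast
  show ?thesis unfolding germ_order_def
    by (rule exI[of _ "LEAST n. \<exists>a b. germ_form f n a b \<noteq> 0"]) (use LeastI_ex[OF ex] not_less_Least in blast)
qed

lemma germ_form_mult_smooth:
  assumes c: "germ_coeff c 0 0 = 0" and g: "\<And>i a b. i < n \<Longrightarrow> germ_form g i a b = 0"
  shows "i \<le> n \<Longrightarrow> germ_form (c * g) i a b = 0"
    and "germ_form (c * g) (Suc n) a b = germ_form c (Suc 0) a b * germ_form g n a b"
proof -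
  have g': "fps_nth (germ_line a b g) i = 0" if "i < n" for i using g that by (simp add: germ_form_def)
  have c0: "fps_nth (germ_line a b c) 0 = 0" using c by (simp add: germ_line_nth_0)
  have e: "germ_form (c * g) i a b = (\<Sum>j=0..i. fps_nth (germ_line a b c) j * fps_nth (germ_line a b g) (i - j))" for i
    by (simp add: germ_form_def is_hom_simps[OF is_hom_germ_line] fps_mult_nth)
  show "germ_form (c * g) i a b = 0" if "i \<le> n"
    unfolding e
  proof (intro sum.neutral ballI)
    fix j assume "j \<in> {0..i}"
    then show "fps_nth (germ_line a b c) j * fps_nth (germ_line a b g) (i - j) = 0"
      using c0 g'[of "i - j"] that by (cases "j = 0") auto
  qed
  have "germ_form (c * g) (Suc n) a b = (\<Sum>j=0..Suc n. if j = Suc 0 then fps_nth (germ_line a b c) (Suc 0) * fps_nth (germ_line a b g) n else 0)"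
    unfolding e
  proof (intro sum.cong refl)
    fix j assume "j \<in> {0..Suc n}"
    then show "fps_nth (germ_line a b c) j * fps_nth (germ_line a b g) (Suc n - j) =
       (if j = Suc 0 then fps_nth (germ_line a b c) (Suc 0) * fps_nth (germ_line a b g) n else 0)"
      using c0 g'[of "Suc n - j"] by (cases "j = 0") auto
  qed
  then show "germ_form (c * g) (Suc n) a b = germ_form c (Suc 0) a b * germ_form g n a b"
    by (simp add: germ_form_def)
qed

lemma germ_unit_coeff: "u dvd 1 \<Longrightarrow> germ_coeff u 0 0 \<noteq> 0"
proof -
  assume "u dvd 1"
  then obtain v where "1 = u * v" by (rule dvdE)
  then have "germ_coeff u 0 0 * germ_coeff v 0 0 = germ_coeff 1 0 0"
    using germ_coeff_mult[of u v 0 0] by simp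
  then show ?thesis by (auto simp: germ_coeff_def)
qed

lemma germ_unit:
  assumes "germ_coeff u 0 0 \<noteq> 0"
  shows "u dvd 1"
proof -
  have "inverse (fps_nth u 0) * fps_nth u 0 = 1"
    using assms by (intro inverse_mult_eq_1) (simp add: germ_coeff_def)
  then have "fps_left_inverse u (inverse (fps_nth u 0)) * u = 1" by (rule fps_left_inverse)
  then show ?thesis by (metis dvd_triv_right)
qed

section \<open>Leading forms of products of transversal branches\<close>

lemma prod_branches_shift:
  fixes c :: "nat \<Rightarrow> complex fps"
  assumes "\<And>j. j < k \<Longrightarrow> fps_nth (c j) 0 = 0"
  shows "(\<Prod>j<k. c j) = fps_X ^ k * (\<Prod>j<k. fps_shift 1 (c j))"
proof -
  have "c j = fps_X * fps_shift 1 (c j)" if "j < k" for j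
    using assms[OF that] by (intro fps_ext) (simp add: fps_X_mult_nth)
  then have "(\<Prod>j<k. c j) = (\<Prod>j<k. fps_X * fps_shift 1 (c j))" by (intro prod.cong) auto
  then show ?thesis by (simp add: prod.distrib)
qed

lemma germ_tangent_mem: "(a, b) \<in> germ_tangent C \<longleftrightarrow> germ_form C (Suc 0) a b = 0"
  by (simp add: germ_tangent_def germ_form_1)

lemma linear_form2_zero:
  fixes \<alpha> \<beta> a b :: complex
  assumes "\<alpha> \<noteq> 0 \<or> \<beta> \<noteq> 0" "(a, b) \<noteq> (0, 0)" "\<alpha> * a + \<beta> * b = 0"
  obtains t where "t \<noteq> 0" "a = t * \<beta>" "b = t * (- \<alpha>)"
proof (cases "\<alpha> = 0")
  case True
  then show ?thesis using assms that[of "a / \<beta>"] by auto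
next
  case False
  then have a: "a = (- b / \<alpha>) * \<beta>"
  proof -
    have "a * \<alpha> = - b * \<beta>" using assms(3) by (simp add: eq_neg_iff_add_eq_0 mult.commute)
    then show ?thesis using False by (simp add: field_simps)
  qed
  moreover have "- b / \<alpha> \<noteq> 0" using a assms(2) False by auto
  moreover have "b = (- b / \<alpha>) * (- \<alpha>)" using False by simp
  ultimately show ?thesis using that by blast
qed

text \<open>On each line through the origin every branch contributes a factor x. What remains after
  dividing by $x^k$ has as its constant term the product of the linear parts, times the constant
  term of the unit.\<close>

lemma transversal_form:
  assumes t: "transversal_branches f k C"
  shows "germ_order f k"
    and "\<exists>u0. u0 \<noteq> 0 \<and> (\<forall>a b. germ_form f k a b = u0 * (\<Prod>j<k. germ_form (C j) (Suc 0) a b))"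
    and "j < k \<Longrightarrow> germ_form (C j) 0 a b = 0"
proof -
  from t obtain u where u: "u dvd 1" "f = u * (\<Prod>j<k. C j)" and sm: "\<And>j. j < k \<Longrightarrow> smooth_germ (C j)"
    unfolding transversal_branches_def by blast
  define u0 where "u0 = germ_coeff u 0 0"
  have u0: "u0 \<noteq> 0" using germ_unit_coeff[OF u(1)] by (simp add: u0_def)
  have c0: "germ_coeff (C j) 0 0 = 0" if "j < k" for j using sm[OF that] by (simp add: smooth_germ_def)
  then show "j < k \<Longrightarrow> germ_form (C j) 0 a b = 0" by (simp add: germ_form_0)
  have e: "germ_line a b f = fps_X ^ k * (germ_line a b u * (\<Prod>j<k. fps_shift 1 (germ_line a b (C j))))" for a b
    unfolding u(2) is_hom_simps(4)[OF is_hom_germ_line] is_hom_prod[OF is_hom_germ_line]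
    using prod_branches_shift[of k "\<lambda>j. germ_line a b (C j)"] c0 by (simp add: germ_line_nth_0 mult_ac)
  have p0: "fps_nth (\<Prod>j<k. g j) 0 = (\<Prod>j<k. fps_nth (g j) 0)" for g :: "nat \<Rightarrow> complex fps"
    by (rule is_hom_prod[OF is_hom_fps_nth_0])
  have fk: "germ_form f k a b = u0 * (\<Prod>j<k. germ_form (C j) (Suc 0) a b)" for a b
    unfolding germ_form_def e by (simp add: fps_X_power_mult_nth u0_def germ_line_nth_0 p0)
  then show "\<exists>u0. u0 \<noteq> 0 \<and> (\<forall>a b. germ_form f k a b = u0 * (\<Prod>j<k. germ_form (C j) (Suc 0) a b))"
    using u0 by blast
  have "(\<Prod>j<k. [:germ_coeff (C j) 1 0, germ_coeff (C j) 0 1:]) \<noteq> 0"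
    using sm by (auto simp: smooth_germ_def)
  then obtain b where "poly (\<Prod>j<k. [:germ_coeff (C j) 1 0, germ_coeff (C j) 0 1:]) b \<noteq> 0"
    using nonroot_avoiding by blast
  then have "germ_form f k 1 b \<noteq> 0" using u0 by (simp add: fk poly_prod germ_form_1 mult.commute)
  moreover have "germ_form f i a b = 0" if "i < k" for i a b
    unfolding germ_form_def e using that by (simp add: fps_X_power_mult_nth)
  ultimately show "germ_order f k" unfolding germ_order_def by blast
qed

text \<open>A nonzero vector on a tangent line spans it, so two branches whose linear parts vanish
  at the same vector would have the same tangent.\<close>

lemma tangent_distinct:
  assumes t: "transversal_branches f k C" and ij: "i < k" "j < k" "i \<noteq> j"
    and ab: "(a, b) \<noteq> (0, 0)" "germ_form (C i) (Suc 0) a b = 0"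
  shows "germ_form (C j) (Suc 0) a b \<noteq> 0"
proof
  assume j: "germ_form (C j) (Suc 0) a b = 0"
  have T: "germ_tangent (C l) = {(t * a, t * b) | t. True}" if l: "l < k" "germ_form (C l) (Suc 0) a b = 0" for l
  proof -
    have n: "germ_coeff (C l) 1 0 \<noteq> 0 \<or> germ_coeff (C l) 0 1 \<noteq> 0"
      using t l(1) by (auto simp: transversal_branches_def smooth_germ_def)
    obtain s where s: "s \<noteq> 0" "a = s * germ_coeff (C l) 0 1" "b = s * (- germ_coeff (C l) 1 0)"
      using linear_form2_zero[OF n ab(1)] l(2) unfolding germ_form_1 by blast
    show ?thesis
    proof (intro set_eqI iffI)
      fix z assume z: "z \<in> germ_tangent (C l)"
      obtain x y where xy: "z = (x, y)" by (cases z)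
      show "z \<in> {(t * a, t * b) | t. True}"
      proof (cases "(x, y) = (0, 0)")
        case False
        then obtain r where "x = r * germ_coeff (C l) 0 1" "y = r * (- germ_coeff (C l) 1 0)"
          using linear_form2_zero[OF n False] z unfolding xy germ_tangent_mem germ_form_1 by blast
        then have "x = (r / s) * a" "y = (r / s) * b" using s by auto
        then show ?thesis using xy by blast
      qed (use xy in \<open>auto intro: exI[of _ 0]\<close>)
    next
      fix z assume "z \<in> {(t * a, t * b) | t. True}"
      then obtain r where "z = (r * a, r * b)" by blast
      then show "z \<in> germ_tangent (C l)"
        using l(2) by (simp add: germ_tangent_mem germ_form_scale)
    qed
  qed
  have "germ_tangent (C i) = germ_tangent (C j)" using T[of i] T[of j] ij ab j by simp
  then show False using t ij unfolding transversal_branches_def inj_on_def by blast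
qed

text \<open>The restriction of a smooth germ to its tangent begins in degree at least 2, and the
  quadratic part decides whether it begins there.\<close>

lemma int_mult_tangent:
  assumes "smooth_germ C" "(a, b) \<noteq> (0, 0)" "germ_form C (Suc 0) a b = 0"
  shows "germ_int_mult C (germ_tangent_eq C) = 2 \<longleftrightarrow> germ_form C 2 a b \<noteq> 0"
proof -
  define \<alpha> where "\<alpha> = germ_coeff C 1 0"
  define \<beta> where "\<beta> = germ_coeff C 0 1"
  have ab: "\<alpha> \<noteq> 0 \<or> \<beta> \<noteq> 0" and c0: "germ_coeff C 0 0 = 0"
    using assms(1) by (auto simp: smooth_germ_def \<alpha>_def \<beta>_def)
  obtain t where t: "t \<noteq> 0" "a = t * \<beta>" "b = t * (- \<alpha>)"
    using linear_form2_zero[OF ab assms(2)] assms(3) unfolding germ_form_1 \<alpha>_def \<beta>_def by blast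
  have "fps_nth (germ_line \<beta> (- \<alpha>) C) i = 0" if "i < 2" for i
  proof -
    have "i = 0 \<or> i = Suc 0" using that by auto
    then show ?thesis using c0 by (auto simp: germ_line_nth_0 germ_line_nth_1 \<alpha>_def \<beta>_def)
  qed
  note z = this
  have f2: "germ_form C 2 a b = t ^ 2 * germ_form C 2 \<beta> (- \<alpha>)" unfolding t by (rule germ_form_scale)
  show ?thesis
  proof
    assume m: "germ_int_mult C (germ_tangent_eq C) = 2"
    show "germ_form C 2 a b \<noteq> 0"
    proof
      assume "germ_form C 2 a b = 0"
      then have "fps_nth (germ_line \<beta> (- \<alpha>) C) 2 = 0" using f2 t by (simp add: germ_form_def)
      then have "fps_nth (germ_line \<beta> (- \<alpha>) C) i = 0" if "i < 3" for i
        using z[of i] that by (cases "i = 2") auto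
      from germ_int_mult_line_ge[OF ab this] have "enat 3 \<le> 2"
        using m by (simp add: germ_tangent_eq_def \<alpha>_def \<beta>_def)
      then show False by (simp add: numeral_eq_enat)
    qed
  next
    assume "germ_form C 2 a b \<noteq> 0"
    then have "fps_nth (germ_line \<beta> (- \<alpha>) C) 2 \<noteq> 0" using f2 by (simp add: germ_form_def)
    from germ_int_mult_line[OF ab z this]
    show "germ_int_mult C (germ_tangent_eq C) = 2"
      by (simp add: germ_tangent_eq_def \<alpha>_def \<beta>_def numeral_eq_enat)
  qed
qed

text \<open>Along the tangent of branch j, once $x^k$ is divided out, the factor of branch j starts
  with its quadratic part in degree 1, while all other factors have nonzero constant terms by
  transversality.\<close>

lemma transversal_next_form:
  assumes t: "transversal_branches f k C" and j: "j < k"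
    and ab: "(a, b) \<noteq> (0, 0)" "germ_form (C j) (Suc 0) a b = 0"
  shows "germ_form f (k + 1) a b \<noteq> 0 \<longleftrightarrow> germ_int_mult (C j) (germ_tangent_eq (C j)) = 2"
proof -
  from t obtain u where u: "u dvd 1" "f = u * (\<Prod>j<k. C j)" and sm: "\<And>j. j < k \<Longrightarrow> smooth_germ (C j)"
    unfolding transversal_branches_def by blast
  have c0: "germ_coeff (C j) 0 0 = 0" if "j < k" for j using sm[OF that] by (simp add: smooth_germ_def)
  define s where "s = (\<lambda>j. fps_shift 1 (germ_line a b (C j)))"
  define R where "R = germ_line a b u * (\<Prod>i\<in>{..<k} - {j}. s i)"
  have "(\<Prod>j<k. s j) = s j * (\<Prod>i\<in>{..<k} - {j}. s i)" by (rule prod.remove) (use j in auto)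
  then have e: "germ_line a b f = fps_X ^ k * (s j * R)"
    unfolding u(2) is_hom_simps(4)[OF is_hom_germ_line] is_hom_prod[OF is_hom_germ_line]
    using prod_branches_shift[of k "\<lambda>j. germ_line a b (C j)"] c0
    by (simp add: germ_line_nth_0 mult_ac s_def R_def)
  have R0: "fps_nth R 0 \<noteq> 0"
  proof -
    have "fps_nth R 0 = germ_coeff u 0 0 * (\<Prod>i\<in>{..<k} - {j}. germ_form (C i) (Suc 0) a b)"
      using is_hom_prod[OF is_hom_fps_nth_0, of s "{..<k} - {j}"]
      by (simp add: R_def germ_line_nth_0 germ_form_def s_def)
    then show ?thesis using germ_unit_coeff[OF u(1)] tangent_distinct[OF t j _ _ ab] by auto
  qed
  have "germ_form f (k + 1) a b = fps_nth (s j * R) 1"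
    unfolding germ_form_def e by (simp add: fps_X_power_mult_nth)
  also have "\<dots> = germ_form (C j) 2 a b * fps_nth R 0"
    using ab(2) by (simp add: fps_mult_nth s_def germ_form_def numeral_2_eq_2)
  finally show ?thesis using R0 int_mult_tangent[OF sm[OF j] ab] by simp
qed

text \<open>A root of the leading form lies on the tangent of some branch j. Crossing it in a
  direction not tangent to this branch, the j-th linear factor has a simple zero and the others do
  not vanish.\<close>

lemma ordinary_imp_good:
  assumes t: "transversal_branches f k C"
    and im: "\<And>j. j < k \<Longrightarrow> germ_int_mult (C j) (germ_tangent_eq (C j)) = 2"
  shows "good_germ f k"
  unfolding good_germ_def
proof (intro allI impI)
  fix a b assume ab: "(a, b) \<noteq> (0, 0)" and z: "germ_form f k a b = 0"
  obtain u0 where u0: "u0 \<noteq> 0" "\<And>a b. germ_form f k a b = u0 * (\<Prod>j<k. germ_form (C j) (Suc 0) a b)"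
    using transversal_form(2)[OF t] by blast
  obtain j where j: "j < k" "germ_form (C j) (Suc 0) a b = 0"
    using z u0 by auto
  have "smooth_germ (C j)" using t j(1) by (simp add: transversal_branches_def)
  then obtain a' b' where ab': "germ_form (C j) (Suc 0) a' b' \<noteq> 0"
    unfolding smooth_germ_def germ_form_1
    by (metis add.right_neutral add_0 mult.right_neutral mult_zero_right)
  define P where "P = (\<Prod>i\<in>{..<k} - {j}. [:germ_form (C i) (Suc 0) a b, germ_form (C i) (Suc 0) a' b':])"
  define Q where "Q = pCons 0 (smult (u0 * germ_form (C j) (Suc 0) a' b') P)"
  have lin: "germ_form (C i) (Suc 0) (a + x * a') (b + x * b') =
      germ_form (C i) (Suc 0) a b + x * germ_form (C i) (Suc 0) a' b'" for i x
    by (simp add: germ_form_1 algebra_simps)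
  have "germ_form f k (a + x * a') (b + x * b') = poly Q x" for x
  proof -
    have "(\<Prod>i<k. germ_form (C i) (Suc 0) (a + x * a') (b + x * b')) =
      germ_form (C j) (Suc 0) (a + x * a') (b + x * b') *
      (\<Prod>i\<in>{..<k} - {j}. germ_form (C i) (Suc 0) (a + x * a') (b + x * b'))"
      by (rule prod.remove) (use j in auto)
    then show ?thesis
      unfolding u0(2) by (simp add: lin j(2) Q_def P_def poly_prod)
  qed
  moreover have "(poly Q has_field_derivative poly (pderiv Q) 0) (at 0)" by (rule poly_DERIV)
  moreover have "poly (pderiv Q) 0 \<noteq> 0"
    using u0(1) ab' tangent_distinct[OF t j(1) _ _ ab j(2)]
    by (auto simp: Q_def pderiv_pCons P_def poly_prod)
  ultimately have "simple_root f k a b" unfolding simple_root_def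
    by (intro exI[of _ a'] exI[of _ b'] exI[of _ "poly (pderiv Q) 0"]) simp
  moreover have "germ_form f (k + 1) a b \<noteq> 0"
    using transversal_next_form[OF t j(1) ab j(2)] im[OF j(1)] by simp
  ultimately show "germ_form f (k + 1) a b \<noteq> 0 \<and> simple_root f k a b" by blast
qed

subsection \<open>Splitting off smooth branches\<close>

lemma germ_coeff_fps_of_poly: "germ_coeff (fps_of_poly P) i j = fps_nth (coeff P j) i"
  by (simp add: germ_coeff_def)

text \<open>Homogeneity expresses the form near (1, b) through the dehomogenised polynomial at the
  quotient of the coordinates. A double root b of this polynomial would make every directional
  derivative zero.\<close>

lemma simple_root_derivative:
  assumes z: "germ_form f m 1 b = 0" and s: "simple_root f m 1 b"
  shows "poly (pderiv (form_poly f m)) b \<noteq> 0"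
proof
  assume d: "poly (pderiv (form_poly f m)) b = 0"
  obtain a' b' c where c: "c \<noteq> 0" and
    D: "((\<lambda>x. germ_form f m (1 + x * a') (b + x * b')) has_field_derivative c) (at 0)"
    using s unfolding simple_root_def by blast
  have p: "(poly (form_poly f m) has_field_derivative 0) (at ((b + 0 * b') / (1 + 0 * a')))"
    using poly_DERIV[of "form_poly f m" b] d by simp
  have q: "((\<lambda>x. (b + x * b') / (1 + x * a')) has_field_derivative (b' - b * a')) (at 0)"
    by (auto intro!: derivative_eq_intros)
  have "((\<lambda>x. (1 + x * a') ^ m * poly (form_poly f m) ((b + x * b') / (1 + x * a'))) has_field_derivative
      (of_nat m * a') * poly (form_poly f m) ((b + 0 * b') / (1 + 0 * a'))
        + 0 * (b' - b * a') * (1 + 0 * a') ^ m) (at 0)"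
    by (rule DERIV_mult[OF _ DERIV_chain2[OF p q]]) (auto intro!: derivative_eq_intros)
  then have D0: "((\<lambda>x. (1 + x * a') ^ m * poly (form_poly f m) ((b + x * b') / (1 + x * a'))) has_field_derivative 0) (at 0)"
    using z by (simp add: poly_form_poly)
  have "(\<lambda>x. 1 + x * a') \<midarrow>0\<rightarrow> 1 + 0 * a'" by (intro tendsto_intros)
  then have "eventually (\<lambda>x. 1 + x * a' \<noteq> 0) (at 0)" by (rule tendsto_imp_eventually_ne) simp
  then have "eventually (\<lambda>x. 1 + x * a' \<noteq> 0) (nhds 0)" unfolding eventually_nhds_conv_at by simp
  then have "eventually (\<lambda>x. germ_form f m (1 + x * a') (b + x * b') =
      (1 + x * a') ^ m * poly (form_poly f m) ((b + x * b') / (1 + x * a'))) (nhds 0)"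
  proof eventually_elim
    case (elim x)
    then show ?case
      using germ_form_scale[of f m "1 + x * a'" 1 "(b + x * b') / (1 + x * a')"] by (simp add: poly_form_poly)
  qed
  then have "((\<lambda>x. germ_form f m (1 + x * a') (b + x * b')) has_field_derivative 0) (at 0)"
    using D0 by (subst DERIV_cong_ev[OF refl _ refl])
  then show False using D c DERIV_unique by blast
qed

text \<open>Blowing up by t = s y turns P into $s^m R$, and R at s = 0 is the dehomogenised leading
  form. Hensel's lemma lifts its simple root b to a series y with R(y) = 0, and then t - s y divides
  P.\<close>

lemma split_branch:
  fixes P :: "complex fps poly"
  assumes o: "\<And>i a b. i < m \<Longrightarrow> germ_form (fps_of_poly P) i a b = 0"
    and z: "germ_form (fps_of_poly P) m 1 b = 0" and s: "simple_root (fps_of_poly P) m 1 b"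
  shows "\<exists>y Q. fps_nth y 0 = 0 \<and> fps_nth y 1 = b \<and> P = [:- y, 1:] * Q"
proof -
  define f where "f = fps_of_poly P"
  have co: "fps_nth (coeff P j) i = 0" if "i + j < m" for i j
    using germ_line_zero_iff[of f "i + j"] o[OF that] germ_coeff_fps_of_poly[of P i j]
    by (auto simp: f_def germ_form_def)
  \<comment> \<open>The strict transform. The shift by m is an exact division, as all terms of P of
    total degree below m vanish.\<close>
  define R where "R = (\<Sum>j\<le>degree P. monom (fps_shift m (coeff P j * fps_X ^ j)) j)"
  have cR: "coeff R j = fps_shift m (coeff P j * fps_X ^ j)" for j
    by (auto simp: R_def coeff_sum coeff_eq_0)
  have sh: "coeff P j * fps_X ^ j = fps_X ^ m * coeff R j" for j
    unfolding cR
  proof (rule fps_ext)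
    fix n
    show "fps_nth (coeff P j * fps_X ^ j) n = fps_nth (fps_X ^ m * fps_shift m (coeff P j * fps_X ^ j)) n"
      using co[of "n - j" j] by (auto simp: fps_X_power_mult_nth fps_X_power_mult_right_nth)
  qed
  have PR: "poly P (fps_X * y) = fps_X ^ m * poly R y" for y
  proof -
    have "poly P (fps_X * y) = (\<Sum>j\<le>degree P + degree R. coeff P j * (fps_X * y) ^ j)"
      by (rule poly_as_sum_le) simp
    also have "\<dots> = (\<Sum>j\<le>degree P + degree R. fps_X ^ m * (coeff R j * y ^ j))"
    proof (intro sum.cong refl)
      fix j
      show "coeff P j * (fps_X * y) ^ j = fps_X ^ m * (coeff R j * y ^ j)"
        unfolding power_mult_distrib mult.assoc[symmetric] sh ..
    qed
    also have "\<dots> = fps_X ^ m * poly R y"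
      by (simp add: sum_distrib_left poly_as_sum_le[of R "degree P + degree R" y])
    finally show ?thesis .
  qed
  have h: "map_poly (\<lambda>c. fps_nth c 0) R = form_poly f m"
  proof (rule poly_eqI)
    fix j
    show "coeff (map_poly (\<lambda>c. fps_nth c 0) R) j = coeff (form_poly f m) j"
      by (simp add: coeff_map_poly cR coeff_form_poly f_def germ_coeff_fps_of_poly fps_X_power_mult_right_nth)
  qed
  have "poly (map_poly (\<lambda>c. fps_nth c 0) R) b = 0"
    unfolding h using z by (simp add: poly_form_poly f_def)
  moreover have "map_poly (\<lambda>c. fps_nth c 0) (pderiv R) = pderiv (map_poly (\<lambda>c. fps_nth c 0) R)"
  proof (rule poly_eqI)
    fix j
    have "fps_nth (of_nat n * g) 0 = of_nat n * fps_nth g 0" for n and g :: "complex fps"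
      by simp
    then show "coeff (map_poly (\<lambda>c. fps_nth c 0) (pderiv R)) j = coeff (pderiv (map_poly (\<lambda>c. fps_nth c 0) R)) j"
      by (simp add: coeff_map_poly coeff_pderiv)
  qed
  then have "poly (map_poly (\<lambda>c. fps_nth c 0) (pderiv R)) b \<noteq> 0"
    unfolding h using simple_root_derivative[OF z s] by (simp add: f_def)
  ultimately obtain y where y: "fps_nth y 0 = b" "poly R y = 0" using hensel_fps by blast
  then have "poly P (fps_X * y) = 0" using PR by simp
  then obtain Q where "P = [:- (fps_X * y), 1:] * Q" by (metis poly_eq_0_iff_dvd dvdE)
  then show ?thesis using y(1) by (intro exI[of _ "fps_X * y"] exI[of _ Q]) simp
qed

text \<open>Roots (1, b) of the leading form are split off one by one; the quotient stays a
  polynomial in t, its order drops by one, and its leading form inherits simple roots different from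
  (1, b). Without such roots the leading form is a multiple of $s^m$, whose root (0, 1) is simple
  only for m = 1. So the direction of the t-axis is met only at the end, and no change of
  coordinates occurs.\<close>

lemma simple_roots_imp_branches:
  fixes P :: "complex fps poly"
  assumes "germ_order (fps_of_poly P) m"
    and "\<And>a b. (a, b) \<noteq> (0, 0) \<Longrightarrow> germ_form (fps_of_poly P) m a b = 0 \<Longrightarrow> simple_root (fps_of_poly P) m a b"
  shows "\<exists>C. transversal_branches (fps_of_poly P) m C"
  using assms
proof (induction m arbitrary: P rule: less_induct)
  case (less m)
  define f where "f = fps_of_poly P"
  note ord = less.prems(1)[folded f_def] and simp_root = less.prems(2)[folded f_def]
  show ?case unfolding f_def[symmetric]
  proof (cases "\<exists>b. germ_form f m 1 b = 0")
    case True
    then obtain b where b: "germ_form f m 1 b = 0" by blast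
    have m0: "\<And>i a b. i < m \<Longrightarrow> germ_form f i a b = 0" using ord by (simp add: germ_order_def)
    obtain y Q where y: "fps_nth y 0 = 0" "fps_nth y 1 = b" and PQ: "P = [:- y, 1:] * Q"
      using split_branch[of m P b] m0 b simp_root[of 1 b] unfolding f_def by auto
    define c where "c = fps_of_poly [:- y, 1:]"
    define g where "g = fps_of_poly Q"
    have fcg: "f = c * g" by (simp add: f_def PQ c_def g_def fps_of_poly_mult)
    have c00: "germ_coeff c 0 0 = 0" "germ_coeff c 1 0 = - b" "germ_coeff c 0 1 = 1"
      using y by (simp_all add: c_def germ_coeff_fps_of_poly)
    have c1: "germ_form c (Suc 0) a b' = b' - b * a" for a b'
      unfolding germ_form_1 c00 by simp
    have "g \<noteq> 0" using ord unfolding fcg germ_order_def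
      by (auto simp: germ_form_def is_hom_simps[OF is_hom_germ_line])
    then obtain n where n: "germ_order g n" using germ_order_exists by blast
    then have g0: "\<And>i a b. i < n \<Longrightarrow> germ_form g i a b = 0" by (simp add: germ_order_def)
    have fm1: "germ_form f i a b = 0" if "i \<le> n" for i a b
      unfolding fcg by (rule germ_form_mult_smooth(1)[OF c00(1) _ that]) (rule g0)
    have fm2: "germ_form f (Suc n) a b = germ_form c (Suc 0) a b * germ_form g n a b" for a b
      unfolding fcg by (rule germ_form_mult_smooth(2)[OF c00(1)]) (rule g0)
    have "germ_order f (Suc n)"
    proof -
      obtain a' b' where "germ_form g n a' b' \<noteq> 0" using n by (auto simp: germ_order_def)
      then obtain x where "x \<noteq> b" "poly (form_poly g n) x \<noteq> 0"
        using nonroot_avoiding[OF form_poly_nz] by blast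
      then have "germ_form f (Suc n) 1 x \<noteq> 0" by (simp add: fm2 c1 poly_form_poly)
      then show ?thesis using fm1 unfolding germ_order_def by (auto simp: less_Suc_eq_le)
    qed
    then have m: "m = Suc n" using germ_order_unique[OF ord] by blast
    \<comment> \<open>At a zero of the leading form of g the product rule leaves only the linear
      part of c times the derivative of the form of g. As this is nonzero, both factors are.\<close>
    have sg: "germ_form c (Suc 0) a b' \<noteq> 0 \<and> simple_root g n a b'"
      if ab: "(a, b') \<noteq> (0, 0)" "germ_form g n a b' = 0" for a b'
    proof -
      have "germ_form f m a b' = 0" using fm2[of a b'] ab(2) by (simp add: m)
      then obtain u u' e where e: "e \<noteq> 0"
        "((\<lambda>x. germ_form f m (a + x * u) (b' + x * u')) has_field_derivative e) (at 0)"
        using simp_root[OF ab(1)] unfolding simple_root_def by blast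
      define G where "G = (\<lambda>x. germ_form g n (a + x * u) (b' + x * u'))"
      \<comment> \<open>The form of g along the chosen line, as a polynomial, to make its
        differentiability evident.\<close>
      define q where "q = (\<Sum>j\<le>n. smult (germ_coeff g (n - j) j) ([:a, u:] ^ (n - j) * [:b', u':] ^ j))"
      have Gq: "G = poly q"
        by (simp add: G_def q_def fun_eq_iff germ_form_def germ_line_def poly_sum mult.assoc)
      have dG: "(G has_field_derivative poly (pderiv q) 0) (at 0)" unfolding Gq by (rule poly_DERIV)
      have G0: "G 0 = 0" using ab by (simp add: G_def)
      have dc: "((\<lambda>x. germ_form c (Suc 0) (a + x * u) (b' + x * u')) has_field_derivative (u' - b * u)) (at 0)"
        unfolding c1 by (auto intro!: derivative_eq_intros)
      have "((\<lambda>x. germ_form f m (a + x * u) (b' + x * u')) has_field_derivative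
           (u' - b * u) * G 0 + poly (pderiv q) 0 * germ_form c (Suc 0) (a + 0 * u) (b' + 0 * u')) (at 0)"
        using DERIV_mult[OF dc dG] by (simp add: G_def m fm2)
      then have "e = (u' - b * u) * G 0 + poly (pderiv q) 0 * germ_form c (Suc 0) (a + 0 * u) (b' + 0 * u')"
        using e(2) DERIV_unique by blast
      then have "poly (pderiv q) 0 * germ_form c (Suc 0) a b' \<noteq> 0" using e(1) G0 by simp
      then show ?thesis using dG unfolding simple_root_def G_def by auto
    qed
    obtain C where C: "transversal_branches g n C"
      using less.IH[of n Q] n sg unfolding g_def m by blast
    define C' where "C' = case_nat c C"
    have "transversal_branches f m C'" unfolding transversal_branches_def
    proof (intro conjI)
      have "smooth_germ c" unfolding smooth_germ_def c00 by simp
      then show "\<forall>j<m. smooth_germ (C' j)"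
        using C by (auto simp: C'_def m transversal_branches_def less_Suc_eq_0_disj split: nat.splits)
      have ne: "germ_tangent c \<noteq> germ_tangent (C j)" if j: "j < n" for j
      proof
        assume eq: "germ_tangent c = germ_tangent (C j)"
        have z: "germ_form (C j) (Suc 0) 1 b = 0"
          using eq germ_tangent_mem[of 1 b c] germ_tangent_mem[of 1 b "C j"] by (simp add: c1)
        obtain u0 where u0: "\<And>a b. germ_form g n a b = u0 * (\<Prod>j<n. germ_form (C j) (Suc 0) a b)"
          using transversal_form(2)[OF C] by blast
        have "(\<Prod>j<n. germ_form (C j) (Suc 0) 1 b) = 0" using z j by (intro prod_zero) auto
        then have "germ_form g n 1 b = 0" unfolding u0 by simp
        then show False using sg[of 1 b] c1[of 1 b] by simp
      qed
      have inj: "inj_on (\<lambda>j. germ_tangent (C j)) {..<n}" using C by (simp add: transversal_branches_def)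
      show "inj_on (\<lambda>j. germ_tangent (C' j)) {..<m}"
      proof (rule inj_onI)
        fix i j assume "i \<in> {..<m}" "j \<in> {..<m}" "germ_tangent (C' i) = germ_tangent (C' j)"
        then show "i = j" using ne inj
          by (cases i; cases j) (auto simp: C'_def m inj_on_def dest: sym)
      qed
      obtain u where u: "u dvd 1" "g = u * (\<Prod>j<n. C j)" using C by (auto simp: transversal_branches_def)
      have "(\<Prod>j<m. C' j) = c * (\<Prod>j<n. C j)"
        unfolding m prod.lessThan_Suc_shift by (simp add: C'_def)
      then show "\<exists>u. u dvd 1 \<and> f = u * (\<Prod>j<m. C' j)"
        using u by (intro exI[of _ u]) (simp add: fcg mult_ac)
    qed
    then show "\<exists>C. transversal_branches f m C" by blast
  next
    case False
    then have "\<nexists>b. poly (form_poly f m) b = 0" by (simp add: poly_form_poly)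
    then have "constant (poly (form_poly f m))" using fundamental_theorem_of_algebra by blast
    then have dg: "degree (form_poly f m) = 0" by (simp add: constant_degree)
    have cz: "germ_coeff f (m - j) j = 0" if "0 < j" "j \<le> m" for j
      using coeff_form_poly[of f m j] that dg by (simp add: coeff_eq_0)
    define e where "e = germ_coeff f m 0"
    have fe: "germ_form f m a b = e * a ^ m" for a b
    proof -
      have "germ_form f m a b = (\<Sum>j\<le>m. if j = 0 then e * a ^ m else 0)"
        unfolding germ_form_def germ_line_def fps_nth_Abs_fps
        by (intro sum.cong) (auto simp: cz e_def)
      then show ?thesis by simp
    qed
    have e0: "e \<noteq> 0" using False fe[of 1] by auto
    have "m = 0 \<or> m = 1"
    proof (rule ccontr)
      assume "\<not> (m = 0 \<or> m = 1)"
      then obtain k where k: "m = Suc (Suc k)" by (metis One_nat_def not0_implies_Suc)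
      then have "germ_form f m 0 1 = 0" unfolding fe by simp
      then obtain u u' c where c: "c \<noteq> 0" "((\<lambda>x. germ_form f m (0 + x * u) (1 + x * u')) has_field_derivative c) (at 0)"
        using simp_root[of 0 1] unfolding simple_root_def by auto
      have "((\<lambda>x. e * (0 + x * u) ^ m) has_field_derivative 0) (at 0)"
        unfolding k by (auto intro!: derivative_eq_intros)
      then show False using c unfolding fe using DERIV_unique by blast
    qed
    then show "\<exists>C. transversal_branches f m C"
    proof
      assume m: "m = 0"
      have "f dvd 1" by (rule germ_unit) (use e0 m in \<open>simp add: e_def\<close>)
      then show ?thesis by (auto simp: transversal_branches_def m)
    next
      assume m: "m = 1"
      have "germ_coeff f 0 0 = 0" using ord m by (simp add: germ_order_def germ_form_0)
      then have "smooth_germ f" using e0 m by (simp add: smooth_germ_def e_def)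
      then have "transversal_branches f m (\<lambda>_. f)"
        by (auto simp: transversal_branches_def m inj_on_def intro: exI[of _ 1])
      then show ?thesis by blast
    qed
  qed
qed

text \<open>The number of branches is the order of the germ, so k is determined. Transversality
  corresponds to simple roots of the leading form, and contact exactly 2 of a branch with its
  tangent to the next form being nonzero there.\<close>

lemma good_iff_ordinary:
  fixes P :: "complex fps poly"
  assumes ord: "germ_order (fps_of_poly P) m"
  shows "good_germ (fps_of_poly P) m \<longleftrightarrow> (\<exists>k C. transversal_branches (fps_of_poly P) k C \<and>
     (\<forall>j<k. germ_int_mult (C j) (germ_tangent_eq (C j)) = 2))"
proof
  assume g: "good_germ (fps_of_poly P) m"
  then obtain C where C: "transversal_branches (fps_of_poly P) m C"
    using simple_roots_imp_branches[OF ord] unfolding good_germ_def by blast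
  have "germ_int_mult (C j) (germ_tangent_eq (C j)) = 2" if j: "j < m" for j
  proof -
    define a where "a = germ_coeff (C j) 0 1"
    define b where "b = - germ_coeff (C j) 1 0"
    have "smooth_germ (C j)" using C j by (simp add: transversal_branches_def)
    then have ab: "(a, b) \<noteq> (0, 0)" by (auto simp: a_def b_def smooth_germ_def)
    have z: "germ_form (C j) (Suc 0) a b = 0" by (simp add: germ_form_1 a_def b_def)
    obtain u0 where "\<And>a b. germ_form (fps_of_poly P) m a b = u0 * (\<Prod>j<m. germ_form (C j) (Suc 0) a b)"
      using transversal_form(2)[OF C] by blast
    then have "germ_form (fps_of_poly P) m a b = 0" using z j by (auto intro!: prod_zero)
    then have "germ_form (fps_of_poly P) (m + 1) a b \<noteq> 0" using g ab unfolding good_germ_def by blast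
    then show ?thesis using transversal_next_form[OF C j ab z] by blast
  qed
  then show "\<exists>k C. transversal_branches (fps_of_poly P) k C \<and>
     (\<forall>j<k. germ_int_mult (C j) (germ_tangent_eq (C j)) = 2)" using C by blast
next
  assume "\<exists>k C. transversal_branches (fps_of_poly P) k C \<and>
     (\<forall>j<k. germ_int_mult (C j) (germ_tangent_eq (C j)) = 2)"
  then obtain k C where C: "transversal_branches (fps_of_poly P) k C"
     "\<And>j. j < k \<Longrightarrow> germ_int_mult (C j) (germ_tangent_eq (C j)) = 2" by blast
  have "k = m" using transversal_form(1)[OF C(1)] germ_order_unique[OF ord] by blast
  then show "good_germ (fps_of_poly P) m" using ordinary_imp_good[OF C] by simp
qed

section \<open>Lines contained in the curve\<close>

lemma map_poly_ident: "map_poly (\<lambda>c. c) p = p"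
  by (rule poly_eqI) (simp add: coeff_map_poly)

lemma poly2_zero:
  fixes G :: "complex poly poly"
  assumes "\<And>a b. poly (map_poly (\<lambda>H. poly H a) G) b = 0"
  shows "G = 0"
proof (rule poly_eqI)
  fix j
  have "poly (coeff G j) a = 0" for a
  proof -
    have "map_poly (\<lambda>H. poly H a) G = 0" using assms[of a] poly_all_0_iff_0 by blast
    then show ?thesis by (metis coeff_0 coeff_map_poly poly_0)
  qed
  then show "coeff G j = coeff 0 j" using poly_all_0_iff_0 by auto
qed

definition eval12 :: "complex \<Rightarrow> complex \<Rightarrow> complex poly poly \<Rightarrow> complex" where
  "eval12 a b G = poly (map_poly (\<lambda>H. poly H a) G) b"

lemma is_hom_eval12: "is_hom (eval12 a b)"
  unfolding eval12_def by (rule is_hom_poly_map[OF is_hom_poly])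

lemma value_at_eval12: "value_at F v = poly (map_poly (eval12 (v $ 1) (v $ 2)) F) (v $ 3)"
  by (simp add: value_at_def eval3_def map_poly_ident eval12_def[abs_def])

lemma value_at_vector: "value_at F (vector [a, b, c]) = poly (map_poly (eval12 a b) F) c"
  by (simp add: value_at_eval12)

lemma value_at_zero:
  assumes "\<And>v. value_at F v = 0"
  shows "F = 0"
proof (rule poly_eqI)
  fix k
  have "eval12 a b (coeff F k) = 0" for a b
  proof -
    have "map_poly (eval12 a b) F = 0"
      using assms value_at_vector[of F a b] poly_all_0_iff_0 by metis
    then show ?thesis by (metis coeff_0 coeff_map_poly is_hom_simps(1)[OF is_hom_eval12])
  qed
  then show "coeff F k = coeff 0 k" using poly2_zero[of "coeff F k"] by (simp add: eval12_def)
qed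

text \<open>Solve the equation of the line for the outermost variable that occurs in it. If this is
  Z, then \<open>F\<close> has the solution r as a root and is divisible by Z - r. Otherwise the
  linear form is constant in the outer variables, and divisibility is checked for each
  coefficient.\<close>

lemma linear_form_dvd:
  assumes a: "a \<noteq> 0" and z: "\<And>x. a $ 1 * x $ 1 + a $ 2 * x $ 2 + a $ 3 * x $ 3 = 0 \<Longrightarrow> value_at F x = 0"
  shows "linear_form a dvd F"
proof -
  have zv: "poly (map_poly (eval12 x y) F) t = 0" if "a $ 1 * x + a $ 2 * y + a $ 3 * t = 0" for x y t
    using z[of "vector [x, y, t]"] that by (simp add: value_at_vector)
  consider "a $ 3 \<noteq> 0" | "a $ 3 = 0" "a $ 2 \<noteq> 0" | "a $ 3 = 0" "a $ 2 = 0" "a $ 1 \<noteq> 0"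
    using a by (auto simp: vec_eq_iff forall_3)
  then show ?thesis
  proof cases
    case 1
    define r where "r = [:[:0, - a $ 1 / a $ 3:], [:- a $ 2 / a $ 3:]:]"
    have "eval12 x y (poly F r) = 0" for x y
    proof -
      have "eval12 x y (poly F r) = poly (map_poly (eval12 x y) F) (eval12 x y r)"
        using poly_map_poly_hom[OF is_hom_eval12, of "\<lambda>c. c" x y F r] by (simp add: map_poly_ident)
      moreover have "eval12 x y r = - (a $ 1 * x + a $ 2 * y) / a $ 3"
        using 1 by (simp add: eval12_def r_def map_poly_pCons field_simps)
      ultimately show ?thesis using zv[of x y "- (a $ 1 * x + a $ 2 * y) / a $ 3"] 1 by simp
    qed
    then have "poly F r = 0" using poly2_zero unfolding eval12_def by blast
    then obtain G where G: "F = [:- r, 1:] * G" by (metis poly_eq_0_iff_dvd dvdE)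
    have "[:- r, 1:] = linear_form a * const3 (1 / a $ 3)"
      using 1 by (simp add: r_def linear_form_def const3_def one_pCons)
    then have "F = linear_form a * (const3 (1 / a $ 3) * G)" using G by (simp only: mult.assoc)
    then show ?thesis by (rule dvdI)
  next
    case 2
    define r where "r = [:0, - a $ 1 / a $ 2:]"
    have "[:[:0, a $ 1:], [:a $ 2:]:] dvd coeff F k" for k
    proof -
      have "poly (poly (coeff F k) r) x = 0" for x
      proof -
        define y where "y = - a $ 1 / a $ 2 * x"
        have "map_poly (eval12 x y) F = 0"
          using zv[of x y] 2 poly_all_0_iff_0 by (auto simp: y_def)
        then have "eval12 x y (coeff F k) = 0" by (metis coeff_0 coeff_map_poly is_hom_simps(1)[OF is_hom_eval12])
        moreover have "poly (poly (coeff F k) r) x = eval12 x (poly r x) (coeff F k)"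
          using poly_map_poly_hom[OF is_hom_poly, of "\<lambda>c. c" "coeff F k" r x] by (simp add: map_poly_ident eval12_def)
        ultimately show ?thesis by (simp add: r_def y_def mult.commute)
      qed
      then have "poly (coeff F k) r = 0" using poly_all_0_iff_0 by blast
      then obtain G where G: "coeff F k = [:- r, 1:] * G" by (metis poly_eq_0_iff_dvd dvdE)
      have "[:- r, 1:] = [:[:0, a $ 1:], [:a $ 2:]:] * [:[:1 / a $ 2:]:]"
        using 2 by (simp add: r_def one_pCons)
      then have "coeff F k = [:[:0, a $ 1:], [:a $ 2:]:] * ([:[:1 / a $ 2:]:] * G)" using G by (simp only: mult.assoc)
      then show ?thesis by (rule dvdI)
    qed
    moreover have "linear_form a = [:[:[:0, a $ 1:], [:a $ 2:]:]:]" using 2 by (simp add: linear_form_def)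
    ultimately show ?thesis by (simp add: const_poly_dvd_iff)
  next
    case 3
    have "[:0, a $ 1:] dvd coeff (coeff F k) j" for k j
    proof -
      have "eval12 0 y (coeff F k) = 0" for y
      proof -
        have "map_poly (eval12 0 y) F = 0" using zv[of 0 y] 3 poly_all_0_iff_0 by auto
        then show ?thesis by (metis coeff_0 coeff_map_poly is_hom_simps(1)[OF is_hom_eval12])
      qed
      then have "map_poly (\<lambda>H. poly H 0) (coeff F k) = 0" unfolding eval12_def using poly_all_0_iff_0 by blast
      then have "poly (coeff (coeff F k) j) 0 = 0" by (metis coeff_0 coeff_map_poly poly_0)
      then obtain G where G: "coeff (coeff F k) j = [:- 0, 1:] * G" by (metis poly_eq_0_iff_dvd dvdE)
      have "[:- 0, 1:] = [:0, a $ 1:] * [:1 / a $ 1:]" using 3 by simp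
      then have "coeff (coeff F k) j = [:0, a $ 1:] * ([:1 / a $ 1:] * G)" using G by (simp only: mult.assoc)
      then show ?thesis by (rule dvdI)
    qed
    moreover have "linear_form a = [:[:[:0, a $ 1:]:]:]" using 3 by (simp add: linear_form_def)
    ultimately show ?thesis by (simp add: const_poly_dvd_iff)
  qed
qed

text \<open>One of two factors has degree 0; it divides the leading coefficient, which is a
  unit.\<close>

lemma irreducible_monic_linear:
  fixes b u :: "'a :: idom"
  assumes "u dvd 1"
  shows "irreducible [:b, u:]"
proof (rule irreducibleI)
  have u: "u \<noteq> 0" using assms by auto
  then show "[:b, u:] \<noteq> 0" by simp
  show "\<not> [:b, u:] dvd 1"
  proof
    assume "[:b, u:] dvd 1"
    then obtain q where q: "1 = [:b, u:] * q" by (rule dvdE)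
    then have "q \<noteq> 0" by auto
    then have "degree ([:b, u:] * q) = degree [:b, u:] + degree q" using u by (intro degree_mult_eq) auto
    then show False using q u by (metis degree_1 degree_pCons_eq_if add_is_0 pCons_eq_0_iff Suc_neq_Zero)
  qed
  have unit: "p dvd 1" if pq: "[:b, u:] = p * q" and d: "degree p = 0" for p q
  proof -
    obtain c where c: "p = [:c:]" using d by (rule degree_eq_zeroE)
    have "u = coeff ([:c:] * q) 1" using arg_cong[OF pq, of "\<lambda>r. coeff r 1"] c by simp
    then have "c dvd u" by simp
    then show ?thesis using assms c by (metis dvd_trans is_unit_const_poly_iff)
  qed
  fix p q assume pq: "[:b, u:] = p * q"
  then have nz: "p \<noteq> 0" "q \<noteq> 0" using u by auto
  have "degree p + degree q = 1" using degree_mult_eq[OF nz] u unfolding pq[symmetric] by simp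
  then have "degree p = 0 \<or> degree q = 0" by auto
  then show "p dvd 1 \<or> q dvd 1" using unit[of p q] unit[of q p] pq by (auto simp: mult.commute)
qed

lemma irreducible_const:
  fixes c :: "'a :: idom"
  assumes "irreducible c"
  shows "irreducible [:c:]"
proof (rule irreducibleI)
  show "[:c:] \<noteq> 0" using assms by (auto simp: irreducible_def)
  show "\<not> [:c:] dvd 1" using assms by (auto simp: irreducible_def is_unit_const_poly_iff)
  fix p q assume pq: "[:c:] = p * q"
  then have nz: "p \<noteq> 0" "q \<noteq> 0" using assms by (auto simp: irreducible_def)
  have "degree p + degree q = 0" using degree_mult_eq[OF nz] unfolding pq[symmetric] by simp
  then obtain x y where xy: "p = [:x:]" "q = [:y:]" by (auto elim!: degree_eq_zeroE)
  then have "c = x * y" using pq by simp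
  then have "x dvd 1 \<or> y dvd 1" using assms by (auto simp: irreducible_def)
  then show "p dvd 1 \<or> q dvd 1" unfolding xy is_unit_const_poly_iff .
qed

lemma complex_unit: "c \<noteq> 0 \<Longrightarrow> (c :: complex) dvd 1"
  by (rule dvdI[of _ _ "1 / c"]) simp

lemma irreducible_linear_form:
  assumes "a \<noteq> 0"
  shows "irreducible (linear_form a)"
proof -
  consider "a $ 3 \<noteq> 0" | "a $ 3 = 0" "a $ 2 \<noteq> 0" | "a $ 3 = 0" "a $ 2 = 0" "a $ 1 \<noteq> 0"
    using assms by (auto simp: vec_eq_iff forall_3)
  then show ?thesis
  proof cases
    case 1
    then show ?thesis unfolding linear_form_def
      by (intro irreducible_monic_linear) (simp add: is_unit_const_poly_iff complex_unit)
  next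
    case 2
    then show ?thesis unfolding linear_form_def
      by (simp, intro irreducible_const irreducible_monic_linear) (simp add: is_unit_const_poly_iff complex_unit)
  next
    case 3
    then show ?thesis unfolding linear_form_def
      by (simp, intro irreducible_const irreducible_monic_linear) (simp add: complex_unit)
  qed
qed

text \<open>The place where the absence of line components enters: a form that vanishes on a line is
  divisible by its irreducible linear equation. It makes the contact with a tangent finite.\<close>

lemma not_in_line:
  assumes hom: "homogeneous d F" and nl: "\<And>G. is_component G F \<Longrightarrow> \<not> is_line G"
    and det: "det3 v w u \<noteq> 0"
  shows "LP F v w \<noteq> 0"
proof
  assume z: "LP F v w = 0"
  \<comment> \<open>The cross product of v and w; its linear form sends x to
    \<open>det3 v w x\<close>.\<close>
  define a :: "complex ^ 3" where "a = vector [v $ 2 * w $ 3 - v $ 3 * w $ 2, v $ 3 * w $ 1 - v $ 1 * w $ 3, v $ 1 * w $ 2 - v $ 2 * w $ 1]"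
  have ax: "a $ 1 * x $ 1 + a $ 2 * x $ 2 + a $ 3 * x $ 3 = det3 v w x" for x
    by (simp add: a_def det3_def algebra_simps)
  have "a \<noteq> 0" using ax[of u] det by auto
  moreover have "value_at F x = 0" if "a $ 1 * x $ 1 + a $ 2 * x $ 2 + a $ 3 * x $ 3 = 0" for x
  proof -
    obtain \<alpha> \<beta> \<gamma> where x: "x = \<alpha> *s v + \<beta> *s w + \<gamma> *s u" using basis3[OF det] by blast
    have "det3 v w x = \<gamma> * det3 v w u" unfolding x by (simp add: det3_def algebra_simps)
    then have "\<gamma> = 0" using that det unfolding ax by simp
    then show ?thesis using value_at_line[OF hom, of \<alpha> v \<beta> w] z x by simp
  qed
  ultimately have "linear_form a dvd F" "irreducible (linear_form a)"
    using linear_form_dvd irreducible_linear_form by blast+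
  then show False using nl[of "linear_form a"] \<open>a \<noteq> 0\<close> unfolding is_component_def is_line_def by blast
qed

section \<open>Local equations and Taylor expansions\<close>

lemma is_hom_germ_const: "is_hom germ_const"
  unfolding germ_const_def using is_hom_comp[OF is_hom_fps_const is_hom_fps_const] .

definition gdot :: "poly3 \<Rightarrow> complex ^ 3 \<Rightarrow> complex ^ 3 \<Rightarrow> complex" where
  "gdot F v w = value_at (dird w F) v"

lemma gdot_gradient: "gdot F v w = gradient F v $ 1 * w $ 1 + gradient F v $ 2 * w $ 2 + gradient F v $ 3 * w $ 3"
  by (simp add: gdot_def value_at_dird_gradient sum_3)

lemma gradient_zero_iff: "gradient F v = 0 \<longleftrightarrow> (\<forall>w. value_at (dird w F) v = 0)"
proof
  assume "\<forall>w. value_at (dird w F) v = 0"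
  then have "gdot F v w = 0" for w by (simp add: gdot_def)
  from this[of "vector [1, 0, 0]"] this[of "vector [0, 1, 0]"] this[of "vector [0, 0, 1]"]
  show "gradient F v = 0" by (simp add: gdot_gradient vec_eq_iff forall_3)
qed (simp add: value_at_dird_gradient)

text \<open>A dictionary between germs at v and Taylor coefficients at the representative
  \<open>c *s v\<close> that is normalised in the chart, with w1 and w2 as coordinate
  directions.\<close>

lemma local_chart:
  assumes "v \<noteq> 0"
  obtains c w1 w2 where "c \<noteq> 0" "det3 (c *s v) w1 w2 \<noteq> 0"
    "\<And>F n a b. germ_form (local_eq F v) n a b = coeff (LP F (c *s v) (a *s w1 + b *s w2)) n"
    "\<And>F. local_eq (linear_form (gradient F v)) v =
       germ_const (gdot F v (c *s v)) + germ_const (gdot F v w1) * germ_s + germ_const (gdot F v w2) * germ_t"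
proof -
  obtain c w1 w2 where c: "c \<noteq> 0" "det3 (c *s v) w1 w2 \<noteq> 0" and le:
    "\<And>F. local_eq F v = eval3 germ_const F
       (germ_const ((c *s v) $ 1) + germ_const (w1 $ 1) * germ_s + germ_const (w2 $ 1) * germ_t)
       (germ_const ((c *s v) $ 2) + germ_const (w1 $ 2) * germ_s + germ_const (w2 $ 2) * germ_t)
       (germ_const ((c *s v) $ 3) + germ_const (w1 $ 3) * germ_s + germ_const (w2 $ 3) * germ_t)"
    by (rule chart[OF assms]) blast
  note h = is_hom_simps[OF is_hom_germ_const]
  have lin: "eval3 germ_const (linear_form g) A B C = germ_const (g $ 1) * A + germ_const (g $ 2) * B + germ_const (g $ 3) * C" for g A B C
    unfolding eval3_def linear_form_def
    by (simp add: map_poly_pCons h algebra_simps)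
  show ?thesis
  proof (rule that[OF c])
    show "germ_form (local_eq F v) n a b = coeff (LP F (c *s v) (a *s w1 + b *s w2)) n" for F n a b
      unfolding germ_form_def le germ_line_eval3 by simp
    show "local_eq (linear_form (gradient F v)) v =
       germ_const (gdot F v (c *s v)) + germ_const (gdot F v w1) * germ_s + germ_const (gdot F v w2) * germ_t" for F
      unfolding le lin gdot_gradient h by (simp add: algebra_simps)
  qed
qed

section \<open>Independence of the homogeneous coordinates\<close>

lemma dird_scale:
  assumes "homogeneous d F"
  shows "value_at (dird w F) (c *s v) = c ^ (d - 1) * value_at (dird w F) v"
  by (rule value_at_scale[OF homogeneous_dird[OF assms]])

lemma LP_scale:
  assumes "homogeneous d F" "\<And>j. j < k \<Longrightarrow> coeff (LP F v w) j = 0"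
  shows "j < k \<Longrightarrow> coeff (LP F (c *s v) w) j = 0"
    and "coeff (LP F (c *s v) w) k = c ^ (d - k) * coeff (LP F v w) k"
  using LP_shift[OF assms(1), where k = k and v = v and w = w and c = c and a = 1 and b = 0] assms(2) by auto

lemma is_mult_scale:
  assumes hom: "homogeneous d F" and c: "c \<noteq> 0" and m: "is_mult F v m"
  shows "is_mult F (c *s v) m"
proof -
  have z: "\<And>w j. j < m \<Longrightarrow> coeff (LP F v w) j = 0" using m by (auto simp: is_mult_def)
  obtain w where w: "coeff (LP F v w) m \<noteq> 0" using m by (auto simp: is_mult_def)
  show ?thesis unfolding is_mult_def
    using LP_scale[OF hom, where k = m and v = v and c = c] z w c by (auto intro!: exI[of _ w])
qed

lemma good_pt_scale:
  assumes hom: "homogeneous d F" and c: "c \<noteq> 0" and m: "is_mult F v m" and g: "good_pt F v m"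
  shows "good_pt F (c *s v) m"
  unfolding good_pt_def
proof (intro allI impI)
  have z: "\<And>w j. j < m \<Longrightarrow> coeff (LP F v w) j = 0" using m by (auto simp: is_mult_def)
  fix w assume w: "\<nexists>e. w = e *s (c *s v)" and zm: "coeff (LP F (c *s v) w) m = 0"
  have w': "\<nexists>e. w = e *s v"
  proof
    assume "\<exists>e. w = e *s v"
    then obtain e where "w = e *s v" ..
    then have "w = (e / c) *s (c *s v)" using c by simp
    then show False using w by blast
  qed
  have "coeff (LP F v w) m = 0" using zm LP_scale(2)[OF hom, where k = m and v = v and w = w and c = c] z c by simp
  then obtain u where u: "coeff (LP F v w) (m + 1) \<noteq> 0" "coeff (LP (dird u F) v w) (m - 1) \<noteq> 0"
    and zz: "\<And>j. j < m + 1 \<Longrightarrow> coeff (LP F v w) j = 0"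
    using g w' z unfolding good_pt_def by (metis less_Suc_eq Suc_eq_plus1)
  have "coeff (LP F (c *s v) w) (m + 1) \<noteq> 0"
    using LP_scale(2)[OF hom, where k = "m + 1" and v = v and w = w and c = c] zz u c by simp
  moreover have "coeff (LP (dird u F) (c *s v) w) (m - 1) \<noteq> 0"
    using LP_scale(2)[OF homogeneous_dird[OF hom], where k = "m - 1" and v = v and w = w and c = c]
      coeff_LP_dird_vanish[of m F v] z u c by simp
  ultimately show "coeff (LP F (c *s v) w) (m + 1) \<noteq> 0 \<and> (\<exists>u. coeff (LP (dird u F) (c *s v) w) (m - 1) \<noteq> 0)"
    by blast
qed

lemma smooth_pt_scale:
  assumes hom: "homogeneous d F" and c: "c \<noteq> 0" and s: "smooth_pt F v k"
  shows "smooth_pt F (c *s v) k"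
proof -
  obtain u where u: "value_at (dird u F) v \<noteq> 0" using s by (auto simp: smooth_pt_def)
  have con: "(\<forall>j<k. coeff (LP F (c *s v) w) j = 0) \<and> coeff (LP F (c *s v) w) k \<noteq> 0"
    if w: "value_at (dird w F) (c *s v) = 0" "\<nexists>e. w = e *s (c *s v)" for w
  proof -
    have "value_at (dird w F) v = 0" using w(1) c by (simp add: dird_scale[OF hom])
    moreover have "\<nexists>e. w = e *s v"
    proof
      assume "\<exists>e. w = e *s v"
      then obtain e where "w = e *s v" ..
      then have "w = (e / c) *s (c *s v)" using c by simp
      then show False using w(2) by blast
    qed
    ultimately have "\<And>j. j < k \<Longrightarrow> coeff (LP F v w) j = 0" "coeff (LP F v w) k \<noteq> 0"
      using s by (auto simp: smooth_pt_def)
    then show ?thesis using LP_scale[OF hom, where k = k and v = v and w = w and c = c] c by simp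
  qed
  show ?thesis unfolding smooth_pt_def
    using s con u c by (auto simp: smooth_pt_def value_at_scale[OF hom] dird_scale[OF hom] intro!: exI[of _ u])
qed

text \<open>A direction in the ambient space is a direction of the chart plus a multiple of the base
  point, and this multiple does not affect the first nonvanishing Taylor coefficient. So order and
  goodness of the germ are those of the Taylor expansion.\<close>

lemma local_order:
  assumes hom: "homogeneous d F" and F: "F \<noteq> 0" and v: "v \<noteq> 0"
  shows "\<exists>m. germ_order (local_eq F v) m \<and> is_mult F v m \<and> (m \<ge> 1 \<longrightarrow> (good_germ (local_eq F v) m \<longleftrightarrow> good_pt F v m))"
proof -
  obtain c w1 w2 where c: "c \<noteq> 0" and det: "det3 (c *s v) w1 w2 \<noteq> 0" and
    form: "\<And>F n a b. germ_form (local_eq F v) n a b = coeff (LP F (c *s v) (a *s w1 + b *s w2)) n"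
    using local_chart[OF v] by metis
  define v0 where "v0 = c *s v"
  define f where "f = local_eq F v"
  define \<omega> where "\<omega> = (\<lambda>a b. a *s w1 + b *s w2)"
  have form: "germ_form f n a b = coeff (LP F v0 (\<omega> a b)) n" for n a b
    by (simp add: f_def form v0_def \<omega>_def)
  have basis: "\<exists>x a b. w = 1 *s \<omega> a b + x *s v0" for w
  proof -
    obtain x a b where "w = x *s v0 + a *s w1 + b *s w2" using basis3[OF det] unfolding v0_def by blast
    then have "w = 1 *s \<omega> a b + x *s v0" by (simp add: \<omega>_def)
    then show ?thesis by blast
  qed
  \<comment> \<open>\<open>LP_shift\<close> with scaling factors 1: the component along
    \<open>v0\<close> is harmless as long as the lower coefficients vanish.\<close>
  have tr: "(\<forall>j<k. coeff (LP F v0 (1 *s \<omega> a b + x *s v0)) j = 0) \<and>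
       coeff (LP F v0 (1 *s \<omega> a b + x *s v0)) k = germ_form f k a b"
    if "\<And>j. j < k \<Longrightarrow> germ_form f j a b = 0" for k a b x
    using LP_shift[OF hom, where k = k and v = v0 and w = "\<omega> a b" and c = 1 and a = 1 and b = x] that[unfolded form]
    by (simp add: form)
  have "f \<noteq> 0"
  proof
    assume "f = 0"
    then have f0: "germ_form f n a b = 0" for n a b
      by (simp add: germ_form_def is_hom_simps[OF is_hom_germ_line])
    have "value_at F x = 0" for x
    proof -
      obtain y a b where y: "x - v0 = 1 *s \<omega> a b + y *s v0" using basis by blast
      have "coeff (LP F v0 (x - v0)) k = 0" for k unfolding y using tr[of k a b y] f0 by simp
      then have "LP F v0 (x - v0) = 0" by (intro poly_eqI) simp
      then show ?thesis using poly_LP[of F v0 "x - v0" 1] by simp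
    qed
    then show False using value_at_zero F by blast
  qed
  then obtain m where m: "germ_order f m" using germ_order_exists by blast
  have m0: "\<And>j a b. j < m \<Longrightarrow> germ_form f j a b = 0" using m by (simp add: germ_order_def)
  have mult0: "is_mult F v0 m" unfolding is_mult_def
  proof (intro conjI allI impI)
    fix j w assume j: "j < m"
    obtain x a b where w: "w = 1 *s \<omega> a b + x *s v0" using basis by blast
    show "coeff (LP F v0 w) j = 0" unfolding w using tr[of m a b x] m0 j by simp
  next
    obtain a b where "germ_form f m a b \<noteq> 0" using m by (auto simp: germ_order_def)
    then show "\<exists>w. coeff (LP F v0 w) m \<noteq> 0" unfolding form by blast
  qed
  have vv: "v = (1 / c) *s v0" using c by (simp add: v0_def)
  have mult: "is_mult F v m" unfolding vv by (rule is_mult_scale[OF hom _ mult0]) (use c in simp)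
  have gg: "good_pt F v m \<longleftrightarrow> good_pt F v0 m"
    using good_pt_scale[OF hom c mult] good_pt_scale[OF hom _ mult0, of "1 / c"] c vv unfolding v0_def by auto
  have "good_germ f m \<longleftrightarrow> good_pt F v0 m" if m1: "m \<ge> 1"
  proof -
    have z: "\<And>w j. j < m \<Longrightarrow> coeff (LP F v0 w) j = 0" using mult0 by (auto simp: is_mult_def)
    have hd: "homogeneous (d - 1) (dird u F)" for u by (rule homogeneous_dird[OF hom])
    have zd: "\<And>u w j. j < m - 1 \<Longrightarrow> coeff (LP (dird u F) v0 w) j = 0"
      by (rule coeff_LP_dird_vanish[OF z])
    \<comment> \<open>The derivative of the leading form in the chart is a Taylor coefficient of
      \<open>dird\<close>, and the component of u along \<open>v0\<close> contributes nothing by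
      \<open>dird_self_zero\<close>.\<close>
    have sr: "simple_root f m a b \<longleftrightarrow> (\<exists>u. coeff (LP (dird u F) v0 (\<omega> a b)) (m - 1) \<noteq> 0)" for a b
    proof -
      have dv: "((\<lambda>x. germ_form f m (a + x * a') (b + x * b')) has_field_derivative
         coeff (LP (dird (\<omega> a' b') F) v0 (\<omega> a b)) (m - 1)) (at 0)" for a' b'
      proof -
        have "\<omega> (a + x * a') (b + x * b') = \<omega> a b + x *s \<omega> a' b'" for x
          by (simp add: \<omega>_def vec_eq_iff algebra_simps)
        then show ?thesis unfolding form using coeff_LP_deriv[of F v0 "\<omega> a b" "\<omega> a' b'" "m - 1"] m1 by simp
      qed
      show ?thesis
      proof
        assume "simple_root f m a b"
        then show "\<exists>u. coeff (LP (dird u F) v0 (\<omega> a b)) (m - 1) \<noteq> 0"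
          unfolding simple_root_def using dv DERIV_unique by metis
      next
        assume "\<exists>u. coeff (LP (dird u F) v0 (\<omega> a b)) (m - 1) \<noteq> 0"
        then obtain u where u: "coeff (LP (dird u F) v0 (\<omega> a b)) (m - 1) \<noteq> 0" ..
        obtain x a' b' where ub: "u = 1 *s \<omega> a' b' + x *s v0" using basis by blast
        have "coeff (LP (dird (\<omega> a' b') F) v0 (\<omega> a b)) (m - 1) \<noteq> 0"
          using u unfolding ub coeff_LP_lin dird_self_zero[OF hom mult0 m1] by simp
        then show "simple_root f m a b" unfolding simple_root_def using dv by blast
      qed
    qed
    show ?thesis
    proof
      assume g: "good_germ f m"
      show "good_pt F v0 m" unfolding good_pt_def
      proof (intro allI impI)
        fix w assume w: "\<nexists>c. w = c *s v0" and wz: "coeff (LP F v0 w) m = 0"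
        obtain x a b where wb: "w = 1 *s \<omega> a b + x *s v0" using basis by blast
        have ab: "(a, b) \<noteq> (0, 0)" using w wb by (auto simp: \<omega>_def)
        have fm: "germ_form f m a b = 0" using tr[of m a b x] m0 wz unfolding wb by simp
        have "\<And>j. j < m + 1 \<Longrightarrow> germ_form f j a b = 0" using m0 fm by (auto simp: less_Suc_eq)
        then have "coeff (LP F v0 w) (m + 1) = germ_form f (m + 1) a b" unfolding wb using tr[of "m + 1"] by simp
        moreover obtain u where "coeff (LP (dird u F) v0 (\<omega> a b)) (m - 1) \<noteq> 0"
          using g ab fm sr unfolding good_germ_def by blast
        then have "coeff (LP (dird u F) v0 w) (m - 1) \<noteq> 0"
          using LP_shift(2)[OF hd, where k = "m - 1" and v = v0 and w = "\<omega> a b" and c = 1 and a = 1 and b = x] zd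
          unfolding wb by simp
        ultimately show "coeff (LP F v0 w) (m + 1) \<noteq> 0 \<and> (\<exists>u. coeff (LP (dird u F) v0 w) (m - 1) \<noteq> 0)"
          using g ab fm unfolding good_germ_def by auto
      qed
    next
      assume g: "good_pt F v0 m"
      show "good_germ f m" unfolding good_germ_def
      proof (intro allI impI)
        fix a b assume ab: "(a, b) \<noteq> (0, 0)" and z: "germ_form f m a b = 0"
        have "\<nexists>e. \<omega> a b = e *s v0"
        proof
          assume "\<exists>e. \<omega> a b = e *s v0"
          then obtain e where e: "\<omega> a b = e *s v0" ..
          have "det3 v0 (\<omega> a b) w2 = a * det3 v0 w1 w2" "det3 v0 w1 (\<omega> a b) = b * det3 v0 w1 w2"
            by (simp_all add: \<omega>_def det3_def algebra_simps)
          moreover have "det3 v0 (\<omega> a b) w2 = 0" "det3 v0 w1 (\<omega> a b) = 0"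
            unfolding e by (simp_all add: det3_def algebra_simps)
          ultimately show False using det ab unfolding v0_def by auto
        qed
        then show "germ_form f (m + 1) a b \<noteq> 0 \<and> simple_root f m a b"
          using g z unfolding good_pt_def form sr by blast
      qed
    qed
  qed
  then show ?thesis using m mult gg unfolding f_def by blast
qed

lemma inflection_contact:
  assumes hom: "homogeneous d F" and nl: "\<And>G. is_component G F \<Longrightarrow> \<not> is_line G"
    and v: "coords p \<noteq> 0" "value_at F (coords p) = 0" "gradient F (coords p) \<noteq> 0"
  shows "\<exists>k. smooth_pt F (coords p) k \<and> inflection_order F p = int k - 2"
proof -
  define v where "v = coords p"
  note v' = v[folded v_def]
  obtain c w1 w2 where c: "c \<noteq> 0" and det: "det3 (c *s v) w1 w2 \<noteq> 0" and
    form: "\<And>F n a b. germ_form (local_eq F v) n a b = coeff (LP F (c *s v) (a *s w1 + b *s w2)) n" and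
    lin: "\<And>F. local_eq (linear_form (gradient F v)) v =
       germ_const (gdot F v (c *s v)) + germ_const (gdot F v w1) * germ_s + germ_const (gdot F v w2) * germ_t"
    using local_chart[OF v'(1)] by metis
  define \<alpha> where "\<alpha> = gdot F v w1"
  define \<beta> where "\<beta> = gdot F v w2"
  define \<omega> where "\<omega> = \<beta> *s w1 + (- \<alpha>) *s w2"
  have gl: "gdot F v (x *s u + y *s w) = x * gdot F v u + y * gdot F v w" for x y u w
    by (simp add: gdot_def dird_lin)
  \<comment> \<open>By Euler's relation the tangent line passes through the point, so its local
    equation has no constant term.\<close>
  have gv: "gdot F v (c *s v) = 0"
    using gl[of c v 0 v] euler[OF hom, of v] v'(2) by (simp add: gdot_def)
  have ab: "\<alpha> \<noteq> 0 \<or> \<beta> \<noteq> 0"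
  proof (rule ccontr)
    assume "\<not> ?thesis"
    then have z: "gdot F v w1 = 0" "gdot F v w2 = 0" by (auto simp: \<alpha>_def \<beta>_def)
    have "gdot F v w = 0" for w
    proof -
      obtain x y t where "w = x *s (c *s v) + y *s w1 + t *s w2" using basis3[OF det] by blast
      then have "w = 1 *s (x *s (c *s v) + y *s w1) + t *s w2" by simp
      then show ?thesis by (simp only: gl gv z) simp
    qed
    then show False using v'(3) gradient_zero_iff[of F v] by (simp add: gdot_def)
  qed
  have "\<exists>u. det3 (c *s v) \<omega> u \<noteq> 0"
  proof (cases "\<alpha> = 0")
    case True
    then have "det3 (c *s v) \<omega> w2 = \<beta> * det3 (c *s v) w1 w2" by (simp add: \<omega>_def det3_def algebra_simps)
    then show ?thesis using ab True det by (intro exI[of _ w2]) simp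
  next
    case False
    have "det3 (c *s v) \<omega> w1 = \<alpha> * det3 (c *s v) w1 w2" by (simp add: \<omega>_def det3_def algebra_simps)
    then show ?thesis using False det by (intro exI[of _ w1]) simp
  qed
  then have "LP F (c *s v) \<omega> \<noteq> 0" using not_in_line[OF hom nl] by blast
  then have ex: "\<exists>n. coeff (LP F (c *s v) \<omega>) n \<noteq> 0" by (metis leading_coeff_0_iff)
  define k where "k = (LEAST n. coeff (LP F (c *s v) \<omega>) n \<noteq> 0)"
  have k: "coeff (LP F (c *s v) \<omega>) k \<noteq> 0" "\<And>j. j < k \<Longrightarrow> coeff (LP F (c *s v) \<omega>) j = 0"
    using LeastI_ex[OF ex] not_less_Least unfolding k_def by blast+
  have "gdot F v \<omega> = 0" unfolding \<omega>_def gl by (simp add: \<alpha>_def \<beta>_def)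
  then have "coeff (LP F (c *s v) \<omega>) 1 = 0" by (simp only: coeff_1_LP dird_scale[OF hom] gdot_def) simp
  moreover have "coeff (LP F (c *s v) \<omega>) 0 = 0" using v'(2) by (simp add: coeff_0_LP value_at_scale[OF hom])
  ultimately have k2: "k \<ge> 2"
  proof -
    assume a: "coeff (LP F (c *s v) \<omega>) 1 = 0" "coeff (LP F (c *s v) \<omega>) 0 = 0"
    have "k \<noteq> 0" "k \<noteq> 1" using k(1) a by metis+
    then show ?thesis by simp
  qed
  have "smooth_pt F v k" unfolding smooth_pt_def
  proof (intro conjI allI impI)
    show "\<exists>u. value_at (dird u F) v \<noteq> 0" using v'(3) gradient_zero_iff by blast
    fix w assume w: "value_at (dird w F) v = 0" "\<nexists>e. w = e *s v"
    obtain x y t where wb: "w = x *s (c *s v) + y *s w1 + t *s w2" using basis3[OF det] by blast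
    then have "w = 1 *s (x *s (c *s v) + y *s w1) + t *s w2" by simp
    then have "gdot F v w = y * \<alpha> + t * \<beta>" by (simp only: gl gv \<alpha>_def \<beta>_def) simp
    then have e: "\<alpha> * y + \<beta> * t = 0" using w(1) by (simp add: gdot_def mult.commute)
    have "(y, t) \<noteq> (0, 0)"
    proof
      assume "(y, t) = (0, 0)"
      then have "w = (x * c) *s v" using wb by simp
      then show False using w(2) by blast
    qed
    then obtain r where r: "r \<noteq> 0" "y = r * \<beta>" "t = r * (- \<alpha>)" using linear_form2_zero[OF ab _ e] by blast
    \<comment> \<open>All tangent directions are nonzero multiples of \<open>\<omega>\<close> plus a
      multiple of the base point, and so have the same contact order.\<close>
    have ww: "w = r *s \<omega> + x *s (c *s v)" unfolding wb r \<omega>_def by (simp add: vec_eq_iff algebra_simps)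
    have "(1 / c) *s (c *s v) = v" using c by simp
    then have "(\<forall>j<k. coeff (LP F v w) j = 0) \<and> coeff (LP F v w) k \<noteq> 0"
      using LP_shift[OF hom, where k = k and v = "c *s v" and w = \<omega> and c = "1 / c" and a = r and b = x] k r(1) c
      unfolding ww by auto
    then show "coeff (LP F v w) k \<noteq> 0" "\<And>j. j < k \<Longrightarrow> coeff (LP F v w) j = 0" by auto
  qed (use k2 v' in auto)
  moreover have "germ_int_mult (local_eq F v) (local_eq (linear_form (gradient F v)) v) = enat k"
  proof -
    have "fps_nth (germ_line \<beta> (- \<alpha>) (local_eq F v)) n = coeff (LP F (c *s v) \<omega>) n" for n
      using form[of F n \<beta> "- \<alpha>"] by (simp add: germ_form_def \<omega>_def)
    then have "germ_int_mult (local_eq F v) (germ_const \<alpha> * germ_s + germ_const \<beta> * germ_t) = enat k"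
      using germ_int_mult_line[OF ab, of k "local_eq F v"] k by simp
    moreover have "germ_const 0 = 0" by (simp add: germ_const_def)
    ultimately show ?thesis unfolding lin gv by (simp add: \<alpha>_def \<beta>_def)
  qed
  ultimately show ?thesis
    unfolding inflection_order_def int_mult_def germ_at_def tangent_line_def v_def[symmetric]
    by (intro exI[of _ k]) simp
qed

section \<open>Points of the curve\<close>

definition point :: "complex ^ 3 \<Rightarrow> (complex ^ 3) set" where
  "point v = proj_rel `` {v}"

lemma mem_point: "v \<noteq> 0 \<Longrightarrow> w \<in> point v \<longleftrightarrow> (\<exists>c. c \<noteq> 0 \<and> w = c *s v)"
  by (auto simp: point_def proj_rel_def)

lemma self_mem_point: "v \<noteq> 0 \<Longrightarrow> v \<in> point v"
  by (auto simp: mem_point intro: exI[of _ 1])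

lemma point_scale:
  assumes "c \<noteq> 0"
  shows "point (c *s v) = point v"
proof (cases "v = 0")
  case True
  then show ?thesis by simp
next
  case False
  then have cv: "c *s v \<noteq> 0" using assms by simp
  show ?thesis
  proof (intro set_eqI iffI)
    fix w assume "w \<in> point (c *s v)"
    then obtain e where "e \<noteq> 0" "w = e *s (c *s v)" using mem_point[OF cv] by blast
    then show "w \<in> point v" using assms by (auto simp: mem_point[OF False] intro!: exI[of _ "e * c"])
  next
    fix w assume "w \<in> point v"
    then obtain e where "e \<noteq> 0" "w = e *s v" using mem_point[OF False] by blast
    then show "w \<in> point (c *s v)" using assms by (auto simp: mem_point[OF cv] intro!: exI[of _ "e / c"])
  qed
qed

lemma point_in_plane: "v \<noteq> 0 \<Longrightarrow> point v \<in> proj_plane"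
  unfolding point_def proj_plane_def by (rule quotientI) simp

lemma plane_point:
  assumes "p \<in> proj_plane" "v \<in> p"
  shows "v \<noteq> 0" "p = point v"
proof -
  obtain u where u: "p = point u" "u \<noteq> 0"
    using assms(1) unfolding proj_plane_def point_def by (auto elim!: quotientE)
  obtain c where c: "c \<noteq> 0" "v = c *s u" using assms(2) u mem_point by blast
  then show "v \<noteq> 0" using u by simp
  show "p = point v" using point_scale[OF c(1)] c u by simp
qed

lemma coords_mem:
  assumes "p \<in> proj_plane"
  shows "coords p \<in> p"
proof -
  obtain u where "p = point u" "u \<noteq> 0"
    using assms unfolding proj_plane_def point_def by (auto elim!: quotientE)
  then have "u \<in> p" by (simp add: self_mem_point)
  then show ?thesis unfolding coords_def by (rule someI)
qed

lemma plane_coords: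
  assumes "p \<in> proj_plane" "v \<in> p"
  obtains c where "c \<noteq> 0" "v = c *s coords p"
proof -
  have u: "coords p \<in> p" by (rule coords_mem[OF assms(1)])
  have "v \<in> point (coords p)" using plane_point[OF assms(1) u] assms(2) by simp
  then show ?thesis using mem_point[OF plane_point(1)[OF assms(1) u]] that by blast
qed

lemma curve_points_iff:
  assumes hom: "homogeneous d F" and v: "v \<noteq> 0"
  shows "point v \<in> curve_points F \<longleftrightarrow> value_at F v = 0"
  using self_mem_point[OF v] point_in_plane[OF v] mem_point[OF v]
  by (auto simp: curve_points_def value_at_scale[OF hom])

text \<open>The definitions refer to the chosen coordinates of a point, whereas projection produces
  other representatives. Here the local data are transferred to an arbitrary representative
  v.\<close>

lemma point_type:
  assumes hom: "homogeneous d F" and F: "F \<noteq> 0" and nl: "\<And>G. is_component G F \<Longrightarrow> \<not> is_line G"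
    and p: "p \<in> curve_points F" and v: "v \<in> p"
  shows "p \<in> singular_points F \<Longrightarrow> sing_pt F v (multiplicity_at F p) \<and>
      (good_pt F v (multiplicity_at F p) \<longleftrightarrow> (\<exists>k. ordinary_simple_multiple_point F k p))"
    and "p \<notin> singular_points F \<Longrightarrow> \<exists>k. smooth_pt F v k \<and> inflection_order F p = int k - 2"
proof -
  have pp: "p \<in> proj_plane" using p by (simp add: curve_points_def)
  define u where "u = coords p"
  have up: "u \<in> p" unfolding u_def by (rule coords_mem[OF pp])
  have u0: "u \<noteq> 0" by (rule plane_point(1)[OF pp up])
  obtain c where c: "c \<noteq> 0" "v = c *s u" using plane_coords[OF pp v] unfolding u_def by blast
  have uv: "u = (1 / c) *s v" using c by simp
  have u\<Phi>: "value_at F u = 0" using p up by (simp add: curve_points_def)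
  obtain m where m: "germ_order (local_eq F u) m" "is_mult F u m"
    and gm: "m \<ge> 1 \<longrightarrow> (good_germ (local_eq F u) m \<longleftrightarrow> good_pt F u m)"
    using local_order[OF hom F u0] by blast
  have mp: "multiplicity_at F p = m"
    unfolding multiplicity_at_def germ_at_def u_def[symmetric] by (rule germ_mult_eq[OF m(1)])
  have mv: "is_mult F v m" unfolding c(2) by (rule is_mult_scale[OF hom c(1) m(2)])
  have grad: "p \<in> singular_points F \<longleftrightarrow> gradient F u = 0"
  proof
    assume "gradient F u = 0"
    then have z: "value_at (dird w F) u = 0" for w using gradient_zero_iff by blast
    have "gradient F x = 0" if xp: "x \<in> p" for x
    proof -
      obtain e where "e \<noteq> 0" "x = e *s u" using plane_coords[OF pp xp] unfolding u_def by blast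
      then show ?thesis unfolding gradient_zero_iff by (simp add: dird_scale[OF hom] z)
    qed
    then show "p \<in> singular_points F" using p by (simp add: singular_points_def)
  qed (use up in \<open>simp add: singular_points_def\<close>)
  show "sing_pt F v (multiplicity_at F p) \<and>
      (good_pt F v (multiplicity_at F p) \<longleftrightarrow> (\<exists>k. ordinary_simple_multiple_point F k p))"
    if s: "p \<in> singular_points F"
  proof -
    have "m \<ge> 2"
    proof (rule ccontr)
      assume "\<not> m \<ge> 2"
      then have "m = 0 \<or> m = 1" by auto
      moreover have "coeff (LP F u w) 0 = 0" for w using u\<Phi> by (simp add: coeff_0_LP)
      moreover have "coeff (LP F u w) 1 = 0" for w
        using s grad gradient_zero_iff by (simp only: coeff_1_LP)
      ultimately show False using m(2) unfolding is_mult_def by metis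
    qed
    then have "sing_pt F v m" using mv by (simp add: sing_pt_def)
    moreover have "good_pt F v m \<longleftrightarrow> good_pt F u m"
    proof
      assume "good_pt F v m"
      then have "good_pt F ((1 / c) *s v) m" by (rule good_pt_scale[OF hom _ mv, rotated]) (use c(1) in simp)
      then show "good_pt F u m" by (simp only: uv[symmetric])
    qed (simp only: c(2) good_pt_scale[OF hom c(1) m(2)])
    moreover obtain P where P: "local_eq F u = fps_of_poly P" using local_eq_polynomial by blast
    have "good_germ (local_eq F u) m \<longleftrightarrow> (\<exists>k. ordinary_simple_multiple_point F k p)"
      using good_iff_ordinary[OF m(1)[unfolded P]] s
      unfolding P[symmetric] ordinary_simple_multiple_point_def germ_at_def u_def[symmetric] by simp
    ultimately show ?thesis using gm \<open>m \<ge> 2\<close> unfolding mp by auto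
  qed
  show "\<exists>k. smooth_pt F v k \<and> inflection_order F p = int k - 2" if s: "p \<notin> singular_points F"
  proof -
    obtain k where "smooth_pt F u k" "inflection_order F p = int k - 2"
      using inflection_contact[OF hom nl, of p] u0 u\<Phi> s grad unfolding u_def by blast
    then show ?thesis unfolding c(2) using smooth_pt_scale[OF hom c(1)] by blast
  qed
qed

text \<open>Every summand of \<open>hess_identity\<close> contains \<open>F\<close> or a first
  derivative. With the corresponding fact for flexes, this shows that a contributing point cannot
  lie on a line at infinity where the Hessian is nonzero on the curve.\<close>

lemma hess_zero_sing:
  assumes hom: "homogeneous d F" and s: "sing_pt F v m" and det: "det3 v w u \<noteq> 0"
  shows "value_at (hessP F) v = 0"
proof -
  have z: "coeff (LP F v x) j = 0" if "j < 2" for x j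
    using s that by (auto simp: sing_pt_def is_mult_def)
  have "value_at F v = 0" using z[of 0] by (simp add: coeff_0_LP)
  moreover have "value_at (dird x F) v = 0" for x using z[of 1 x] by (simp only: coeff_1_LP)
  ultimately show ?thesis using hess_identity[OF hom, of v w u] det by simp
qed

text \<open>Use \<open>hess_identity\<close> with w tangent: \<open>F\<close>, the first and the
  second derivative along w vanish, and every summand contains one of them.\<close>

lemma hess_zero_flex:
  assumes hom: "homogeneous d F" and s: "smooth_pt F v k" and k: "k \<ge> 3" and det: "det3 v a b \<noteq> 0"
  shows "value_at (hessP F) v = 0"
proof -
  define x where "x = value_at (dird b F) v"
  define y where "y = value_at (dird a F) v"
  have v0: "value_at F v = 0" using s by (simp add: smooth_pt_def)
  have "x \<noteq> 0 \<or> y \<noteq> 0"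
  proof (rule ccontr)
    assume n: "\<not> ?thesis"
    obtain u where u: "value_at (dird u F) v \<noteq> 0" using s by (auto simp: smooth_pt_def)
    obtain r s t where "u = r *s v + s *s a + t *s b" using basis3[OF det] by blast
    then have "u = 1 *s (r *s v + s *s a) + t *s b" by simp
    then have "value_at (dird u F) v = 1 * (r * value_at (dird v F) v + s * y) + t * x"
      by (simp only: dird_lin x_def y_def)
    then show False using u n euler[OF hom, of v] v0 by simp
  qed
  \<comment> \<open>The combination of a and b along which the first derivative cancels.\<close>
  define w where "w = x *s a + (- y) *s b"
  have "\<exists>u. det3 v w u \<noteq> 0"
  proof (cases "x = 0")
    case True
    then have "det3 v w a = y * det3 v a b" by (simp add: w_def det3_def algebra_simps)
    then show ?thesis using True \<open>x \<noteq> 0 \<or> y \<noteq> 0\<close> det by (intro exI[of _ a]) simp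
  next
    case False
    have "det3 v w b = x * det3 v a b" by (simp add: w_def det3_def algebra_simps)
    then show ?thesis using False det by (intro exI[of _ b]) simp
  qed
  then obtain u where du: "det3 v w u \<noteq> 0" by blast
  have w1: "value_at (dird w F) v = 0" unfolding w_def dird_lin by (simp add: x_def y_def)
  have "\<forall>j<k. coeff (LP F v w) j = 0"
    using s w1 det3_not_multiple[OF du] unfolding smooth_pt_def by blast
  then have "coeff (LP F v w) 2 = 0" using k by simp
  then have "poly (pderiv (pderiv (LP F v w))) 0 = 0"
    by (simp add: poly_0_coeff_0 coeff_pderiv numeral_2_eq_2)
  then have "hq F v w w = 0" by (simp add: pderiv_LP poly_LP hq_def)
  then show ?thesis using hess_identity[OF hom, of v w u] du v0 w1 by simp
qed

section \<open>Choice of the centre of projection\<close>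

lemma poly_on_lines_value_at: "poly_on_lines (value_at F)"
  unfolding poly_on_lines_def by (metis poly_LP)

lemma poly_on_lines_coeff_LP: "poly_on_lines (\<lambda>w. coeff (LP F v w) k)"
  unfolding poly_on_lines_def
proof (intro allI)
  fix a b
  show "\<exists>p. \<forall>x. coeff (LP F v (a + x *s b)) k = poly p x"
    using coeff_LPP[of F v 0 a b k] by (intro exI[of _ "coeff (LPP F v 0 a b) k"]) simp
qed

lemma poly_on_lines_det3: "poly_on_lines (\<lambda>q. det3 q u w)"
  unfolding poly_on_lines_def
proof (intro allI)
  fix a b
  have "det3 (a + x *s b) u w = poly [:det3 a u w, det3 b u w:] x" for x
    by (simp add: det3_def algebra_simps)
  then show "\<exists>p. \<forall>x. det3 (a + x *s b) u w = poly p x" by blast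
qed

lemma det3_complete:
  assumes "u \<noteq> 0" "w \<noteq> 0" "\<nexists>c. u = c *s w"
  shows "\<exists>q. det3 q u w \<noteq> 0"
proof (rule ccontr)
  assume "\<not> ?thesis"
  then have z: "det3 q u w = 0" for q by blast
  have m: "u $ 2 * w $ 3 = u $ 3 * w $ 2" "u $ 1 * w $ 3 = u $ 3 * w $ 1" "u $ 1 * w $ 2 = u $ 2 * w $ 1"
    using z[of "vector [1, 0, 0]"] z[of "vector [0, 1, 0]"] z[of "vector [0, 0, 1]"] by (simp_all add: det3_def)
  consider "w $ 1 \<noteq> 0" | "w $ 2 \<noteq> 0" | "w $ 3 \<noteq> 0" using assms(2) by (auto simp: vec_eq_iff forall_3)
  then have "\<exists>c. u = c *s w"
  proof cases
    case 1
    then show ?thesis using m by (intro exI[of _ "u $ 1 / w $ 1"]) (simp add: vec_eq_iff forall_3 field_simps)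
  next
    case 2
    then show ?thesis using m by (intro exI[of _ "u $ 2 / w $ 2"]) (simp add: vec_eq_iff forall_3 field_simps)
  next
    case 3
    then show ?thesis using m by (intro exI[of _ "u $ 3 / w $ 3"]) (simp add: vec_eq_iff forall_3 field_simps)
  qed
  then show False using assms(3) by blast
qed

lemma exists_not_multiple: "\<exists>e. e \<noteq> 0 \<and> (\<nexists>c. e = c *s (w :: complex ^ 3))"
proof (rule ccontr)
  assume "\<not> ?thesis"
  then have m: "\<And>e. e \<noteq> 0 \<Longrightarrow> \<exists>c. e = c *s w" by blast
  have "vector [1, 0, 0] \<noteq> (0 :: complex ^ 3)" "vector [0, 1, 0] \<noteq> (0 :: complex ^ 3)"
    by (simp_all add: vec_eq_iff forall_3)
  then obtain a b where ab: "vector [1, 0, 0] = a *s w" "vector [0, 1, 0] = b *s w" using m by metis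
  have "1 = a * w $ 1" "0 = a * w $ 2" "1 = b * w $ 2"
    using arg_cong[OF ab(1), of "\<lambda>x. x $ 1"] arg_cong[OF ab(1), of "\<lambda>x. x $ 2"] arg_cong[OF ab(2), of "\<lambda>x. x $ 2"]
    by simp_all
  then show False by auto
qed

text \<open>Let E be the degree of s and t its reversal, which has degree E since s does not vanish
  at 0. Then $x^E r = x^D t$, and degrees are compared.\<close>

lemma degree_from_reversal:
  fixes r s :: "complex poly"
  assumes e: "\<And>x. x \<noteq> 0 \<Longrightarrow> poly r x = x ^ D * poly s (1 / x)" and s0: "poly s 0 \<noteq> 0"
  shows "degree r = D"
proof -
  define E where "E = degree s"
  define t where "t = (\<Sum>k\<le>E. monom (coeff s k) (E - k))"
  have "monom 1 E * r = monom 1 D * t"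
  proof (rule poly_eqI_nonzero)
    fix x :: complex assume x: "x \<noteq> 0"
    have "poly t x = (\<Sum>k\<le>E. x ^ E * (coeff s k * (1 / x) ^ k))"
      unfolding t_def poly_sum poly_monom using x
      by (intro sum.cong) (auto simp: power_divide power_diff)
    also have "\<dots> = x ^ E * poly s (1 / x)"
      by (simp add: sum_distrib_left E_def poly_as_sum_le[OF order_refl])
    finally show "poly (monom 1 E * r) x = poly (monom 1 D * t) x"
      by (simp add: poly_monom e[OF x])
  qed
  moreover have "coeff t E = coeff s 0"
  proof -
    have "coeff t E = (\<Sum>k\<le>E. if k = 0 then coeff s 0 else 0)"
      unfolding t_def coeff_sum by (intro sum.cong) auto
    then show ?thesis by simp
  qed
  then have tE: "coeff t E \<noteq> 0" using s0 by (simp add: poly_0_coeff_0)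
  then have t0: "t \<noteq> 0" by auto
  have "degree t \<le> E" unfolding t_def
    by (intro degree_sum_le) (auto intro: order_trans[OF degree_monom_le])
  then have "degree t = E" using le_degree[OF tE] by simp
  moreover have "r \<noteq> 0" using calculation(1) t0 by auto
  ultimately show ?thesis
    using t0 degree_mult_eq[of "monom 1 E" r] degree_mult_eq[of "monom 1 D" t]
    by (simp add: degree_monom_eq)
qed

lemma LP_factors:
  assumes hom: "homogeneous d F" and p: "value_at F p \<noteq> 0"
  shows "\<exists>z. LP F v p = smult (value_at F p) (\<Prod>i<d. [:- z i, 1:])"
proof -
  have c: "coeff (LP F v p) d = value_at F p" by (rule coeff_LP_degree[OF hom])
  then have "degree (LP F v p) = d"
    using degree_LP_le[OF hom, of v p] le_degree[of "LP F v p" d] p by simp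
  then show ?thesis using complex_poly_factors[of "LP F v p" d] c by auto
qed

lemma hess_norm:
  assumes hom: "homogeneous d F" and p: "value_at F p \<noteq> 0"
  shows "\<exists>r. \<forall>x z. LP F (q + x *s e) p = smult (value_at F p) (\<Prod>i<d. [:- z i, 1:]) \<longrightarrow>
     poly r x = (\<Prod>i<d. value_at (hessP F) (q + x *s e + z i *s p))"
  using norm_polynomial[OF p, where P = "LPP F q e p 0" and Q = "LPP (hessP F) q e p 0" and d = d]
  by (simp add: map_poly_LPP poly_LP)

lemma inverse_Suc_tendsto: "(\<lambda>n. 1 / of_nat (Suc n) :: complex) \<longlonglongrightarrow> 0"
  using LIMSEQ_inverse_real_of_nat[THEN tendsto_of_real[where 'a = complex]]
  by (simp add: inverse_eq_divide)

text \<open>At smooth points of the curve the inflection order is nonnegative, so \<open>nat\<close>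
  loses nothing there.\<close>

definition contribution :: "poly3 \<Rightarrow> (complex ^ 3) set \<Rightarrow> nat" where
  "contribution F p = (if p \<in> singular_points F then 3 * multiplicity_at F p * (multiplicity_at F p - 1)
     else nat (inflection_order F p))"

text \<open>Here e and p span the line at infinity. To find it, take a line through p that misses
  all singular points. On it \<open>local_limit\<close> has a nonzero limit, so on some nearby line
  through p the Hessian is nonzero at all points of the curve. In this way the Hessian is never
  shown separately to be nonzero on each component.\<close>

lemma general_projection:
  assumes hom: "homogeneous d F" and d: "d \<ge> 2" and F: "F \<noteq> 0"
    and nl: "\<And>G. is_component G F \<Longrightarrow> \<not> is_line G" and fin: "finite (singular_points F)"
  obtains q e p where "det3 q e p \<noteq> 0" "value_at F p \<noteq> 0"
    "\<And>s v. s \<in> singular_points F \<Longrightarrow> v \<in> s \<Longrightarrow> coeff (LP F v p) (multiplicity_at F s) \<noteq> 0"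
    "\<And>x. value_at F (e + x *s p) = 0 \<Longrightarrow> value_at (hessP F) (e + x *s p) \<noteq> 0"
proof -
  define S where "S = singular_points F"
  have S: "s \<in> curve_points F" "s \<in> proj_plane" if "s \<in> S" for s
    using that by (auto simp: S_def singular_points_def curve_points_def)
  have ms: "sing_pt F v (multiplicity_at F s)" if "s \<in> S" "v \<in> s" for s v
    using point_type(1)[OF hom F nl S(1)[OF that(1)] that(2)] that by (simp add: S_def)
  have "\<exists>p. \<forall>f\<in>insert (value_at F) ((\<lambda>s w. coeff (LP F (coords s) w) (multiplicity_at F s)) ` S). f p \<noteq> 0"
  proof (rule general_point)
    show "finite (insert (value_at F) ((\<lambda>s w. coeff (LP F (coords s) w) (multiplicity_at F s)) ` S))"
      using fin by (simp add: S_def)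
    fix f assume f: "f \<in> insert (value_at F) ((\<lambda>s w. coeff (LP F (coords s) w) (multiplicity_at F s)) ` S)"
    then show "poly_on_lines f" by (auto intro: poly_on_lines_value_at poly_on_lines_coeff_LP)
    show "\<exists>v. f v \<noteq> 0"
    proof (cases "f = value_at F")
      case True
      then show ?thesis using value_at_zero F by blast
    next
      case False
      then obtain s where s: "s \<in> S" "f = (\<lambda>w. coeff (LP F (coords s) w) (multiplicity_at F s))" using f by blast
      have "sing_pt F (coords s) (multiplicity_at F s)" using ms[OF s(1) coords_mem[OF S(2)[OF s(1)]]] .
      then show ?thesis unfolding s(2) sing_pt_def is_mult_def by blast
    qed
  qed
  then obtain p where p: "value_at F p \<noteq> 0" and ps: "\<And>s. s \<in> S \<Longrightarrow> coeff (LP F (coords s) p) (multiplicity_at F s) \<noteq> 0"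
    by auto
  have p0: "p \<noteq> 0"
    using p value_at_scale[OF hom, of 0 p] d by (auto simp: power_0_left)
  have psv: "coeff (LP F v p) (multiplicity_at F s) \<noteq> 0" if sS: "s \<in> S" and vs: "v \<in> s" for s v
  proof -
    have "coords s \<in> s" by (rule coords_mem[OF S(2)[OF sS]])
    then have "is_mult F (coords s) (multiplicity_at F s)" using ms[OF sS] by (simp add: sing_pt_def)
    moreover obtain c where "c \<noteq> 0" "v = c *s coords s" using plane_coords[OF S(2)[OF sS] vs] by blast
    ultimately show ?thesis
      using LP_scale(2)[OF hom, where k = "multiplicity_at F s" and v = "coords s" and w = p and c = c] ps[OF sS]
      by (simp add: is_mult_def)
  qed
  obtain e0 where e0: "e0 \<noteq> 0" "\<nexists>c. e0 = c *s p" using exists_not_multiple by blast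
  \<comment> \<open>The line through q0 and p is to avoid the singular points, and q0, e0, p are to
    form a basis.\<close>
  have "\<exists>q. \<forall>f\<in>insert (\<lambda>q. det3 q e0 p) ((\<lambda>s q. det3 q (coords s) p) ` S). f q \<noteq> 0"
  proof (rule general_point)
    show "finite (insert (\<lambda>q. det3 q e0 p) ((\<lambda>s q. det3 q (coords s) p) ` S))" using fin by (simp add: S_def)
    fix f assume f: "f \<in> insert (\<lambda>q. det3 q e0 p) ((\<lambda>s q. det3 q (coords s) p) ` S)"
    then show "poly_on_lines f" by (auto intro: poly_on_lines_det3)
    have "\<exists>q. det3 q (coords s) p \<noteq> 0" if s: "s \<in> S" for s
    proof (rule det3_complete[OF _ p0])
      have c: "coords s \<in> s" by (rule coords_mem[OF S(2)[OF s]])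
      show "coords s \<noteq> 0" by (rule plane_point(1)[OF S(2)[OF s] c])
      have z: "value_at F (coords s) = 0" using S(1)[OF s] c by (simp add: curve_points_def)
      show "\<nexists>c. coords s = c *s p"
      proof
        assume "\<exists>c. coords s = c *s p"
        then obtain a where a: "coords s = a *s p" ..
        then have "a = 0" using z p by (simp add: value_at_scale[OF hom])
        then show False using a \<open>coords s \<noteq> 0\<close> by simp
      qed
    qed
    then show "\<exists>v. f v \<noteq> 0" using f det3_complete[OF e0(1) p0 e0(2)] by blast
  qed
  then obtain q0 where q0: "det3 q0 e0 p \<noteq> 0" and q0s: "\<And>s. s \<in> S \<Longrightarrow> det3 q0 (coords s) p \<noteq> 0" by auto
  define \<tau> where "\<tau> = (\<lambda>n. 1 / of_nat (Suc n) :: complex)"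
  have \<tau>: "\<tau> \<longlonglongrightarrow> 0" "\<And>n. \<tau> n \<noteq> 0"
    using inverse_Suc_tendsto by (auto simp: \<tau>_def of_nat_eq_0_iff simp del: of_nat_Suc)
  obtain Z where Z: "\<And>v. LP F v p = smult (value_at F p) (\<Prod>i<d. [:- Z v i, 1:])"
    using LP_factors[OF hom p] by metis
  have sm: "\<exists>k. smooth_pt F (q0 + x *s p) k \<and> inflection_order F (point (q0 + x *s p)) = int k - 2"
    if x: "value_at F (q0 + x *s p) = 0" for x
  proof -
    have n0: "q0 + x *s p \<noteq> 0"
    proof
      assume "q0 + x *s p = 0"
      then have "det3 (q0 + x *s p) e0 p = 0" by (simp add: det3_def)
      then show False using q0 by (simp add: det3_def algebra_simps)
    qed
    have c: "point (q0 + x *s p) \<in> curve_points F" using curve_points_iff[OF hom n0] x by simp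
    have "point (q0 + x *s p) \<notin> S"
    proof
      assume s: "point (q0 + x *s p) \<in> S"
      obtain a where "q0 + x *s p = a *s coords (point (q0 + x *s p))"
        using plane_coords[OF S(2)[OF s] self_mem_point[OF n0]] by blast
      then have "det3 (q0 + x *s p) (coords (point (q0 + x *s p))) p = det3 (a *s coords (point (q0 + x *s p))) (coords (point (q0 + x *s p))) p"
        by simp
      also have "\<dots> = 0" by (simp add: det3_def algebra_simps)
      finally show False using q0s[OF s] by (simp add: det3_def algebra_simps)
    qed
    then show ?thesis using point_type(2)[OF hom F nl c self_mem_point[OF n0]] by (simp add: S_def)
  qed
  define cf where "cf = (\<lambda>x. nat (inflection_order F (point (q0 + x *s p))))"
  have "\<exists>\<sigma> L. strict_mono \<sigma> \<and>
     (\<lambda>n. norm (\<Prod>i<d. value_at (hessP F) (q0 + \<tau> (\<sigma> n) *s e0 + Z (q0 + \<tau> (\<sigma> n) *s e0) i *s p))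
        / norm (\<tau> (\<sigma> n)) ^ (\<Sum>x | value_at F (q0 + x *s p) = 0. cf x)) \<longlonglongrightarrow> L \<and>
     (L \<noteq> 0 \<longleftrightarrow> (\<forall>x m. value_at F (q0 + x *s p) = 0 \<longrightarrow> sing_pt F (q0 + x *s p) m \<longrightarrow> good_pt F (q0 + x *s p) m))"
  proof (rule local_limit[OF hom d q0 p _ \<tau> Z])
    fix x assume "value_at F (q0 + x *s p) = 0"
    then obtain k where k: "smooth_pt F (q0 + x *s p) k" "inflection_order F (point (q0 + x *s p)) = int k - 2"
      using sm by blast
    then have "cf x = k - 2" by (simp add: cf_def)
    then show "(\<exists>m. sing_pt F (q0 + x *s p) m \<and> coeff (LP F (q0 + x *s p) p) m \<noteq> 0 \<and> cf x = 3 * m * (m - 1)) \<or>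
       (\<exists>k. smooth_pt F (q0 + x *s p) k \<and> cf x = k - 2)" using k by blast
  qed
  then obtain \<sigma> L where lim: "(\<lambda>n. norm (\<Prod>i<d. value_at (hessP F) (q0 + \<tau> (\<sigma> n) *s e0 + Z (q0 + \<tau> (\<sigma> n) *s e0) i *s p))
        / norm (\<tau> (\<sigma> n)) ^ (\<Sum>x | value_at F (q0 + x *s p) = 0. cf x)) \<longlonglongrightarrow> L" and "L \<noteq> 0"
    using sm sing_not_smooth by blast
  have "\<exists>n. (\<Prod>i<d. value_at (hessP F) (q0 + \<tau> (\<sigma> n) *s e0 + Z (q0 + \<tau> (\<sigma> n) *s e0) i *s p)) \<noteq> 0"
  proof (rule ccontr)
    assume "\<not> ?thesis"
    then have z: "(\<Prod>i<d. value_at (hessP F) (q0 + \<tau> (\<sigma> n) *s e0 + Z (q0 + \<tau> (\<sigma> n) *s e0) i *s p)) = 0" for n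
      by blast
    have "(\<lambda>n. 0) \<longlonglongrightarrow> L" using lim unfolding z by simp
    then show False using \<open>L \<noteq> 0\<close> by (simp add: LIMSEQ_const_iff)
  qed
  then obtain n where n: "(\<Prod>i<d. value_at (hessP F) (q0 + \<tau> (\<sigma> n) *s e0 + Z (q0 + \<tau> (\<sigma> n) *s e0) i *s p)) \<noteq> 0" by blast
  \<comment> \<open>The nearby line becomes the line at infinity; \<open>e0\<close> completes e and
    p to a basis.\<close>
  define e where "e = q0 + \<tau> (\<sigma> n) *s e0"
  show ?thesis
  proof (rule that[of e0 e p])
    have "det3 e0 e p = - det3 q0 e0 p" by (simp add: e_def det3_def algebra_simps)
    then show "det3 e0 e p \<noteq> 0" using q0 by simp
    show "coeff (LP F v p) (multiplicity_at F s) \<noteq> 0" if "s \<in> singular_points F" "v \<in> s" for s v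
      using psv that by (simp add: S_def)
    show "value_at (hessP F) (e + x *s p) \<noteq> 0" if x: "value_at F (e + x *s p) = 0" for x
    proof -
      have "poly (LP F e p) x = 0" using x by (simp add: poly_LP)
      then obtain i where "i < d" "x = Z e i" unfolding Z[of e] using p by (auto simp: poly_prod)
      then show ?thesis using n unfolding e_def by (auto simp: prod_zero_iff)
    qed
  qed (rule p)
qed

section \<open>The inflection formula\<close>

text \<open>Scale \<open>q + x *s e\<close> by 1/x to get \<open>e + (1 / x) *s q\<close>. The roots
  scale as well, and each of the d values of the Hessian gives a factor $x^{3(d-2)}$. So r is the
  reversal of the norm s formed around the line at infinity, and s does not vanish at 0 by the
  choice of this line.\<close>

lemma degree_hess_norm:
  assumes hom: "homogeneous d F" and p: "value_at F p \<noteq> 0"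
    and r: "\<And>x z. LP F (q + x *s e) p = smult (value_at F p) (\<Prod>i<d. [:- z i, 1:]) \<Longrightarrow>
       poly r x = (\<Prod>i<d. value_at (hessP F) (q + x *s e + z i *s p))"
    and inf: "\<And>x. value_at F (e + x *s p) = 0 \<Longrightarrow> value_at (hessP F) (e + x *s p) \<noteq> 0"
  shows "degree r = d * (3 * (d - 2))"
proof -
  obtain Z where Z: "\<And>v. LP F v p = smult (value_at F p) (\<Prod>i<d. [:- Z v i, 1:])"
    using LP_factors[OF hom p] by metis
  obtain s where s: "\<And>x z. LP F (e + x *s q) p = smult (value_at F p) (\<Prod>i<d. [:- z i, 1:]) \<Longrightarrow>
       poly s x = (\<Prod>i<d. value_at (hessP F) (e + x *s q + z i *s p))"
    using hess_norm[OF hom p, of e q] by blast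
  show ?thesis
  proof (rule degree_from_reversal)
    fix x :: complex assume x: "x \<noteq> 0"
    define v where "v = e + (1 / x) *s q"
    have xv: "x *s (v + y *s p) = q + x *s e + (x * y) *s p" for y
      using x by (simp add: v_def vec_eq_iff algebra_simps)
    have "LP F (q + x *s e) p = smult (value_at F p) (\<Prod>i<d. [:- (x * Z v i), 1:])"
    proof (rule poly_eqI_nonzero)
      fix y :: complex
      have "poly (LP F (q + x *s e) p) y = value_at F (x *s (v + (y / x) *s p))"
        unfolding xv using x by (simp add: poly_LP)
      also have "\<dots> = x ^ d * poly (LP F v p) (y / x)" by (simp only: value_at_scale[OF hom] poly_LP)
      also have "\<dots> = value_at F p * (x ^ d * (\<Prod>i<d. y / x - Z v i))" unfolding Z[of v] by (simp add: poly_prod)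
      also have "x ^ d * (\<Prod>i<d. y / x - Z v i) = (\<Prod>i<d. x * (y / x - Z v i))" by (simp add: prod.distrib)
      also have "\<dots> = (\<Prod>i<d. y - x * Z v i)" using x by (intro prod.cong) (auto simp: field_simps)
      finally show "poly (LP F (q + x *s e) p) y = poly (smult (value_at F p) (\<Prod>i<d. [:- (x * Z v i), 1:])) y"
        by (simp add: poly_prod)
    qed
    then have "poly r x = (\<Prod>i<d. value_at (hessP F) (x *s (v + Z v i *s p)))" unfolding xv by (rule r)
    also have "\<dots> = (\<Prod>i<d. x ^ (3 * (d - 2)) * value_at (hessP F) (v + Z v i *s p))"
      by (simp only: hessP_scale[OF hom])
    also have "\<dots> = x ^ (d * (3 * (d - 2))) * (\<Prod>i<d. value_at (hessP F) (v + Z v i *s p))"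
      by (simp add: prod.distrib mult.commute flip: power_mult)
    also have "(\<Prod>i<d. value_at (hessP F) (v + Z v i *s p)) = poly s (1 / x)"
      using s[of "1 / x" "Z v"] Z[of v] by (simp add: v_def)
    finally show "poly r x = x ^ (d * (3 * (d - 2))) * poly s (1 / x)" .
  next
    have "poly s 0 = (\<Prod>i<d. value_at (hessP F) (e + Z e i *s p))" using s[of 0 "Z e"] Z[of e] by simp
    moreover have "value_at F (e + Z e i *s p) = 0" if "i < d" for i
    proof -
      have "value_at F (e + Z e i *s p) = poly (LP F e p) (Z e i)" by (simp add: poly_LP)
      also have "\<dots> = 0" unfolding Z[of e] using that by (auto simp: poly_prod intro!: prod_zero)
      finally show ?thesis .
    qed
    ultimately show "poly s 0 \<noteq> 0" using inf by auto
  qed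
qed

lemma sum_orders:
  fixes r :: "complex poly"
  assumes "r \<noteq> 0"
  shows "(\<Sum>x | poly r x = 0. order x r) = degree r"
proof -
  have "degree r = (\<Sum>x\<in>set_mset (proots r). count (proots r) x)"
    by (simp add: size_proots_complex[symmetric] size_multiset_overloaded_eq)
  then show ?thesis using assms by simp
qed

text \<open>The contributions of the points on the line with parameter x sum to at most the order of
  r at x, with equality iff the singular points on this line are good. Summing over the zeros of r
  gives its degree, and equality of the sums forces equality on every line.\<close>

lemma inflection_formula:
  assumes hom: "homogeneous d F" and d: "d \<ge> 3" and F: "F \<noteq> 0"
    and nl: "\<And>G. is_component G F \<Longrightarrow> \<not> is_line G" and fin: "finite (singular_points F)"
  defines "A \<equiv> {s \<in> curve_points F. contribution F s > 0}"
  shows "finite A" "(\<Sum>s\<in>A. contribution F s) \<le> d * (3 * (d - 2))"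
    "(\<Sum>s\<in>A. contribution F s) = d * (3 * (d - 2)) \<longleftrightarrow>
       (\<forall>s\<in>singular_points F. \<exists>k. ordinary_simple_multiple_point F k s)"
proof -
  have d2: "d \<ge> 2" using d by simp
  obtain q e p where det: "det3 q e p \<noteq> 0" and p: "value_at F p \<noteq> 0"
    and ps: "\<And>s v. s \<in> singular_points F \<Longrightarrow> v \<in> s \<Longrightarrow> coeff (LP F v p) (multiplicity_at F s) \<noteq> 0"
    and inf: "\<And>x. value_at F (e + x *s p) = 0 \<Longrightarrow> value_at (hessP F) (e + x *s p) \<noteq> 0"
    using general_projection[OF hom d2 F nl fin] by blast
  obtain r where r: "\<And>x z. LP F (q + x *s e) p = smult (value_at F p) (\<Prod>i<d. [:- z i, 1:]) \<Longrightarrow>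
       poly r x = (\<Prod>i<d. value_at (hessP F) (q + x *s e + z i *s p))"
    using hess_norm[OF hom p, of q e] by blast
  obtain Z where Z: "\<And>v. LP F v p = smult (value_at F p) (\<Prod>i<d. [:- Z v i, 1:])"
    using LP_factors[OF hom p] by metis
  have deg: "degree r = d * (3 * (d - 2))" by (rule degree_hess_norm[OF hom p r inf])
  define v where "v = (\<lambda>x y. q + x *s e + y *s p)"
  have v0: "v x y \<noteq> 0" for x y
  proof
    assume "v x y = 0"
    then have "det3 (v x y) e p = 0" by (simp add: det3_def)
    then show False using det by (simp add: v_def det3_def algebra_simps)
  qed
  have r0: "r \<noteq> 0" using deg d by auto
  define pts where "pts = (\<lambda>x. {y. value_at F (v x y) = 0})"
  have finpts: "finite (pts x)" for x
  proof -
    have "pts x = {y. poly (LP F (q + x *s e) p) y = 0}" by (simp add: pts_def v_def poly_LP)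
    moreover have "LP F (q + x *s e) p \<noteq> 0" using coeff_LP_degree[OF hom, of "q + x *s e" p] p by auto
    ultimately show ?thesis using poly_roots_finite by simp
  qed
  have curve: "point (v x y) \<in> curve_points F" if "y \<in> pts x" for x y
    using curve_points_iff[OF hom v0] that by (simp add: pts_def)
  define cf where "cf = (\<lambda>x y. contribution F (point (v x y)))"
  have ptype: "(\<exists>m. sing_pt F (v x y) m \<and> coeff (LP F (v x y) p) m \<noteq> 0 \<and> cf x y = 3 * m * (m - 1)) \<or>
       (\<exists>k. smooth_pt F (v x y) k \<and> cf x y = k - 2)" if y: "y \<in> pts x" for x y
  proof (cases "point (v x y) \<in> singular_points F")
    case True
    then show ?thesis
      using point_type(1)[OF hom F nl curve[OF y] self_mem_point[OF v0] True] ps[OF True self_mem_point[OF v0]]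
      by (intro disjI1 exI[of _ "multiplicity_at F (point (v x y))"]) (simp add: cf_def contribution_def)
  next
    case False
    obtain k where "smooth_pt F (v x y) k" "inflection_order F (point (v x y)) = int k - 2"
      using point_type(2)[OF hom F nl curve[OF y] self_mem_point[OF v0] False] by blast
    then show ?thesis using False by (intro disjI2 exI[of _ k]) (auto simp: cf_def contribution_def)
  qed
  define S where "S = (\<lambda>x. \<Sum>y\<in>pts x. cf x y)"
  define good where "good = (\<lambda>x. \<forall>y\<in>pts x. \<forall>m. sing_pt F (v x y) m \<longrightarrow> good_pt F (v x y) m)"
  \<comment> \<open>Approach the line of parameter x through the parameters x + 1/(n + 1); the limit
    of the product of Hessian values gives the order of r at x.\<close>
  have loc: "S x \<le> order x r \<and> (order x r = S x \<longleftrightarrow> good x)" for x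
  proof -
    define \<tau> where "\<tau> = (\<lambda>n. 1 / of_nat (Suc n) :: complex)"
    have \<tau>: "\<tau> \<longlonglongrightarrow> 0" "\<And>n. \<tau> n \<noteq> 0"
      using inverse_Suc_tendsto by (auto simp: \<tau>_def of_nat_eq_0_iff simp del: of_nat_Suc)
    have det': "det3 (q + x *s e) e p \<noteq> 0" using det by (simp add: det3_def algebra_simps)
    have "\<exists>\<sigma> L. strict_mono \<sigma> \<and>
     (\<lambda>n. norm (\<Prod>i<d. value_at (hessP F) (q + x *s e + \<tau> (\<sigma> n) *s e + Z (q + x *s e + \<tau> (\<sigma> n) *s e) i *s p))
        / norm (\<tau> (\<sigma> n)) ^ (\<Sum>y | value_at F (q + x *s e + y *s p) = 0. cf x y)) \<longlonglongrightarrow> L \<and>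
     (L \<noteq> 0 \<longleftrightarrow> (\<forall>y m. value_at F (q + x *s e + y *s p) = 0 \<longrightarrow> sing_pt F (q + x *s e + y *s p) m \<longrightarrow> good_pt F (q + x *s e + y *s p) m))"
      by (rule local_limit[OF hom d2 det' p _ \<tau> Z]) (use ptype in \<open>simp add: pts_def v_def\<close>)
    then obtain \<sigma> L where \<sigma>: "strict_mono \<sigma>" and
      lim: "(\<lambda>n. norm (\<Prod>i<d. value_at (hessP F) (q + x *s e + \<tau> (\<sigma> n) *s e + Z (q + x *s e + \<tau> (\<sigma> n) *s e) i *s p))
        / norm (\<tau> (\<sigma> n)) ^ S x) \<longlonglongrightarrow> L" and L: "L \<noteq> 0 \<longleftrightarrow> good x"
      unfolding S_def good_def pts_def v_def by auto
    have xe: "q + x *s e + t *s e = q + (x + t) *s e" for t by (simp add: vec_eq_iff algebra_simps)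
    have "(\<lambda>n. norm (poly r (x + \<tau> (\<sigma> n))) / norm (\<tau> (\<sigma> n)) ^ S x) \<longlonglongrightarrow> L"
      using lim unfolding xe r[OF Z] .
    moreover have "(\<lambda>n. \<tau> (\<sigma> n)) \<longlonglongrightarrow> 0" using LIMSEQ_subseq_LIMSEQ[OF \<tau>(1) \<sigma>] by (simp add: o_def)
    ultimately show ?thesis
      using order_from_limit[OF r0, of "\<lambda>n. \<tau> (\<sigma> n)" x "S x" L] \<tau>(2) L by blast
  qed
  define X where "X = {x. poly r x = 0}"
  have finX: "finite X" unfolding X_def by (rule poly_roots_finite[OF r0])
  have SX: "S x = 0" if "x \<notin> X" for x
    using loc[of x] that order_root[of r x] by (simp add: X_def)
  \<comment> \<open>A contributing point is a zero of the Hessian, so it does not lie on the line a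
    = 0 at infinity. There b is nonzero because p is not on the curve, and \<open>inf\<close>
    excludes such zeros.\<close>
  have onchart: "\<exists>x y. y \<in> pts x \<and> s = point (v x y)" if s: "s \<in> curve_points F" "contribution F s > 0" for s
  proof -
    have sp: "s \<in> proj_plane" using s by (simp add: curve_points_def)
    define u where "u = coords s"
    have us: "u \<in> s" unfolding u_def by (rule coords_mem[OF sp])
    have u0: "u \<noteq> 0" and su: "s = point u" using plane_point[OF sp us] by auto
    have uz: "value_at F u = 0" using s(1) us by (simp add: curve_points_def)
    obtain a b c where u: "u = a *s q + b *s e + c *s p" using basis3[OF det] by blast
    show ?thesis
    proof (cases "a = 0")
      case False
      have uv: "u = a *s v (b / a) (c / a)" using False by (simp add: u v_def vec_eq_iff field_simps)
      then have "value_at F (v (b / a) (c / a)) = 0" using uz False by (simp add: value_at_scale[OF hom])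
      moreover have "s = point (v (b / a) (c / a))" unfolding su uv by (rule point_scale[OF False])
      ultimately show ?thesis by (auto simp: pts_def)
    next
      case True
      have b: "b \<noteq> 0"
      proof
        assume "b = 0"
        then have uc: "u = c *s p" using True u by simp
        then have "c = 0" using uz p by (simp add: value_at_scale[OF hom])
        then show False using u0 uc by simp
      qed
      define w where "w = e + (c / b) *s p"
      have uw: "u = b *s w" using True b by (simp add: u w_def vec_eq_iff field_simps)
      have wz: "value_at F w = 0" using uz b unfolding uw by (simp add: value_at_scale[OF hom])
      have w0: "w \<noteq> 0" using uw u0 by auto
      have sw: "s = point w" unfolding su uw by (rule point_scale[OF b])
      have ws: "w \<in> s" unfolding sw by (rule self_mem_point[OF w0])
      have detw: "det3 w q p \<noteq> 0" using det by (simp add: w_def det3_def algebra_simps)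
      have "value_at (hessP F) w = 0"
      proof (cases "s \<in> singular_points F")
        case True
        then have "sing_pt F w (multiplicity_at F s)" using point_type(1)[OF hom F nl s(1) ws] by blast
        then show ?thesis using hess_zero_sing[OF hom _ detw] by blast
      next
        case False
        obtain k where k: "smooth_pt F w k" "inflection_order F s = int k - 2"
          using point_type(2)[OF hom F nl s(1) ws False] by blast
        then have "k \<ge> 3" using s(2) False by (simp add: contribution_def)
        then show ?thesis using hess_zero_flex[OF hom k(1) _ detw] by blast
      qed
      then show ?thesis using inf[of "c / b"] wz by (simp add: w_def)
    qed
  qed
  \<comment> \<open>The pairs (x, y) are affine coordinates on the complement of the line through e
    and p, hence f is injective.\<close>
  define f where "f = (\<lambda>(x, y). point (v x y))"
  have inj: "inj_on f U" for U
  proof (rule inj_onI)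
    fix z z' assume "f z = f z'"
    obtain x y x' y' where zz: "z = (x, y)" "z' = (x', y')" by (cases z, cases z')
    have "v x' y' \<in> point (v x y)" using \<open>f z = f z'\<close> zz self_mem_point[OF v0] by (simp add: f_def)
    then obtain c where c: "v x' y' = c *s v x y" using mem_point[OF v0] by blast
    have "det3 (v x' y') e p = c * det3 (v x y) e p" unfolding c by (simp add: det3_def algebra_simps)
    moreover have "det3 (v a b) e p = det3 q e p" for a b by (simp add: v_def det3_def algebra_simps)
    ultimately have "c = 1" using det by simp
    then have vv: "v x' y' = v x y" using c by simp
    have "det3 q (v x' y') p = det3 q (v x y) p" "det3 q e (v x' y') = det3 q e (v x y)" using vv by simp_all
    moreover have "det3 q (v a b) p = a * det3 q e p" "det3 q e (v a b) = b * det3 q e p" for a b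
      by (simp_all add: v_def det3_def algebra_simps)
    ultimately show "z = z'" using det zz by simp
  qed
  define U where "U = (SIGMA x:X. pts x)"
  have finU: "finite U" unfolding U_def using finX finpts by blast
  have AU: "A \<subseteq> f ` U"
  proof
    fix s assume s: "s \<in> A"
    then obtain x y where xy: "y \<in> pts x" "s = point (v x y)" using onchart unfolding A_def by blast
    have "cf x y \<le> S x" unfolding S_def using xy(1) finpts by (intro member_le_sum) auto
    then have "x \<in> X" using SX[of x] s xy unfolding A_def cf_def by fastforce
    then show "s \<in> f ` U" using xy unfolding U_def f_def by force
  qed
  show finA: "finite A" using finite_subset[OF AU] finU by blast
  have "(\<Sum>s\<in>A. contribution F s) = (\<Sum>s\<in>f ` U. contribution F s)"
  proof (rule sum.mono_neutral_left)
    show "\<forall>s\<in>f ` U - A. contribution F s = 0"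
      using curve unfolding A_def f_def U_def by auto
  qed (use finU AU in auto)
  also have "\<dots> = (\<Sum>z\<in>U. contribution F (f z))" by (rule sum.reindex_cong[OF inj refl refl])
  also have "\<dots> = (\<Sum>x\<in>X. S x)"
    unfolding U_def S_def cf_def using finX finpts by (subst sum.Sigma) (auto simp: f_def intro!: sum.cong)
  finally have sumS: "(\<Sum>s\<in>A. contribution F s) = (\<Sum>x\<in>X. S x)" .
  have sumD: "(\<Sum>x\<in>X. order x r) = d * (3 * (d - 2))" unfolding X_def sum_orders[OF r0] by (rule deg)
  show "(\<Sum>s\<in>A. contribution F s) \<le> d * (3 * (d - 2))"
    unfolding sumS sumD[symmetric] using loc by (intro sum_mono) auto
  have gd: "good_pt F (v x y) m \<longleftrightarrow> (\<exists>k. ordinary_simple_multiple_point F k (point (v x y)))"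
    if "y \<in> pts x" "point (v x y) \<in> singular_points F" "sing_pt F (v x y) m" for x y m
    using point_type(1)[OF hom F nl curve[OF that(1)] self_mem_point[OF v0] that(2)] sing_pt_unique[OF that(3)] by blast
  show "(\<Sum>s\<in>A. contribution F s) = d * (3 * (d - 2)) \<longleftrightarrow>
       (\<forall>s\<in>singular_points F. \<exists>k. ordinary_simple_multiple_point F k s)"
  proof
    assume eq: "(\<Sum>s\<in>A. contribution F s) = d * (3 * (d - 2))"
    have ord: "order x r = S x" if "x \<in> X" for x
    proof (rule ccontr)
      assume "order x r \<noteq> S x"
      then have "S x < order x r" using loc[of x] by auto
      then have "(\<Sum>x\<in>X. S x) < (\<Sum>x\<in>X. order x r)"
        using loc finX that by (intro sum_strict_mono_ex1) auto
      then show False using eq sumS sumD by simp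
    qed
    show "\<forall>s\<in>singular_points F. \<exists>k. ordinary_simple_multiple_point F k s"
    proof
      fix s assume s: "s \<in> singular_points F"
      have sc: "s \<in> curve_points F" using s by (simp add: singular_points_def)
      have "coords s \<in> s" using coords_mem sc by (simp add: curve_points_def)
      then have "sing_pt F (coords s) (multiplicity_at F s)" using point_type(1)[OF hom F nl sc _ s] by blast
      then have "contribution F s > 0" using s by (simp add: contribution_def sing_pt_def)
      then have "s \<in> A" using sc by (simp add: A_def)
      then obtain x y where xy: "x \<in> X" "y \<in> pts x" "s = point (v x y)" using AU unfolding U_def f_def by auto
      have "sing_pt F (v x y) (multiplicity_at F s)"
        using point_type(1)[OF hom F nl sc _ s] xy(3) self_mem_point[OF v0] by blast
      moreover have "good x" using loc[of x] ord[OF xy(1)] by blast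
      ultimately show "\<exists>k. ordinary_simple_multiple_point F k s"
        using gd[OF xy(2)] s xy unfolding good_def by blast
    qed
  next
    assume all: "\<forall>s\<in>singular_points F. \<exists>k. ordinary_simple_multiple_point F k s"
    have "good x" for x unfolding good_def
    proof (intro ballI allI impI)
      fix y m assume y: "y \<in> pts x" and m: "sing_pt F (v x y) m"
      have "point (v x y) \<in> singular_points F"
        using point_type(2)[OF hom F nl curve[OF y] self_mem_point[OF v0]] sing_not_smooth[OF m] by blast
      then show "good_pt F (v x y) m" using gd[OF y _ m] all by blast
    qed
    then have "(\<Sum>x\<in>X. S x) = (\<Sum>x\<in>X. order x r)" using loc by simp
    then show "(\<Sum>s\<in>A. contribution F s) = d * (3 * (d - 2))" using sumS sumD by simp
  qed
qed

theorem corollary1p4: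
  fixes F :: poly3 and d s :: nat and n :: "nat \<Rightarrow> nat"
  assumes "d \<ge> 3"
    and "reduced_curve d F"
    and "\<And>G. is_component G F \<Longrightarrow> \<not> is_line G"
    and "finite (singular_points F)" and "card (singular_points F) = s"
    and "\<And>k. n k = card {p \<in> singular_points F. multiplicity_at F p = k}"
  shows "total_inflection F \<le> 3 * int d * (int d - 2) - 6 * int s \<and>
    total_inflection F \<le> 3 * int d * (int d - 2)
      - (\<Sum>k\<in>multiplicity_at F ` singular_points F. 3 * int k * (int k - 1) * int (n k)) \<and>
    (total_inflection F = 3 * int d * (int d - 2)
      - (\<Sum>k\<in>multiplicity_at F ` singular_points F. 3 * int k * (int k - 1) * int (n k))
     \<longleftrightarrow> (\<forall>p\<in>singular_points F. \<exists>k. ordinary_simple_multiple_point F k p))"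
proof -
  have hom: "homogeneous d F" and sq: "squarefree F" using assms(2) by (auto simp: reduced_curve_def)
  have F: "F \<noteq> 0" using sq by auto
  have d2: "d \<ge> 2" using assms(1) by simp
  define S where "S = singular_points F"
  define A where "A = {p \<in> curve_points F. contribution F p > 0}"
  define g where "g = (\<lambda>k. 3 * int k * (int k - 1))"
  note IF = inflection_formula[OF hom assms(1) F assms(3) assms(4), folded A_def S_def]
  have finS: "finite S" using assms(4) by (simp add: S_def)
  have Sc: "p \<in> curve_points F" if "p \<in> S" for p using that by (simp add: S_def singular_points_def)
  have m2: "multiplicity_at F p \<ge> 2" if "p \<in> S" for p
  proof -
    have "coords p \<in> p" using coords_mem Sc[OF that] by (simp add: curve_points_def)
    then show ?thesis
      using point_type(1)[OF hom F assms(3) Sc[OF that]] that by (auto simp: S_def sing_pt_def)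
  qed
  have cS: "int (contribution F p) = g (multiplicity_at F p)" if "p \<in> S" for p
    using m2[OF that] that by (simp add: contribution_def S_def g_def of_nat_diff)
  \<comment> \<open>With the finiteness of \<open>A\<close> this also shows that there are finitely
    many inflection points, so \<open>total_inflection\<close> is a genuine sum and not the default
    value 0 of an infinite one.\<close>
  have AS: "A = S \<union> inflection_points F"
  proof (intro set_eqI iffI)
    fix p assume p: "p \<in> A"
    show "p \<in> S \<union> inflection_points F"
      using p by (cases "p \<in> S") (auto simp: A_def S_def contribution_def inflection_points_def)
  next
    fix p assume "p \<in> S \<union> inflection_points F"
    then show "p \<in> A"
    proof
      assume p: "p \<in> S"
      then show ?thesis using Sc[OF p] m2[OF p] by (simp add: A_def contribution_def S_def)
    qed (auto simp: A_def S_def contribution_def inflection_points_def)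
  qed
  have disj: "S \<inter> inflection_points F = {}" by (auto simp: S_def inflection_points_def)
  have "int (\<Sum>p\<in>A. contribution F p) = (\<Sum>p\<in>S. int (contribution F p)) + (\<Sum>p\<in>inflection_points F. int (contribution F p))"
    unfolding of_nat_sum using IF(1) disj unfolding AS by (intro sum.union_disjoint) auto
  also have "(\<Sum>p\<in>inflection_points F. int (contribution F p)) = total_inflection F"
    unfolding total_inflection_def
    by (intro sum.cong) (auto simp: contribution_def inflection_points_def)
  also have "(\<Sum>p\<in>S. int (contribution F p)) = (\<Sum>p\<in>S. g (multiplicity_at F p))"
    by (intro sum.cong) (auto simp: cS)
  finally have total: "int (\<Sum>p\<in>A. contribution F p) = (\<Sum>p\<in>S. g (multiplicity_at F p)) + total_inflection F" .
  have "(\<Sum>p\<in>S. g (multiplicity_at F p)) =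
      (\<Sum>k\<in>multiplicity_at F ` S. \<Sum>p\<in>{p\<in>S. multiplicity_at F p = k}. g (multiplicity_at F p))"
    by (rule sum.image_gen[OF finS])
  also have "\<dots> = (\<Sum>k\<in>multiplicity_at F ` S. g k * int (n k))"
  proof (intro sum.cong refl)
    fix k
    have "(\<Sum>p\<in>{p\<in>S. multiplicity_at F p = k}. g (multiplicity_at F p)) = (\<Sum>p\<in>{p\<in>S. multiplicity_at F p = k}. g k)"
      by (intro sum.cong) auto
    then show "(\<Sum>p\<in>{p\<in>S. multiplicity_at F p = k}. g (multiplicity_at F p)) = g k * int (n k)"
      by (simp add: assms(6) S_def)
  qed
  finally have gS: "(\<Sum>p\<in>S. g (multiplicity_at F p)) = (\<Sum>k\<in>multiplicity_at F ` S. g k * int (n k))" .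
  have D: "int (d * (3 * (d - 2))) = 3 * int d * (int d - 2)" using d2 by (simp add: of_nat_diff)
  have "6 * int s = (\<Sum>p\<in>S. 6)" using assms(5) by (simp add: S_def)
  also have "\<dots> \<le> (\<Sum>p\<in>S. g (multiplicity_at F p))"
  proof (intro sum_mono)
    fix p assume p: "p \<in> S"
    \<comment> \<open>Singular points have multiplicity at least 2, so 3m(m - 1) is at least 6; the
      coarser bound is a consequence of the finer one.\<close>
    have "int (multiplicity_at F p) * (int (multiplicity_at F p) - 1) \<ge> 2 * 1"
      using m2[OF p] by (intro mult_mono) auto
    then show "6 \<le> g (multiplicity_at F p)" by (simp add: g_def)
  qed
  finally have s6: "6 * int s \<le> (\<Sum>k\<in>multiplicity_at F ` S. g k * int (n k))" unfolding gS .
  have le: "(\<Sum>k\<in>multiplicity_at F ` S. g k * int (n k)) + total_inflection F \<le> 3 * int d * (int d - 2)"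
    unfolding D[symmetric] gS[symmetric] total[symmetric] of_nat_le_iff by (rule IF(2))
  moreover have "(\<Sum>k\<in>multiplicity_at F ` S. g k * int (n k)) + total_inflection F = 3 * int d * (int d - 2)
      \<longleftrightarrow> (\<forall>p\<in>S. \<exists>k. ordinary_simple_multiple_point F k p)"
    unfolding D[symmetric] gS[symmetric] total[symmetric] of_nat_eq_iff by (rule IF(3))
  ultimately show ?thesis using s6 unfolding g_def S_def by linarith
qed

end
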